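(* The sharp threshold bias for the $(a:1)$ Hamiltonicity game between RandomMaker and CleverBreaker (played on the edge set of $K_n$) is $\ln\ln n$. That is, for every $\epsilon>0$: (a) RandomMaker wins the $((1+\epsilon)\ln\ln n:1)$-biased Hamiltonicity game a.a.s. against any strategy of CleverBreaker; and (b) CleverBreaker has a strategy against which RandomMaker loses the $((1-\epsilon)\ln\ln n:1)$-biased Hamiltonicity game a.a.s.
   Context: In an $(a:1)$-biased Maker-Breaker game on $E(K_n)$, Maker and Breaker alternately take turns claiming previously unclaimed (free) edges of the complete graph $K_n$; Maker goes first, Maker claims $a$ edges in each of his turns and Breaker claims $1$ edge in each of his turns, until no free edge is left (if fewer edges remain than a player should claim, he claims all of them). Maker wins the Hamiltonicity game if the graph formed by the edges he claimed contains a Hamilton cycle of $K_n$; otherwise Breaker wins. RandomMaker is a Maker each of whose moves (a move is the claiming of one edge) is a uniformly random edge among all currently free edges. CleverBreaker plays according to a strategy, i.e. a set of rules specifying what he does in every possible game situation. "Game" and "strategy" mean a sequence of games and a sequence of strategies, one for each number $n$ of vertices. "A.a.s." means with probability tending to $1$ as $n\to\infty$. Biases are integers; rounding of non-integer quantities is omitted (it does not affect the asymptotic statement). Definition: a function $f(n)$ is a sharp threshold bias of the $(a:1)$ half-random game between RandomMaker and CleverBreaker if for every $\epsilon>0$: (a) RandomMaker wins the $((1+\epsilon)f(n):1)$-biased game a.a.s. against any strategy of CleverBreaker, and (b) CleverBreaker has a strategy against which RandomMaker loses the $((1-\epsilon)f(n):1)$-biased game a.a.s. *)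

theory Defs
  imports "HOL-Probability.Probability"
begin

text \<open>The board: edges of \<open>K_n\<close> on the vertex set \<open>{0..<n}\<close>.\<close>

definition complete_edges :: "nat \<Rightarrow> nat set set" where
  "complete_edges n = {e. e \<subseteq> {0..<n} \<and> card e = 2}"

datatype player = Maker | Breaker

text \<open>A game situation is the full sequence of moves made so far, the most recent one first.\<close>

type_synonym history = "(player \<times> nat set) list"

definition claimed :: "player \<Rightarrow> history \<Rightarrow> nat set set" where
  "claimed p h = {e. (p, e) \<in> set h}"

definition free :: "nat \<Rightarrow> history \<Rightarrow> nat set set" where
  "free n h = complete_edges n - claimed Maker h - claimed Breaker h"

text \<open>A strategy of CleverBreaker may depend on the whole history (hence on everything seen so
  far, including the order of moves). The edge it names must be free whenever a free edge is left;
  its value at histories without a free edge is irrelevant. Quantifying over all histories,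
  including those that no play produces, costs no generality.\<close>

type_synonym strategy = "history \<Rightarrow> nat set"

definition breaker_strategy :: "nat \<Rightarrow> strategy \<Rightarrow> bool" where
  "breaker_strategy n \<sigma> \<longleftrightarrow> (\<forall>h. free n h \<noteq> {} \<longrightarrow> \<sigma> h \<in> free n h)"

text \<open>In \<open>random_maker_turn n k h\<close>, RandomMaker claims \<open>k\<close> edges one after the other (all the
  remaining ones if fewer than \<open>k\<close> are free), each uniform among the edges free at that moment.\<close>

primrec random_maker_turn :: "nat \<Rightarrow> nat \<Rightarrow> history \<Rightarrow> history pmf" where
  "random_maker_turn n 0 h = return_pmf h"
| "random_maker_turn n (Suc k) h =
     (if free n h = {} then return_pmf h
      else bind_pmf (pmf_of_set (free n h)) (\<lambda>e. random_maker_turn n k ((Maker, e) # h)))"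

definition breaker_turn :: "nat \<Rightarrow> strategy \<Rightarrow> history \<Rightarrow> history" where
  "breaker_turn n \<sigma> h = (if free n h = {} then h else (Breaker, \<sigma> h) # h)"

primrec rounds :: "nat \<Rightarrow> nat \<Rightarrow> strategy \<Rightarrow> nat \<Rightarrow> history pmf" where
  "rounds n a \<sigma> 0 = return_pmf []"
| "rounds n a \<sigma> (Suc r) =
     bind_pmf (rounds n a \<sigma> r) (\<lambda>h. map_pmf (breaker_turn n \<sigma>) (random_maker_turn n a h))"

text \<open>Every round claims at least one edge while a free edge is left, and changes nothing
  afterwards, so the game is over after as many rounds as there are edges.\<close>

definition half_random_game :: "nat \<Rightarrow> nat \<Rightarrow> strategy \<Rightarrow> history pmf" where
  "half_random_game n a \<sigma> = rounds n a \<sigma> (card (complete_edges n))"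

text \<open>A game (more precisely a sequence of games, one for each \<open>n\<close>) is given by the predicate
  \<open>W\<close>: Maker wins on \<open>K_n\<close> iff the set \<open>G\<close> of his edges satisfies \<open>W n G\<close>.\<close>

definition maker_wins :: "(nat \<Rightarrow> nat set set \<Rightarrow> bool) \<Rightarrow> nat \<Rightarrow> history \<Rightarrow> bool" where
  "maker_wins W n h \<longleftrightarrow> W n (claimed Maker h)"

text \<open>Biases are integers, and the definition below asks for its two clauses under every way of
  rounding the prescribed real bias up or down, independently for each \<open>n\<close>. Negative values
  (\<open>\<epsilon> > 1\<close> in the second clause, or small \<open>n\<close>) become the bias \<open>0\<close>.\<close>

definition rounding_of :: "(nat \<Rightarrow> nat) \<Rightarrow> (nat \<Rightarrow> real) \<Rightarrow> bool" where
  "rounding_of a x \<longleftrightarrow> (\<forall>n. a n = nat \<lfloor>x n\<rfloor> \<or> a n = nat \<lceil>x n\<rceil>)"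

definition sharp_threshold_bias ::
    "(nat \<Rightarrow> nat set set \<Rightarrow> bool) \<Rightarrow> (nat \<Rightarrow> real) \<Rightarrow> bool" where
  "sharp_threshold_bias W f \<longleftrightarrow>
     (\<forall>\<epsilon>>0.
        (\<forall>a. rounding_of a (\<lambda>n. (1 + \<epsilon>) * f n) \<longrightarrow>
           (\<forall>\<sigma>. (\<forall>n. breaker_strategy n (\<sigma> n)) \<longrightarrow>
              (\<lambda>n. measure_pmf.prob (half_random_game n (a n) (\<sigma> n)) {h. maker_wins W n h})
                \<longlonglongrightarrow> 1)) \<and>
        (\<forall>a. rounding_of a (\<lambda>n. (1 - \<epsilon>) * f n) \<longrightarrow>
           (\<exists>\<sigma>. (\<forall>n. breaker_strategy n (\<sigma> n)) \<and>
              (\<lambda>n. measure_pmf.prob (half_random_game n (a n) (\<sigma> n)) {h. \<not> maker_wins W n h})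
                \<longlonglongrightarrow> 1)))"

definition has_hamilton_cycle :: "nat \<Rightarrow> nat set set \<Rightarrow> bool" where
  "has_hamilton_cycle n G \<longleftrightarrow>
     n \<ge> 3 \<and>
     (\<exists>vs. distinct vs \<and> set vs = {0..<n} \<and>
        (\<forall>i<n. {vs ! i, vs ! (Suc i mod n)} \<in> G))"

end

theory Submission
  imports Defs "HOL-Real_Asymp.Real_Asymp"
begin

text \<open>Let \<open>a\<close> be Maker's bias. If Breaker spends all his moves on one vertex that Maker has not
  touched, he takes its last edge after about \<open>n\<close> rounds. While the vertex has \<open>k\<close> free edges a random
  move of Maker hits it with probability about \<open>2 * k / n\<^sup>2\<close>, and there are \<open>a\<close> moves for every
  \<open>k \<le> n\<close>, so the vertex ends up isolated with probability about \<open>exp (- a)\<close>. Untouched vertices exist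
  until Maker has made about \<open>n * ln n / 2\<close> moves, which is time for about \<open>ln n / (2 * a)\<close> such
  sieges. The game is therefore decided by whether \<open>ln n * exp (- a)\<close> is large or small, that is, by
  the comparison of \<open>a\<close> with \<open>ln (ln n)\<close>.

  Below the threshold Breaker always claims an edge at the untouched vertex with the fewest free edges.
  Every block of \<open>n\<close> rounds that starts with an untouched vertex isolates a vertex with probability
  at least \<open>exp (- a - 3)\<close> (\<open>not_isolated_block\<close>, \<open>hit_free_lower_bound\<close>). The number \<open>u\<close> of untouched
  vertices stays positive for long enough because the expectation of \<open>1 / (u + 1)\<close> grows only by a
  factor \<open>1 + O(1 / n)\<close> per move (\<open>all_touched_prob\<close>). With \<open>(ln n) powr (1 - \<epsilon> / 2)\<close> blocks
  the probability that no vertex gets isolated vanishes.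

  Above the threshold fix a small \<open>\<delta>\<close> and look at the game after about \<open>(10 / \<delta>) * n * ln n\<close> moves
  of Maker. Only \<open>O(ln n)\<close> vertices have by then lost a proportion \<open>\<delta>\<close> of their edges. Call a vertex
  exhausted if fewer than \<open>\<delta> * n\<close> of its edges are free. From the moment at which a vertex has lost the
  first \<open>\<delta> * n\<close> edges until it is exhausted Maker hits it about \<open>a\<close> times on average. An
  exponential supermartingale shows that it collects fewer than 8 hits with probability at most
  about \<open>exp (- (1 - 7 * \<delta>) * a)\<close>, and as \<open>ln n * exp (- (1 - 7 * \<delta>) * a)\<close> tends to 0 there is no such
  vertex (\<open>starved_prob\<close>). Only hits whose other end has not been used before are counted, so the
  exhausted vertices have disjoint sets of 8 neighbours each, and sets of exhausted vertices
  expand (\<open>fresh_nbrs\<close>). A vertex that is not exhausted has had \<open>\<delta> * n\<close> free edges throughout, and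
  a union bound shows that sets of such vertices expand as well (\<open>poor_expansion_prob\<close>). Both
  expansions are strong enough to survive mixing the two kinds of vertices (\<open>expansion_combine\<close>).

  So Maker's graph is a connected expander, and by the rotation argument of Posa it has quadratically
  many boosters as long as it is not Hamiltonian: edges that lengthen a longest path or close a
  Hamilton cycle (\<open>many_boosters\<close>). Breaker has claimed far fewer edges than that, so each further
  move of Maker hits a free booster with probability bounded away from 0, and at most \<open>n\<close> boosters are
  needed (\<open>booster_phase\<close>).\<close>

section \<open>Expectations along a half-random play\<close>

text \<open>In a valid history every move has removed exactly one free edge, so its length serves as a clock
  (\<open>card_free\<close>). All estimates below are made on valid histories, for either player to move.\<close>

fun valid :: "nat \<Rightarrow> history \<Rightarrow> bool" where
  "valid n [] = True"
| "valid n ((p, e) # h) = (e \<in> free n h \<and> valid n h)"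

abbreviation expec :: "'a pmf \<Rightarrow> ('a \<Rightarrow> real) \<Rightarrow> real" where
  "expec p f \<equiv> measure_pmf.expectation p f"

lemma finite_complete_edges [simp]: "finite (complete_edges n)"
  by (rule finite_subset[of _ "Pow {0..<n}"]) (auto simp: complete_edges_def)

lemma real_choose_2: "real (n choose 2) = n * (real n - 1) / 2"
proof (cases n)
  case (Suc m)
  have "even (n * (n - 1))" using Suc by simp
  then have "2 * (n choose 2) = n * (n - 1)" by (simp only: choose_two dvd_mult_div_cancel)
  then have "2 * real (n choose 2) = real n * real (n - 1)" by (metis of_nat_mult of_nat_numeral)
  then show ?thesis using Suc by simp
qed simp

lemma finite_free [simp]: "finite (free n h)"
  by (simp add: free_def)

lemma card_complete_edges: "card (complete_edges n) = n choose 2"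
  unfolding complete_edges_def using n_subsets[of "{0..<n}" 2] by simp

lemma claimed_Nil [simp]: "claimed p [] = {}"
  by (simp add: claimed_def)

lemma claimed_Cons [simp]:
  "claimed p ((q, e) # h) = (if p = q then insert e (claimed p h) else claimed p h)"
  by (auto simp: claimed_def)

lemma free_Nil [simp]: "free n [] = complete_edges n"
  by (simp add: free_def)

lemma free_Cons [simp]: "free n ((p, e) # h) = free n h - {e}"
  by (cases p) (auto simp: free_def)

lemma free_subset: "free n h \<subseteq> complete_edges n"
  by (auto simp: free_def)

lemma card_free: "valid n h \<Longrightarrow> card (free n h) + length h = n choose 2"
proof (induction n h rule: valid.induct)
  case (2 n p e h)
  then have "card (free n h) > 0" by (auto simp: card_gt_0_iff)
  with 2 show ?case by simp
qed (simp add: card_complete_edges)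

lemma free_nonempty: "valid n h \<Longrightarrow> length h < n choose 2 \<Longrightarrow> free n h \<noteq> {}"
  using card_free[of n h] by auto

lemma finite_set_pmf_maker_turn [simp]: "finite (set_pmf (random_maker_turn n k h))"
  by (induction k arbitrary: h) (auto simp: set_pmf_of_set)

lemma finite_set_pmf_rounds [simp]: "finite (set_pmf (rounds n a \<sigma> r))"
  by (induction r) auto

lemma maker_turn_valid:
  assumes "valid n h" "length h + k \<le> n choose 2" "h' \<in> set_pmf (random_maker_turn n k h)"
  shows "valid n h' \<and> length h' = length h + k"
  using assms
proof (induction k arbitrary: h)
  case (Suc k)
  have ne: "free n h \<noteq> {}" using Suc.prems free_nonempty[of n h] by simp
  with Suc.prems(3) obtain e where "e \<in> free n h" "h' \<in> set_pmf (random_maker_turn n k ((Maker, e) # h))"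
    by (auto simp: set_pmf_of_set)
  with Suc.IH[of "(Maker, e) # h"] Suc.prems show ?case by simp
qed simp

lemma breaker_turn_valid:
  assumes "valid n h" "length h < n choose 2" "breaker_strategy n \<sigma>"
  shows "breaker_turn n \<sigma> h = (Breaker, \<sigma> h) # h" "\<sigma> h \<in> free n h"
  using free_nonempty[OF assms(1,2)] assms(3) by (auto simp: breaker_turn_def breaker_strategy_def)

lemma rounds_valid:
  assumes "breaker_strategy n \<sigma>" "r * (a + 1) \<le> n choose 2" "h \<in> set_pmf (rounds n a \<sigma> r)"
  shows "valid n h \<and> length h = r * (a + 1)"
  using assms(2,3)
proof (induction r arbitrary: h)
  case (Suc r)
  then obtain h0 h1 where h: "h0 \<in> set_pmf (rounds n a \<sigma> r)"
    "h1 \<in> set_pmf (random_maker_turn n a h0)" "h = breaker_turn n \<sigma> h1"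
    by auto
  have h0: "valid n h0" "length h0 = r * (a + 1)" using Suc.IH[OF _ h(1)] Suc.prems by auto
  have h1: "valid n h1" "length h1 = r * (a + 1) + a"
    using maker_turn_valid[OF h0(1) _ h(2)] h0 Suc.prems by auto
  show ?case using breaker_turn_valid[OF h1(1) _ assms(1)] h1 h(3) Suc.prems by simp
qed simp

text \<open>All distributions of the game are finitely supported, and this takes care of integrability.\<close>

lemma expec_bind:
  assumes "finite (set_pmf p)" "\<And>x. x \<in> set_pmf p \<Longrightarrow> finite (set_pmf (f x))"
  shows "expec (bind_pmf p f) g = expec p (\<lambda>x. expec (f x) g)"
proof -
  have "expec (bind_pmf p f) g = (\<Sum>a\<in>set_pmf p. pmf p a *\<^sub>R expec (f a) g)"
    by (rule pmf_expectation_bind) (use assms in auto)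
  also have "\<dots> = expec p (\<lambda>x. expec (f x) g)"
    by (subst integral_measure_pmf[of "set_pmf p"]) (use assms in auto)
  finally show ?thesis .
qed

lemma expec_mono:
  assumes "finite (set_pmf p)" "\<And>x. x \<in> set_pmf p \<Longrightarrow> f x \<le> g x"
  shows "expec p f \<le> expec p g"
proof -
  have "expec p f = (\<Sum>a\<in>set_pmf p. pmf p a * f a)" for f
    by (subst integral_measure_pmf[of "set_pmf p"]) (use assms in auto)
  then show ?thesis using assms by (auto intro!: sum_mono mult_left_mono)
qed

lemma prob_eq_expec: "measure_pmf.prob p {h. Q h} = expec p (\<lambda>h. of_bool (Q h))"
proof -
  have "(\<lambda>h. of_bool (Q h)) = (indicator {h. Q h} :: _ \<Rightarrow> real)"
    by (auto simp: indicator_def)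
  then show ?thesis by simp
qed

text \<open>The potential \<open>P i h\<close> may depend on the number \<open>i\<close> of moves that Maker still has in his current turn.
  The hypothesis only concerns histories whose length lies between \<open>L0\<close> and \<open>L\<close>, so that a bound on
  the number of moves made so far can enter every step.\<close>

lemma expec_maker_turn_le:
  assumes step: "\<And>i h. i < k0 \<Longrightarrow> valid n h \<Longrightarrow> L0 \<le> length h \<Longrightarrow> length h < L \<Longrightarrow>
      (\<Sum>e\<in>free n h. P i ((Maker, e) # h)) \<le> real (card (free n h)) * P (Suc i) h"
    and "L \<le> n choose 2" "valid n h" "length h + k \<le> L" "k \<le> k0" "L0 \<le> length h"
  shows "expec (random_maker_turn n k h) (P 0) \<le> P k h"
  using assms(3,4,5,6)
proof (induction k arbitrary: h)
  case (Suc k)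
  have ne: "free n h \<noteq> {}" using Suc.prems assms(2) free_nonempty[of n h] by simp
  then have c: "card (free n h) > 0" by (simp add: card_gt_0_iff)
  have "expec (random_maker_turn n (Suc k) h) (P 0) =
      expec (pmf_of_set (free n h)) (\<lambda>e. expec (random_maker_turn n k ((Maker, e) # h)) (P 0))"
    using ne by (simp add: expec_bind)
  also have "\<dots> \<le> expec (pmf_of_set (free n h)) (\<lambda>e. P k ((Maker, e) # h))"
    using Suc ne by (intro expec_mono) auto
  also have "\<dots> = (\<Sum>e\<in>free n h. P k ((Maker, e) # h)) / card (free n h)"
    using ne by (subst integral_pmf_of_set) auto
  also have "\<dots> \<le> P (Suc k) h"
    using step[of k h] Suc.prems c by (simp add: divide_le_eq mult.commute)
  finally show ?case .
qed simp

lemma expec_rounds_Suc_le: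
  assumes "breaker_strategy n \<sigma>" "Suc r * (a + 1) \<le> n choose 2"
    and "\<And>h. valid n h \<Longrightarrow> length h = r * (a + 1) \<Longrightarrow>
          expec (random_maker_turn n a h) (\<lambda>h'. f (breaker_turn n \<sigma> h')) \<le> g h"
  shows "expec (rounds n a \<sigma> (Suc r)) f \<le> expec (rounds n a \<sigma> r) g"
proof -
  have "expec (rounds n a \<sigma> (Suc r)) f =
      expec (rounds n a \<sigma> r) (\<lambda>h. expec (random_maker_turn n a h) (\<lambda>h'. f (breaker_turn n \<sigma> h')))"
    by (simp add: expec_bind)
  also have "\<dots> \<le> expec (rounds n a \<sigma> r) g"
    using assms(2) by (intro expec_mono) (auto dest!: rounds_valid[OF assms(1), rotated] intro!: assms(3))
  finally show ?thesis .
qed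

text \<open>All events of interest are persistent or are read off at a fixed time. Their probabilities are
  therefore bounded by any potential that decreases on average in each move, whatever Breaker does.\<close>

lemma expec_rounds_supermartingale:
  assumes \<sigma>: "breaker_strategy n \<sigma>" and L: "(r + s) * (a + 1) \<le> n choose 2"
    and maker: "\<And>i h. i < a \<Longrightarrow> valid n h \<Longrightarrow> r * (a + 1) \<le> length h \<Longrightarrow> length h < (r + s) * (a + 1) \<Longrightarrow>
      (\<Sum>e\<in>free n h. P i ((Maker, e) # h)) \<le> real (card (free n h)) * P (Suc i) h"
    and breaker: "\<And>e h. valid n h \<Longrightarrow> r * (a + 1) \<le> length h \<Longrightarrow> length h < (r + s) * (a + 1) \<Longrightarrow> e \<in> free n h \<Longrightarrow>
      P a ((Breaker, e) # h) \<le> c * P 0 h"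
    and c: "c \<ge> 0"
  shows "expec (rounds n a \<sigma> (r + s)) (P a) \<le> c ^ s * expec (rounds n a \<sigma> r) (P a)"
  using L maker breaker
proof (induction s)
  case (Suc s)
  have "expec (rounds n a \<sigma> (Suc (r + s))) (P a) \<le> expec (rounds n a \<sigma> (r + s)) (\<lambda>h. c * P a h)"
  proof (rule expec_rounds_Suc_le[OF \<sigma>])
    show "Suc (r + s) * (a + 1) \<le> n choose 2" using Suc.prems by simp
    fix h assume h: "valid n h" "length h = (r + s) * (a + 1)"
    have "expec (random_maker_turn n a h) (\<lambda>h'. P a (breaker_turn n \<sigma> h'))
        \<le> expec (random_maker_turn n a h) (\<lambda>h'. c * P 0 h')"
    proof (rule expec_mono)
      fix h' assume "h' \<in> set_pmf (random_maker_turn n a h)"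
      from maker_turn_valid[OF h(1) _ this] h Suc.prems(1)
      have h': "valid n h'" "length h' = (r + s) * (a + 1) + a" by auto
      then have l: "length h' < n choose 2" "r * (a + 1) \<le> length h'" "length h' < (r + Suc s) * (a + 1)"
        using Suc.prems(1) by (auto simp: algebra_simps)
      from breaker_turn_valid[OF h'(1) l(1) \<sigma>] Suc.prems(3)[OF h'(1) l(2,3)]
      show "P a (breaker_turn n \<sigma> h') \<le> c * P 0 h'" by simp
    qed simp
    also have "\<dots> = c * expec (random_maker_turn n a h) (P 0)" by simp
    also have "\<dots> \<le> c * P a h"
      using mult_right_mono[of r "r + s" "a + 1"] h Suc.prems c
      by (intro mult_left_mono expec_maker_turn_le[of a n "r * (a + 1)" "(r + Suc s) * (a + 1)"]) auto
    finally show "expec (random_maker_turn n a h) (\<lambda>h'. P a (breaker_turn n \<sigma> h')) \<le> c * P a h" .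
  qed
  also have "\<dots> = c * expec (rounds n a \<sigma> (r + s)) (P a)" by simp
  also have "\<dots> \<le> c * (c ^ s * expec (rounds n a \<sigma> r) (P a))"
    using Suc.prems by (intro mult_left_mono Suc.IH c) auto
  finally show ?case by (simp add: mult.assoc)
qed simp

text \<open>The form in which most potentials occur: every move of Maker shrinks (or inflates) the expectation
  by the same factor \<open>c\<close>, and moves of Breaker do not increase the potential.\<close>

lemma expec_rounds_geometric:
  assumes \<sigma>: "breaker_strategy n \<sigma>" and L: "(r + s) * (a + 1) \<le> n choose 2" and c: "c > 0"
    and maker: "\<And>h. valid n h \<Longrightarrow> r * (a + 1) \<le> length h \<Longrightarrow> length h < (r + s) * (a + 1) \<Longrightarrow>
      (\<Sum>e\<in>free n h. \<Psi> ((Maker, e) # h)) \<le> real (card (free n h)) * (c * \<Psi> h)"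
    and breaker: "\<And>e h. valid n h \<Longrightarrow> r * (a + 1) \<le> length h \<Longrightarrow> length h < (r + s) * (a + 1) \<Longrightarrow> e \<in> free n h \<Longrightarrow>
      \<Psi> ((Breaker, e) # h) \<le> \<Psi> h"
  shows "expec (rounds n a \<sigma> (r + s)) \<Psi> \<le> c ^ (a * s) * expec (rounds n a \<sigma> r) \<Psi>"
proof -
  define P where "P i h = c ^ i * \<Psi> h" for i h
  have "expec (rounds n a \<sigma> (r + s)) (P a) \<le> (c ^ a) ^ s * expec (rounds n a \<sigma> r) (P a)"
  proof (rule expec_rounds_supermartingale[OF \<sigma> L])
    fix i h assume "valid n h" "r * (a + 1) \<le> length h" "length h < (r + s) * (a + 1)"
    from mult_left_mono[OF maker[OF this], of "c ^ i"] c
    show "(\<Sum>e\<in>free n h. P i ((Maker, e) # h)) \<le> real (card (free n h)) * P (Suc i) h"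
      by (simp add: P_def sum_distrib_left[symmetric] mult_ac)
  next
    fix e h assume "valid n h" "r * (a + 1) \<le> length h" "length h < (r + s) * (a + 1)" "e \<in> free n h"
    from breaker[OF this] c show "P a ((Breaker, e) # h) \<le> c ^ a * P 0 h" by (simp add: P_def)
  qed (use c in auto)
  then have "c ^ a * expec (rounds n a \<sigma> (r + s)) \<Psi> \<le> c ^ a * (c ^ (a * s) * expec (rounds n a \<sigma> r) \<Psi>)"
    unfolding P_def by (simp add: power_mult mult_ac)
  then show ?thesis using c by simp
qed

lemma maker_turn_persistent:
  assumes Q: "\<And>p e h. Q h \<Longrightarrow> e \<in> free n h \<Longrightarrow> Q ((p, e) # h)"
    and "Q h" "h' \<in> set_pmf (random_maker_turn n k h)"
  shows "Q h'"
  using assms(2,3) by (induction k arbitrary: h) (auto split: if_splits simp: set_pmf_of_set dest: Q)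

text \<open>This is how a statement about an early round is carried over to the end of the game.\<close>

lemma prob_persistent:
  assumes Q: "\<And>p e h. Q h \<Longrightarrow> e \<in> free n h \<Longrightarrow> Q ((p, e) # h)" and \<sigma>: "breaker_strategy n \<sigma>"
    and "r \<le> r'"
  shows "measure_pmf.prob (rounds n a \<sigma> r) {h. Q h} \<le> measure_pmf.prob (rounds n a \<sigma> r') {h. Q h}"
proof -
  have mt: "Q h'" if "Q h" "h' \<in> set_pmf (random_maker_turn n k h)" for h h' k
    by (rule maker_turn_persistent[where Q = Q, OF _ that]) (rule Q)
  have bt: "Q (breaker_turn n \<sigma> h)" if "Q h" for h
    using that \<sigma> by (auto simp: breaker_turn_def breaker_strategy_def intro!: Q)
  have one: "expec (rounds n a \<sigma> r) (\<lambda>h. of_bool (Q h)) \<le> expec (rounds n a \<sigma> (Suc r)) (\<lambda>h. of_bool (Q h))" for r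
  proof -
    have "expec (rounds n a \<sigma> r) (\<lambda>h. of_bool (Q h)) \<le> expec (rounds n a \<sigma> r)
        (\<lambda>h. expec (map_pmf (breaker_turn n \<sigma>) (random_maker_turn n a h)) (\<lambda>h. of_bool (Q h)))"
    proof (rule expec_mono)
      fix h
      show "of_bool (Q h) \<le> expec (map_pmf (breaker_turn n \<sigma>) (random_maker_turn n a h)) (\<lambda>h. of_bool (Q h))"
      proof (cases "Q h")
        case True
        have "expec (map_pmf (breaker_turn n \<sigma>) (random_maker_turn n a h)) (\<lambda>h. 1)
          \<le> expec (map_pmf (breaker_turn n \<sigma>) (random_maker_turn n a h)) (\<lambda>h. of_bool (Q h))"
          using True by (intro expec_mono) (auto intro: bt dest: mt)
        then show ?thesis using True by simp
      qed simp
    qed simp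
    then show ?thesis by (simp add: expec_bind)
  qed
  have "expec (rounds n a \<sigma> r) (\<lambda>h. of_bool (Q h)) \<le> expec (rounds n a \<sigma> r') (\<lambda>h. of_bool (Q h))"
    using \<open>r \<le> r'\<close> by (induction rule: dec_induct) (use one order.trans in blast)+
  then show ?thesis by (simp add: prob_eq_expec)
qed

definition fdeg :: "nat \<Rightarrow> history \<Rightarrow> nat \<Rightarrow> nat" where
  "fdeg n h v = card {e \<in> free n h. v \<in> e}"

lemma fdeg_Cons:
  assumes "e \<in> free n h"
  shows "fdeg n ((p, e) # h) v = (if v \<in> e then fdeg n h v - 1 else fdeg n h v)"
proof -
  have "{e' \<in> free n ((p, e) # h). v \<in> e'} = {e' \<in> free n h. v \<in> e'} - {e}" by auto
  then show ?thesis using assms by (auto simp: fdeg_def)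
qed

lemma fdeg_pos: "e \<in> free n h \<Longrightarrow> v \<in> e \<Longrightarrow> fdeg n h v > 0"
  by (auto simp: fdeg_def card_gt_0_iff)

lemma fdeg_le: "fdeg n h v \<le> n - 1"
proof (cases "v < n")
  case True
  have "{e \<in> free n h. v \<in> e} \<subseteq> (\<lambda>w. {v, w}) ` ({0..<n} - {v})"
  proof safe
    fix e assume e: "e \<in> free n h" "v \<in> e"
    then have "e \<subseteq> {0..<n}" "card e = 2" using free_subset[of n h] by (auto simp: complete_edges_def)
    with e obtain w where "e = {v, w}" "w < n" "w \<noteq> v" by (fastforce simp: card_2_iff)
    then show "e \<in> (\<lambda>w. {v, w}) ` ({0..<n} - {v})" by auto
  qed
  from card_mono[OF _ this] show ?thesis
    unfolding fdeg_def using card_image_le[of "{0..<n} - {v}" "\<lambda>w. {v, w}"] True by simp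
next
  case False
  then have "{e \<in> free n h. v \<in> e} = {}"
    using free_subset[of n h] unfolding complete_edges_def by fastforce
  then show ?thesis by (simp only: fdeg_def card.empty)
qed

section \<open>Breaker isolates a vertex below the threshold\<close>

definition untouched :: "nat \<Rightarrow> history \<Rightarrow> nat \<Rightarrow> bool" where
  "untouched n h v \<longleftrightarrow> v < n \<and> (\<forall>e\<in>claimed Maker h. v \<notin> e)"

text \<open>For \<open>k = 0\<close> this says that some vertex is isolated in Maker's graph for good.\<close>

definition isolable :: "nat \<Rightarrow> nat \<Rightarrow> history \<Rightarrow> bool" where
  "isolable n k h \<longleftrightarrow> (\<exists>v. untouched n h v \<and> fdeg n h v \<le> k)"

text \<open>Choosing the untouched vertex with the fewest free edges makes the strategy memoryless: the minimum
  falls in every round in which Maker misses its witness, and after a hit the next target is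
  whatever untouched vertex is cheapest.\<close>

definition attack :: "nat \<Rightarrow> strategy" where
  "attack n h =
     (if \<exists>v. untouched n h v \<and> fdeg n h v > 0
      then (SOME e. e \<in> free n h \<and> (ARG_MIN (fdeg n h) v. untouched n h v \<and> fdeg n h v > 0) \<in> e)
      else (SOME e. e \<in> free n h))"

lemma attack_free_min:
  assumes "untouched n h v" "fdeg n h v > 0"
  obtains w where "untouched n h w" "fdeg n h w \<le> fdeg n h v" "attack n h \<in> free n h" "w \<in> attack n h"
proof -
  define w where "w = (ARG_MIN (fdeg n h) v. untouched n h v \<and> fdeg n h v > 0)"
  have w: "untouched n h w" "fdeg n h w > 0" "fdeg n h w \<le> fdeg n h v"
    using arg_min_nat_lemma[of "\<lambda>v. untouched n h v \<and> fdeg n h v > 0" v "fdeg n h"] assms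
    unfolding w_def by auto
  then have "\<exists>e. e \<in> free n h \<and> w \<in> e" by (auto simp: fdeg_def card_gt_0_iff)
  then have "(SOME e. e \<in> free n h \<and> w \<in> e) \<in> free n h \<and> w \<in> (SOME e. e \<in> free n h \<and> w \<in> e)"
    by (rule someI_ex)
  moreover have "attack n h = (SOME e. e \<in> free n h \<and> w \<in> e)"
    using assms unfolding attack_def w_def by auto
  ultimately show ?thesis using w that by metis
qed

lemma breaker_strategy_attack: "breaker_strategy n (attack n)"
  unfolding breaker_strategy_def
proof (intro allI impI)
  fix h assume "free n h \<noteq> {}"
  then have "(SOME e. e \<in> free n h) \<in> free n h" by (metis ex_in_conv someI_ex)
  then show "attack n h \<in> free n h"
    using attack_free_min[of n h] by (cases "\<exists>v. untouched n h v \<and> fdeg n h v > 0") (auto simp: attack_def)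
qed

lemma isolable_mono: "isolable n k h \<Longrightarrow> k \<le> l \<Longrightarrow> isolable n l h"
  unfolding isolable_def by (meson order_trans)

lemma isolable_0_persistent: "isolable n 0 h \<Longrightarrow> e \<in> free n h \<Longrightarrow> isolable n 0 ((p, e) # h)"
proof -
  assume "isolable n 0 h" and e: "e \<in> free n h"
  then obtain v where v: "untouched n h v" "fdeg n h v = 0" by (auto simp: isolable_def)
  then have "v \<notin> e" using fdeg_pos[OF e] by fastforce
  then have "untouched n ((p, e) # h) v" "fdeg n ((p, e) # h) v = 0"
    using v e by (auto simp: untouched_def fdeg_Cons)
  then show ?thesis by (auto simp: isolable_def)
qed

lemma isolable_attack:
  assumes "isolable n k h" "free n h \<noteq> {}"
  shows "isolable n (k - 1) ((Breaker, attack n h) # h)"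
proof (cases "isolable n 0 h")
  case True
  have "attack n h \<in> free n h"
    using breaker_strategy_attack assms(2) by (auto simp: breaker_strategy_def)
  from isolable_0_persistent[OF True this] show ?thesis by (rule isolable_mono) simp
next
  case False
  obtain v where v: "untouched n h v" "fdeg n h v \<le> k" using assms by (auto simp: isolable_def)
  with False have "fdeg n h v > 0" by (auto simp: isolable_def)
  from attack_free_min[OF v(1) this] obtain w where
    w: "untouched n h w" "fdeg n h w \<le> fdeg n h v" "attack n h \<in> free n h" "w \<in> attack n h" .
  have "untouched n ((Breaker, attack n h) # h) w" using w by (auto simp: untouched_def)
  moreover have "fdeg n ((Breaker, attack n h) # h) w \<le> k - 1"
    using w v by (auto simp: fdeg_Cons)
  ultimately show ?thesis by (auto simp: isolable_def)
qed

lemma isolable_0_not_hamilton: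
  assumes "isolable n 0 h"
  shows "\<not> has_hamilton_cycle n (claimed Maker h)"
proof
  assume "has_hamilton_cycle n (claimed Maker h)"
  then obtain vs where vs: "distinct vs" "set vs = {0..<n}"
    "\<forall>i<n. {vs ! i, vs ! (Suc i mod n)} \<in> claimed Maker h"
    by (auto simp: has_hamilton_cycle_def)
  obtain v where v: "untouched n h v" using assms by (auto simp: isolable_def)
  have "length vs = n" using vs by (metis distinct_card card_atLeastLessThan diff_zero)
  moreover have "v \<in> set vs" using v vs by (auto simp: untouched_def)
  ultimately obtain i where "i < n" "vs ! i = v" by (auto simp: in_set_conv_nth)
  then have "v \<in> {vs ! i, vs ! (Suc i mod n)}" "{vs ! i, vs ! (Suc i mod n)} \<in> claimed Maker h"
    using vs by auto
  with v show False unfolding untouched_def by blast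
qed

lemma card_free_ge:
  assumes "valid n h" "length h \<le> L" "F0 = real (n choose 2) - real L"
  shows "F0 \<le> real (card (free n h))"
  using card_free[OF assms(1)] assms(2,3) by linarith

text \<open>Fix one vertex that witnesses \<open>isolable n m h\<close>. A move of Maker hits it with probability at most
  \<open>m / F0\<close>, and if all \<open>a\<close> moves of the turn miss it, then Breaker's move brings the minimum down to at most
  \<open>m - 1\<close>, even if he plays at a different vertex.\<close>

lemma isolable_round:
  assumes h: "valid n h" "length h + a < L" and L: "L \<le> n choose 2"
    and F0: "F0 = real (n choose 2) - real L" "F0 > 0" and iso: "isolable n m h"
  shows "expec (random_maker_turn n a h) (\<lambda>h'. of_bool (\<not> isolable n (m - 1) (breaker_turn n (attack n) h')))
     \<le> a * m / F0"
proof -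
  obtain v where v: "untouched n h v" "fdeg n h v \<le> m" using iso by (auto simp: isolable_def)
  define good where "good h \<longleftrightarrow> untouched n h v \<and> fdeg n h v \<le> m" for h
  define P where "P i h = of_bool (\<not> good h) + i * m / F0" for i h
  have "expec (random_maker_turn n a h) (\<lambda>h'. of_bool (\<not> isolable n (m - 1) (breaker_turn n (attack n) h')))
     \<le> expec (random_maker_turn n a h) (P 0)"
  proof (rule expec_mono)
    fix h' assume "h' \<in> set_pmf (random_maker_turn n a h)"
    then have h': "valid n h'" "length h' < n choose 2"
      using maker_turn_valid[of n h a h'] h L by auto
    show "of_bool (\<not> isolable n (m - 1) (breaker_turn n (attack n) h')) \<le> P 0 h'"
    proof (cases "good h'")
      case True
      then have "isolable n m h'" by (auto simp: good_def isolable_def)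
      from isolable_attack[OF this free_nonempty[OF h']]
        breaker_turn_valid(1)[OF h' breaker_strategy_attack] show ?thesis by (simp add: P_def)
    qed (simp add: P_def)
  qed simp
  also have "\<dots> \<le> P a h"
  proof (rule expec_maker_turn_le[of a n 0 L])
    fix i h assume h: "valid n h" "length h < L"
    let ?F = "real (card (free n h))"
    have F: "F0 \<le> ?F" using card_free_ge[OF h(1) _ F0(1)] h(2) by simp
    have "(\<Sum>e\<in>free n h. of_bool (\<not> good ((Maker, e) # h))) \<le> ?F * (of_bool (\<not> good h) + m / F0)"
    proof (cases "good h")
      case True
      have "(\<Sum>e\<in>free n h. of_bool (\<not> good ((Maker, e) # h))) \<le> (\<Sum>e\<in>free n h. of_bool (v \<in> e) :: real)"
        using True by (intro sum_mono) (auto simp: good_def untouched_def fdeg_Cons)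
      also have "\<dots> = fdeg n h v" by (simp add: fdeg_def of_bool_def sum.If_cases Int_def)
      also have "\<dots> \<le> m" using True by (simp add: good_def)
      also have "real m \<le> ?F * (m / F0)"
        using mult_right_mono[OF F, of "real m"] F0(2) by (simp add: field_simps)
      finally show ?thesis using True by simp
    next
      case False
      have "(\<Sum>e\<in>free n h. of_bool (\<not> good ((Maker, e) # h))) \<le> (\<Sum>e\<in>free n h. 1 :: real)"
        by (intro sum_mono) auto
      also have "\<dots> \<le> ?F * (1 + m / F0)" using F0(2) by (simp add: mult_le_cancel_left1)
      finally show ?thesis using False by simp
    qed
    then show "(\<Sum>e\<in>free n h. P i ((Maker, e) # h)) \<le> real (card (free n h)) * P (Suc i) h"
      unfolding P_def by (simp add: sum.distrib algebra_simps add_divide_distrib)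
  qed (use h L in auto)
  also have "\<dots> = a * m / F0" using v by (simp add: P_def good_def)
  finally show ?thesis by simp
qed

text \<open>Lower bound for the probability that a siege of a vertex with \<open>m\<close> free edges succeeds, if there are
  never fewer than \<open>F0\<close> free edges.\<close>

definition hit_free :: "nat \<Rightarrow> real \<Rightarrow> nat \<Rightarrow> real" where
  "hit_free a F0 m = (\<Prod>i=1..m. 1 - real (a * i) / F0)"

text \<open>Upper bound for the probability that no vertex is isolated after \<open>m\<close> further rounds.\<close>

definition fail_bound :: "nat \<Rightarrow> nat \<Rightarrow> real \<Rightarrow> nat \<Rightarrow> history \<Rightarrow> real" where
  "fail_bound n a F0 m h = (if isolable n 0 h then 0 else if isolable n m h then 1 - hit_free a F0 m else 1)"

definition all_touched :: "nat \<Rightarrow> history \<Rightarrow> bool" where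
  "all_touched n h \<longleftrightarrow> (\<forall>v. \<not> untouched n h v)"

definition few_untouched :: "nat \<Rightarrow> history \<Rightarrow> real" where
  "few_untouched n h = 1 / (real (card {v. untouched n h v}) + 1)"

context
  fixes n a L :: nat and F0 :: real
  assumes L: "L \<le> n choose 2" and F0: "F0 = real (n choose 2) - real L" "F0 > 0"
    and small: "real a * real n \<le> F0"
begin

lemma hit_free_bounds: "m \<le> n \<Longrightarrow> 0 \<le> hit_free a F0 m \<and> hit_free a F0 m \<le> 1"
proof -
  assume m: "m \<le> n"
  have "0 \<le> 1 - a * i / F0 \<and> 1 - a * i / F0 \<le> 1" if "i \<in> {1..m}" for i
  proof -
    have "real a * real i \<le> real a * real n" using that m by (intro mult_left_mono) auto
    then have "real a * real i \<le> F0" using small by linarith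
    then show ?thesis using F0 by (auto simp: field_simps)
  qed
  then show ?thesis unfolding hit_free_def by (intro conjI prod_nonneg prod_le_1) auto
qed

lemma fail_bound_le_1: "m \<le> n \<Longrightarrow> fail_bound n a F0 m h \<le> 1"
  using hit_free_bounds[of m] by (auto simp: fail_bound_def)

text \<open>The three values of \<open>fail_bound\<close> correspond to success (which persists), a siege that can still
  finish in time, and the trivial bound. In the second case the recursion is
  \<open>hit_free (m + 1) = hit_free m * (1 - a * (m + 1) / F0)\<close>.\<close>

lemma fail_bound_round:
  assumes m: "Suc m \<le> n" and h: "valid n h" "length h + a < L"
  shows "expec (random_maker_turn n a h) (\<lambda>h'. fail_bound n a F0 m (breaker_turn n (attack n) h'))
    \<le> fail_bound n a F0 (Suc m) h"
proof -
  have bt: "breaker_turn n (attack n) h' = (Breaker, attack n h') # h'" "attack n h' \<in> free n h'"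
    if "h' \<in> set_pmf (random_maker_turn n a h)" for h'
    using that maker_turn_valid[of n h a h'] h L breaker_turn_valid[OF _ _ breaker_strategy_attack, of n h']
    by auto
  consider "isolable n 0 h" | "\<not> isolable n 0 h" "isolable n (Suc m) h" | "\<not> isolable n (Suc m) h"
    by blast
  then show ?thesis
  proof cases
    case 1
    have "expec (random_maker_turn n a h) (\<lambda>h'. fail_bound n a F0 m (breaker_turn n (attack n) h'))
      \<le> expec (random_maker_turn n a h) (\<lambda>h'. 0)"
    proof (rule expec_mono)
      fix h' assume h': "h' \<in> set_pmf (random_maker_turn n a h)"
      have "isolable n 0 h'" by (rule maker_turn_persistent[where Q = "isolable n 0", OF _ 1 h']) (rule isolable_0_persistent)
      then show "fail_bound n a F0 m (breaker_turn n (attack n) h') \<le> 0"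
        using bt[OF h'] isolable_0_persistent by (simp add: fail_bound_def)
    qed simp
    then show ?thesis using 1 by (simp add: fail_bound_def)
  next
    case 2
    have q: "0 \<le> hit_free a F0 m" "hit_free a F0 m \<le> 1" using hit_free_bounds[of m] m by auto
    have "expec (random_maker_turn n a h) (\<lambda>h'. fail_bound n a F0 m (breaker_turn n (attack n) h'))
      \<le> expec (random_maker_turn n a h) (\<lambda>h'. (1 - hit_free a F0 m) + 
          hit_free a F0 m * of_bool (\<not> isolable n (Suc m - 1) (breaker_turn n (attack n) h')))"
      using q by (intro expec_mono) (auto simp: fail_bound_def)
    also have "\<dots> = (1 - hit_free a F0 m) + hit_free a F0 m * expec (random_maker_turn n a h)
         (\<lambda>h'. of_bool (\<not> isolable n (Suc m - 1) (breaker_turn n (attack n) h')))"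
      by (subst Bochner_Integration.integral_add) (auto intro!: integrable_measure_pmf_finite)
    also have "\<dots> \<le> (1 - hit_free a F0 m) + hit_free a F0 m * (a * Suc m / F0)"
      using isolable_round[OF h L F0 2(2)] q
      by (intro add_left_mono mult_left_mono) (auto simp: algebra_simps)
    also have "\<dots> = 1 - hit_free a F0 (Suc m)"
      by (simp add: hit_free_def algebra_simps)
    also have "\<dots> = fail_bound n a F0 (Suc m) h" using 2 by (simp add: fail_bound_def)
    finally show ?thesis .
  next
    case 3
    have "expec (random_maker_turn n a h) (\<lambda>h'. fail_bound n a F0 m (breaker_turn n (attack n) h'))
      \<le> expec (random_maker_turn n a h) (\<lambda>h'. 1)"
      using m by (intro expec_mono fail_bound_le_1) auto
    moreover have "\<not> isolable n 0 h" using 3 isolable_mono by blast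
    ultimately show ?thesis using 3 by (simp add: fail_bound_def)
  qed
qed

lemma fail_bound_rounds:
  assumes "j \<le> n" "(r + j) * (a + 1) \<le> L"
  shows "expec (rounds n a (attack n) (r + j)) (fail_bound n a F0 (n - j))
    \<le> expec (rounds n a (attack n) r) (fail_bound n a F0 n)"
  using assms
proof (induction j)
  case (Suc j)
  have "expec (rounds n a (attack n) (Suc (r + j))) (fail_bound n a F0 (n - Suc j))
    \<le> expec (rounds n a (attack n) (r + j)) (fail_bound n a F0 (n - j))"
  proof (rule expec_rounds_Suc_le[OF breaker_strategy_attack])
    show "Suc (r + j) * (a + 1) \<le> n choose 2" using Suc.prems L by simp
    fix h assume h: "valid n h" "length h = (r + j) * (a + 1)"
    show "expec (random_maker_turn n a h) (\<lambda>h'. fail_bound n a F0 (n - Suc j) (breaker_turn n (attack n) h'))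
         \<le> fail_bound n a F0 (n - j) h"
      using fail_bound_round[of "n - Suc j" h] h Suc.prems by (simp add: Suc_diff_Suc)
  qed
  also have "\<dots> \<le> expec (rounds n a (attack n) r) (fail_bound n a F0 n)"
    using Suc by simp
  finally show ?case by simp
qed simp

text \<open>Within \<open>n\<close> rounds a siege of any untouched vertex can be completed, since a vertex has fewer than
  \<open>n\<close> edges.\<close>

lemma not_isolated_block:
  assumes "(r + n) * (a + 1) \<le> L"
  shows "measure_pmf.prob (rounds n a (attack n) (r + n)) {h. \<not> isolable n 0 h}
    \<le> (1 - hit_free a F0 n) * measure_pmf.prob (rounds n a (attack n) r) {h. \<not> isolable n 0 h}
      + measure_pmf.prob (rounds n a (attack n) r) {h. all_touched n h}"
proof -
  have q: "hit_free a F0 n \<le> 1" using hit_free_bounds[of n] by simp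
  have "fail_bound n a F0 (n - n) = (\<lambda>h. of_bool (\<not> isolable n 0 h))"
    by (auto simp: fail_bound_def)
  then have "measure_pmf.prob (rounds n a (attack n) (r + n)) {h. \<not> isolable n 0 h}
    \<le> expec (rounds n a (attack n) r) (fail_bound n a F0 n)"
    using fail_bound_rounds[OF order.refl assms] by (simp add: prob_eq_expec)
  also have "\<dots> \<le> expec (rounds n a (attack n) r) (\<lambda>h.
      (1 - hit_free a F0 n) * of_bool (\<not> isolable n 0 h) + of_bool (all_touched n h))"
  proof (rule expec_mono)
    fix h
    have "isolable n n h" if "untouched n h v" for v using that fdeg_le[of n h v] by (auto simp: isolable_def)
    then show "fail_bound n a F0 n h \<le> (1 - hit_free a F0 n) * of_bool (\<not> isolable n 0 h) + of_bool (all_touched n h)"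
      using q hit_free_bounds[of n] by (auto simp: fail_bound_def all_touched_def)
  qed simp
  also have "\<dots> = (1 - hit_free a F0 n) * expec (rounds n a (attack n) r) (\<lambda>h. of_bool (\<not> isolable n 0 h))
      + expec (rounds n a (attack n) r) (\<lambda>h. of_bool (all_touched n h))"
    by (subst Bochner_Integration.integral_add) (auto intro!: integrable_measure_pmf_finite)
  finally show ?thesis by (simp only: prob_eq_expec)
qed

lemma finite_untouched [simp]: "finite {v. untouched n h v}"
  by (rule finite_subset[of _ "{0..<n}"]) (auto simp: untouched_def)

text \<open>An edge that meets \<open>c \<le> 2\<close> of the \<open>u\<close> untouched vertices changes \<open>1 / (u + 1)\<close> to
  \<open>1 / (u - c + 1) \<le> (1 + 2 * c / u) / (u + 1)\<close>, and summing \<open>c\<close> over all free edges gives at most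
  \<open>u * n\<close>. The factor \<open>u\<close> cancels, and the relative growth does not depend on the history.\<close>

lemma few_untouched_maker:
  assumes h: "valid n h" "length h < L"
  shows "(\<Sum>e\<in>free n h. few_untouched n ((Maker, e) # h))
    \<le> card (free n h) * ((1 + 2 * n / F0) * few_untouched n h)"
proof -
  let ?U = "{v. untouched n h v}"
  let ?u = "real (card ?U)"
  let ?F = "real (card (free n h))"
  have F: "F0 \<le> ?F" using card_free_ge[OF h(1) _ F0(1)] h(2) by simp
  have U': "{v. untouched n ((Maker, e) # h) v} = ?U - e" for e
    by (auto simp: untouched_def)
  have one: "few_untouched n ((Maker, e) # h) \<le> few_untouched n h * (1 + 2 * card (?U \<inter> e) / ?u)"
    if e: "e \<in> free n h" for e
  proof -
    have fe: "finite e" "card e = 2"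
      using e free_subset[of n h] by (auto simp: complete_edges_def intro: finite_subset)
    define c where "c = card (?U \<inter> e)"
    have c2: "c \<le> 2" using card_mono[of e "?U \<inter> e"] fe by (auto simp: c_def)
    have cu: "c \<le> card ?U" unfolding c_def by (rule card_mono) auto
    have "card (?U - e) = card ?U - c" unfolding c_def by (rule card_Diff_subset_Int) simp
    then have cd: "real (card (?U - e)) = ?u - c" using cu by simp
    have "c = 0 \<or> c = 1 \<or> c = 2" using c2 by auto
    then have "1 / (?u - c + 1) \<le> 1 / (?u + 1) * (1 + 2 * c / ?u)"
    proof (elim disjE)
      assume c: "c = 1"
      then have "?u > 0" using cu by linarith
      then show ?thesis unfolding c by (auto simp: divide_simps card_gt_0_iff)
    next
      assume c: "c = 2"
      then have "?u \<ge> 2" using cu by simp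
      have "1 / (x - 1) \<le> 1 / (x + 1) * (1 + 2 * 2 / x)" if "x \<ge> 2" for x :: real
      proof -
        have "1 / (x + 1) * (1 + 2 * 2 / x) - 1 / (x - 1) = (2 * x - 4) / (x * (x + 1) * (x - 1))"
          using that by (simp add: divide_simps) (simp add: algebra_simps)
        also have "\<dots> \<ge> 0" using that by simp
        finally show ?thesis by simp
      qed
      from this[OF \<open>?u \<ge> 2\<close>] show ?thesis using c by simp
    qed simp
    then show ?thesis unfolding few_untouched_def U' cd c_def by simp
  qed
  have swap: "(\<Sum>e\<in>free n h. real (card (?U \<inter> e))) = (\<Sum>v\<in>?U. real (fdeg n h v))"
  proof -
    have "real (card (?U \<inter> e)) = (\<Sum>v\<in>?U. of_bool (v \<in> e))" for e
      by (simp add: of_bool_def sum.If_cases Int_def)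
    moreover have "real (fdeg n h v) = (\<Sum>e\<in>free n h. of_bool (v \<in> e))" for v
      by (simp add: of_bool_def sum.If_cases Int_def fdeg_def)
    ultimately show ?thesis by (simp only: sum.swap[of _ ?U])
  qed
  have "(\<Sum>e\<in>free n h. few_untouched n ((Maker, e) # h))
     \<le> (\<Sum>e\<in>free n h. few_untouched n h * (1 + 2 * card (?U \<inter> e) / ?u))"
    using one by (rule sum_mono)
  also have "\<dots> = few_untouched n h * (?F + 2 * (\<Sum>e\<in>free n h. real (card (?U \<inter> e))) / ?u)"
    by (simp add: sum_distrib_left sum.distrib sum_divide_distrib algebra_simps)
  also have "\<dots> \<le> few_untouched n h * (?F + 2 * n)"
  proof (intro mult_left_mono add_left_mono)
    have "(\<Sum>v\<in>?U. real (fdeg n h v)) \<le> (\<Sum>v\<in>?U. real n)"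
    proof (rule sum_mono)
      show "real (fdeg n h v) \<le> real n" for v using fdeg_le[of n h v] by simp
    qed
    then have "(\<Sum>e\<in>free n h. real (card (?U \<inter> e))) \<le> ?u * n" unfolding swap by simp
    then show "2 * (\<Sum>e\<in>free n h. real (card (?U \<inter> e))) / ?u \<le> real (2 * n)"
      by (cases "?u = 0") (auto simp: divide_le_eq mult_ac)
  qed (simp add: few_untouched_def)
  also have "\<dots> \<le> few_untouched n h * (?F * (1 + 2 * n / F0))"
  proof (rule mult_left_mono)
    have "2 * n \<le> ?F * (2 * n / F0)"
      using mult_right_mono[OF F, of "real n"] F0(2) by (simp add: field_simps)
    then show "?F + 2 * n \<le> ?F * (1 + 2 * n / F0)" by (simp add: algebra_simps)
  qed (simp add: few_untouched_def)
  finally show ?thesis by (simp add: mult_ac)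
qed

text \<open>The potential starts at \<open>1 / (n + 1)\<close> and equals \<open>1\<close> once all vertices are touched. Breaker's
  moves do not change it at all, so his adaptivity does no harm.\<close>

lemma all_touched_prob:
  assumes "r * (a + 1) \<le> L" "breaker_strategy n \<sigma>"
  shows "measure_pmf.prob (rounds n a \<sigma> r) {h. all_touched n h} \<le> (1 + 2 * n / F0) ^ (a * r) / (n + 1)"
proof -
  have "measure_pmf.prob (rounds n a \<sigma> r) {h. all_touched n h} \<le> expec (rounds n a \<sigma> (0 + r)) (few_untouched n)"
    unfolding prob_eq_expec by (simp, intro expec_mono) (auto simp: all_touched_def few_untouched_def)
  also have "\<dots> \<le> (1 + 2 * n / F0) ^ (a * r) * expec (rounds n a \<sigma> 0) (few_untouched n)"
  proof (rule expec_rounds_geometric[OF assms(2)])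
    show "(0 + r) * (a + 1) \<le> n choose 2" using assms L by simp
    show "0 < 1 + 2 * n / F0" using F0 by (simp add: add_pos_nonneg)
  next
    fix h assume "valid n h" "0 * (a + 1) \<le> length h" "length h < (0 + r) * (a + 1)"
    then show "(\<Sum>e\<in>free n h. few_untouched n ((Maker, e) # h))
       \<le> card (free n h) * ((1 + 2 * n / F0) * few_untouched n h)"
      using few_untouched_maker[of h] assms by simp
  next
    fix e h
    show "few_untouched n ((Breaker, e) # h) \<le> few_untouched n h"
      by (simp add: few_untouched_def untouched_def)
  qed
  also have "expec (rounds n a \<sigma> 0) (few_untouched n) = 1 / (n + 1)"
  proof -
    have "{v. untouched n [] v} = {0..<n}" by (auto simp: untouched_def)
    then show ?thesis by (simp add: few_untouched_def)
  qed
  finally show ?thesis by simp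
qed

lemma not_isolated_prob:
  assumes "K * n * (a + 1) \<le> L"
  shows "measure_pmf.prob (rounds n a (attack n) (K * n)) {h. \<not> isolable n 0 h}
    \<le> (1 - hit_free a F0 n) ^ K + K * ((1 + 2 * n / F0) ^ (a * (K * n)) / (n + 1))"
proof -
  define z where "z = (1 + 2 * n / F0) ^ (a * (K * n)) / (n + 1)"
  have q: "0 \<le> 1 - hit_free a F0 n" "1 - hit_free a F0 n \<le> 1" using hit_free_bounds[of n] by auto
  have "measure_pmf.prob (rounds n a (attack n) (j * n)) {h. \<not> isolable n 0 h}
    \<le> (1 - hit_free a F0 n) ^ j + j * z" if "j \<le> K" for j
    using that
  proof (induction j)
    case (Suc j)
    have jK: "(j * n + n) * (a + 1) \<le> L"
    proof -
      have "(j * n + n) * (a + 1) = Suc j * n * (a + 1)" by simp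
      also have "\<dots> \<le> K * n * (a + 1)" using Suc.prems by (intro mult_right_mono) auto
      finally show ?thesis using assms by simp
    qed
    have "(1 - hit_free a F0 n) ^ j * (1 - hit_free a F0 n) + (1 - hit_free a F0 n) * (j * z) \<le>
      (1 - hit_free a F0 n) ^ j * (1 - hit_free a F0 n) + 1 * (j * z)"
      using q F0 by (intro add_left_mono mult_right_mono) (auto simp: z_def)
    moreover have "measure_pmf.prob (rounds n a (attack n) (j * n)) {h. all_touched n h} \<le> z"
    proof -
      have "j * n * (a + 1) \<le> L" using jK by (simp add: algebra_simps)
      then have "measure_pmf.prob (rounds n a (attack n) (j * n)) {h. all_touched n h}
         \<le> (1 + 2 * n / F0) ^ (a * (j * n)) / (n + 1)"
        by (rule all_touched_prob[OF _ breaker_strategy_attack])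
      also have "\<dots> \<le> z" unfolding z_def using Suc.prems F0
        by (intro divide_right_mono power_increasing) auto
      finally show ?thesis .
    qed
    moreover have "(1 - hit_free a F0 n) * measure_pmf.prob (rounds n a (attack n) (j * n)) {h. \<not> isolable n 0 h}
        \<le> (1 - hit_free a F0 n) * ((1 - hit_free a F0 n) ^ j + j * z)"
      using Suc q by (intro mult_left_mono) auto
    ultimately show ?case using not_isolated_block[OF jK]
      by (simp add: algebra_simps)
  qed simp
  from this[of K] show ?thesis by (simp add: z_def)
qed

end

text \<open>The factors \<open>1 - x i\<close> with \<open>x i = a * i / F0\<close> have \<open>\<Sum> x i \<le> a + 1\<close>, and the quadratic error terms of
  \<open>ln (1 - x i)\<close> contribute at most 2.\<close>

lemma hit_free_lower_bound:
  assumes F0: "F0 > 0" "real a * (real a + 1) * n \<le> F0" "real a * n * (real n + 1) / 2 \<le> (real a + 1) * F0"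
  shows "exp (- real a - 3) \<le> hit_free a F0 n"
proof -
  define x where "x i = real (a * i) / F0" for i
  have xb: "0 \<le> x i" "x i \<le> 1 / 2" "x i * (a + 1) \<le> 1" if "i \<in> {1..n}" for i
  proof -
    show "0 \<le> x i" using F0 by (simp add: x_def)
    have "real a * (real a + 1) * i \<le> real a * (real a + 1) * n" using that by (intro mult_left_mono) auto
    then have *: "real a * (real a + 1) * i \<le> F0" using F0 by simp
    then show **: "x i * (a + 1) \<le> 1" using F0 by (simp add: x_def field_simps)
    show "x i \<le> 1 / 2"
    proof (cases "a = 0")
      case False
      then have "x i * 2 \<le> x i * (a + 1)" using \<open>0 \<le> x i\<close> by (intro mult_left_mono) auto
      then show ?thesis using ** by simp
    qed (simp add: x_def)
  qed
  have sum: "(\<Sum>i=1..n. x i) \<le> a + 1"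
  proof -
    have gauss: "(\<Sum>i=1..n. real i) = n * (n + 1) / 2" by (induction n) (auto simp: field_simps)
    have "(\<Sum>i=1..n. x i) = real a * (\<Sum>i=1..n. real i) / F0"
      by (simp add: x_def sum_divide_distrib[symmetric] sum_distrib_left[symmetric])
    also have "\<dots> = real a * n * (n + 1) / 2 / F0" unfolding gauss by (simp add: algebra_simps)
    finally have "(\<Sum>i=1..n. x i) = real a * n * (n + 1) / 2 / F0" .
    then show ?thesis using F0 by (simp add: divide_le_eq algebra_simps)
  qed
  have sq: "(\<Sum>i=1..n. (x i)\<^sup>2) \<le> 1"
  proof -
    have "(\<Sum>i=1..n. (x i)\<^sup>2) \<le> (\<Sum>i=1..n. x i * (1 / (a + 1)))"
    proof (rule sum_mono)
      fix i assume "i \<in> {1..n}"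
      note b = xb[OF this]
      have "x i \<le> 1 / (a + 1)" using b(3) by (simp add: field_simps)
      then show "(x i)\<^sup>2 \<le> x i * (1 / (a + 1))" unfolding power2_eq_square using b(1) by (rule mult_left_mono)
    qed
    also have "\<dots> = (\<Sum>i=1..n. x i) * (1 / (a + 1))" by (rule sum_distrib_right[symmetric])
    also have "\<dots> \<le> (a + 1) * (1 / (a + 1))" using sum by (intro mult_right_mono) auto
    finally show ?thesis by simp
  qed
  have "exp (- real a - 3) \<le> exp (\<Sum>i=1..n. - x i - 2 * (x i)\<^sup>2)"
    using sum sq by (simp add: sum_subtractf sum_negf sum_distrib_left[symmetric])
  also have "\<dots> = (\<Prod>i=1..n. exp (- x i - 2 * (x i)\<^sup>2))" by (simp add: exp_sum)
  also have "\<dots> \<le> (\<Prod>i=1..n. 1 - x i)"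
  proof (rule prod_mono, rule conjI)
    fix i assume "i \<in> {1..n}"
    note b = xb[OF this]
    have "exp (- x i - 2 * (x i)\<^sup>2) \<le> exp (ln (1 - x i))"
      using ln_one_minus_pos_lower_bound[OF b(1,2)] by simp
    then show "exp (- x i - 2 * (x i)\<^sup>2) \<le> 1 - x i" using b by simp
  qed simp
  finally show ?thesis by (simp add: hit_free_def x_def)
qed

text \<open>\<open>K\<close> is the number of blocks, kept between the real numbers \<open>k\<close> and \<open>k + 1\<close>, and \<open>A\<close> is an upper bound
  for the bias; the final estimate is thus an explicit function of real numbers.\<close>

lemma breaker_isolates_prob:
  fixes n a K :: nat and A k :: real
  assumes A: "real a \<le> A" and k: "k \<le> real K" "real K \<le> k + 1" and n: "n \<ge> 2"
    and large: "(A + 1)\<^sup>2 * (k + 1 + 2) \<le> (real n - 1) / 4"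
  shows "measure_pmf.prob (half_random_game n a (attack n)) {h. \<not> isolable n 0 h}
    \<le> exp (- (exp (- A - 3) * k)) + (k + 1) * (exp (16 * A * (k + 1)) / (n + 1))"
proof -
  define L where "L = K * n * (a + 1)"
  define F0 where "F0 = real (n choose 2) - real L"
  have ch: "real (n choose 2) = n * (real n - 1) / 2"
    by (rule real_choose_2)
  have "(real a + 1)\<^sup>2 * (real K + 2) \<le> (A + 1)\<^sup>2 * (k + 1 + 2)"
    using A k by (intro mult_mono power_mono) auto
  then have big: "(real a + 1)\<^sup>2 * (real K + 2) \<le> (real n - 1) / 4" using large by linarith
  have e1: "(real a + 1) * real K \<le> (real a + 1)\<^sup>2 * real K" "real a \<le> (real a + 1)\<^sup>2"
    "real a * (real a + 1) \<le> (real a + 1)\<^sup>2"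
    by (auto simp: power2_eq_square algebra_simps intro!: mult_right_mono)
  have F0_eq: "F0 = n * ((real n - 1) / 2 - K * (real a + 1))"
    unfolding F0_def L_def ch by (simp add: algebra_simps)
  have expand: "(real a + 1)\<^sup>2 * (real K + 2) = (real a + 1)\<^sup>2 * real K + 2 * (real a + 1)\<^sup>2"
    by (simp add: algebra_simps)
  have sq1: "(real a + 1)\<^sup>2 \<ge> 1" by (simp add: power2_eq_square algebra_simps)
  have quarter: "(real n - 1) / 4 \<le> (real n - 1) / 2 - K * (real a + 1)"
  proof -
    have "K * (real a + 1) \<le> (real n - 1) / 4"
      using big e1(1) expand sq1 by (simp only: mult.commute[of "real K"])
    then show ?thesis by linarith
  qed
  have F0_ge: "real n * ((real n - 1) / 4) \<le> F0"
    unfolding F0_eq using quarter by (intro mult_left_mono) auto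
  have F0_pos: "F0 > 0" 
  proof -
    have "0 < real n * ((real n - 1) / 4)" using n by simp
    then show ?thesis using F0_ge by linarith
  qed
  have LC: "L \<le> n choose 2" using F0_pos unfolding F0_def by linarith
  have s1: "real a * (real a + 1) * n \<le> F0"
  proof -
    have "real a * (real a + 1) \<le> (real n - 1) / 4"
    proof -
      have "0 \<le> (real a + 1)\<^sup>2 * real K" by simp
      then show ?thesis using big e1(3) expand sq1 by linarith
    qed
    then have "real n * (real a * (real a + 1)) \<le> real n * ((real n - 1) / 4)"
      by (rule mult_left_mono) simp
    also note F0_ge
    finally show ?thesis by (simp add: mult_ac add.commute)
  qed
  have s2: "real a * n * (real n + 1) / 2 \<le> (real a + 1) * F0"
  proof -
    have "(real a + 1) * (K * (real a + 1)) = (real a + 1)\<^sup>2 * K" by (simp add: power2_eq_square)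
    then have "real a + (real a + 1) * (K * (real a + 1)) \<le> (real n - 1) / 2"
    proof -
      have "real n \<ge> 2" using n by simp
      then have "real a + X \<le> (real n - 1) / 2"
        if "Z = X + 2 * Y" "Z \<le> (real n - 1) / 4" "real a \<le> Y" "1 \<le> Y" for X Y Z
        using that by (simp add: field_simps)
      from this[OF expand big e1(2) sq1] show ?thesis
        unfolding \<open>(real a + 1) * (K * (real a + 1)) = (real a + 1)\<^sup>2 * K\<close> .
    qed
    then have "real a * (real n + 1) / 2 \<le> (real a + 1) * ((real n - 1) / 2 - K * (real a + 1))"
      by (simp add: algebra_simps add_divide_distrib diff_divide_distrib)
    then have "real n * (real a * (real n + 1) / 2) \<le> real n * ((real a + 1) * ((real n - 1) / 2 - K * (real a + 1)))"
      by (intro mult_left_mono) auto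
    then show ?thesis unfolding F0_eq by (simp add: mult_ac add.commute)
  qed
  have small: "real a * real n \<le> F0"
  proof -
    have "real a * n * 1 \<le> real a * n * (real a + 1)" by (intro mult_left_mono) auto
    also have "\<dots> = real a * (real a + 1) * n" by (simp add: mult_ac)
    finally show ?thesis using s1 by simp
  qed
  define q where "q = hit_free a F0 n"
  have q: "exp (- A - 3) \<le> q" "q \<le> 1"
    using hit_free_lower_bound[OF F0_pos s1 s2] hit_free_bounds[OF LC F0_def F0_pos small, of n] A
    unfolding q_def by (auto intro: order.trans[rotated])
  have n8: "n\<^sup>2 / 8 \<le> F0"
  proof -
    have "real n * (real n / 8) \<le> real n * ((real n - 1) / 4)" using n by (intro mult_left_mono) auto
    then show ?thesis using F0_ge by (simp add: power2_eq_square)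
  qed
  have "K * n \<le> n choose 2"
  proof -
    have "K * n * 1 \<le> L" unfolding L_def by (intro mult_left_mono) auto
    then show ?thesis using LC by simp
  qed
  then have "measure_pmf.prob (rounds n a (attack n) (K * n)) {h. isolable n 0 h}
     \<le> measure_pmf.prob (half_random_game n a (attack n)) {h. isolable n 0 h}"
    unfolding half_random_game_def card_complete_edges
    by (intro prob_persistent isolable_0_persistent breaker_strategy_attack)
  moreover have "measure_pmf.prob M {h. \<not> isolable n 0 h} = 1 - measure_pmf.prob M {h. isolable n 0 h}" for M
    using measure_pmf.prob_compl[of "{h. isolable n 0 h}" M] by (simp add: Compl_eq_Diff_UNIV[symmetric] Collect_neg_eq)
  ultimately have "measure_pmf.prob (half_random_game n a (attack n)) {h. \<not> isolable n 0 h}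
    \<le> measure_pmf.prob (rounds n a (attack n) (K * n)) {h. \<not> isolable n 0 h}" by simp
  also have "\<dots> \<le> (1 - q) ^ K + K * ((1 + 2 * n / F0) ^ (a * (K * n)) / (n + 1))"
    unfolding q_def by (rule not_isolated_prob[OF LC F0_def F0_pos small]) (simp add: L_def)
  also have "(1 - q) ^ K \<le> exp (- (exp (- A - 3) * k))"
  proof -
    have "(1 - q) ^ K \<le> exp (- q) ^ K" using q exp_ge_add_one_self[of "- q"] by (intro power_mono) auto
    also have "\<dots> = exp (- (q * K))" by (simp add: exp_of_nat_mult[symmetric] mult.commute)
    also have "\<dots> \<le> exp (- (exp (- A - 3) * k))"
    proof -
      have "exp (- A - 3) * k \<le> exp (- A - 3) * K" using k by (intro mult_left_mono) auto
      also have "\<dots> \<le> q * K" using q by (intro mult_right_mono) auto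
      finally show ?thesis by simp
    qed
    finally show ?thesis .
  qed
  also have "K * ((1 + 2 * n / F0) ^ (a * (K * n)) / (n + 1))
     \<le> (k + 1) * (exp (16 * A * (k + 1)) / (n + 1))"
  proof (intro mult_mono divide_right_mono)
    have np: "real n > 0" using n by simp
    have "2 * n / F0 \<le> 2 * n / (n\<^sup>2 / 8)" using n8 np F0_pos by (intro divide_left_mono) auto
    also have "\<dots> = 16 / n" using np by (simp add: power2_eq_square)
    finally have "2 * n / F0 \<le> 16 / n" .
    then have "1 + 2 * n / F0 \<le> exp (16 / n)" using exp_ge_add_one_self[of "16 / n"] by linarith
    then have "(1 + 2 * n / F0) ^ (a * (K * n)) \<le> exp (16 / n) ^ (a * (K * n))"
      using F0_pos by (intro power_mono) auto
    also have "\<dots> = exp (16 * a * K)" using np by (simp add: exp_of_nat_mult[symmetric])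
    also have "\<dots> \<le> exp (16 * A * (k + 1))" using A k by (auto intro!: mult_mono)
    finally show "(1 + 2 * n / F0) ^ (a * (K * n)) \<le> exp (16 * A * (k + 1))" .
  qed (use k F0_pos in auto)
  finally show ?thesis by simp
qed

lemma rounding_of_bounds:
  assumes "rounding_of a x"
  shows "x n - 1 \<le> real (a n)" "real (a n) \<le> max 0 (x n + 1)"
proof -
  have "a n = nat \<lfloor>x n\<rfloor> \<or> a n = nat \<lceil>x n\<rceil>" using assms by (auto simp: rounding_of_def)
  then show "x n - 1 \<le> real (a n)" "real (a n) \<le> max 0 (x n + 1)" by linarith+
qed

text \<open>It suffices to treat \<open>\<epsilon> \<le> 1 / 2\<close>, since a smaller bias only helps Breaker in the estimates. Among the
  two error terms the first needs more than \<open>exp a\<close> blocks and the second \<open>o (ln n / a)\<close> of them;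
  \<open>(ln n) powr (1 - \<epsilon> / 2)\<close> lies in between.\<close>

lemma attack_beats_random_maker:
  assumes \<epsilon>: "\<epsilon> > 0" and a: "rounding_of a (\<lambda>n. (1 - \<epsilon>) * ln (ln (real n)))"
  shows "(\<lambda>n. measure_pmf.prob (half_random_game n (a n) (attack n))
    {h. \<not> maker_wins has_hamilton_cycle n h}) \<longlonglongrightarrow> 1"
proof -
  define e where "e = min \<epsilon> (1 / 2)"
  have e: "0 < e" "e \<le> 1 / 2" "e \<le> \<epsilon>" using \<epsilon> by (auto simp: e_def)
  define A where "A n = (1 - e) * ln (ln (real n)) + 1" for n :: nat
  define k where "k n = ln (real n) powr (1 - e / 2)" for n :: nat
  define b where "b n = exp (- (exp (- A n - 3) * k n)) + (k n + 1) * (exp (16 * A n * (k n + 1)) / (n + 1))" for n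
  have b0: "b \<longlonglongrightarrow> 0"
    unfolding b_def A_def k_def using e by real_asymp
  have ev: "\<forall>\<^sub>F n in sequentially. (A n + 1)\<^sup>2 * (k n + 1 + 2) \<le> (real n - 1) / 4"
    unfolding A_def k_def using e by real_asymp
  have ev2: "\<forall>\<^sub>F n in sequentially. ln (ln (real n)) \<ge> 0" by real_asymp
  have "\<forall>\<^sub>F n in sequentially. 1 - b n \<le> measure_pmf.prob (half_random_game n (a n) (attack n))
    {h. \<not> maker_wins has_hamilton_cycle n h}"
    using ev ev2 eventually_ge_at_top[of 2]
  proof eventually_elim
    case (elim n)
    have "(1 - \<epsilon>) * ln (ln (real n)) \<le> (1 - e) * ln (ln (real n))"
      using e elim by (intro mult_right_mono) auto
    moreover have "0 \<le> (1 - e) * ln (ln (real n))" using e elim by (intro mult_nonneg_nonneg) auto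
    ultimately have aA: "real (a n) \<le> A n"
      using rounding_of_bounds(2)[OF a, of n] by (simp add: A_def)
    have "k n \<ge> 0" by (simp add: k_def)
    then have kK: "k n \<le> real (nat \<lceil>k n\<rceil>)" "real (nat \<lceil>k n\<rceil>) \<le> k n + 1" by linarith+
    have "measure_pmf.prob (half_random_game n (a n) (attack n)) {h. \<not> isolable n 0 h} \<le> b n"
      unfolding b_def by (rule breaker_isolates_prob[OF aA kK]) (use elim in auto)
    moreover have "measure_pmf.prob (half_random_game n (a n) (attack n)) {h. \<not> isolable n 0 h}
      = 1 - measure_pmf.prob (half_random_game n (a n) (attack n)) {h. isolable n 0 h}"
      using measure_pmf.prob_compl[of "{h. isolable n 0 h}"] by (simp add: Compl_eq_Diff_UNIV[symmetric] Collect_neg_eq)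
    moreover have "measure_pmf.prob (half_random_game n (a n) (attack n)) {h. isolable n 0 h}
      \<le> measure_pmf.prob (half_random_game n (a n) (attack n)) {h. \<not> maker_wins has_hamilton_cycle n h}"
      using isolable_0_not_hamilton by (intro measure_pmf.finite_measure_mono) (auto simp: maker_wins_def)
    ultimately show ?case by linarith
  qed
  note lower = this
  have "(\<lambda>n. 1 - b n) \<longlonglongrightarrow> 1" using tendsto_diff[OF tendsto_const b0, of 1] by simp
  from tendsto_sandwich[OF lower _ this tendsto_const] show ?thesis
    by (simp add: always_eventually)
qed

section \<open>Rotations of longest paths, and boosters\<close>

definition is_path :: "nat \<Rightarrow> nat set set \<Rightarrow> nat list \<Rightarrow> bool" where
  "is_path n G xs \<longleftrightarrow> xs \<noteq> [] \<and> distinct xs \<and> set xs \<subseteq> {0..<n} \<and>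
     successively (\<lambda>x y. {x, y} \<in> G) xs"

fun path_edges :: "'a list \<Rightarrow> 'a set set" where
  "path_edges (x # y # zs) = insert {x, y} (path_edges (y # zs))"
| "path_edges _ = {}"

lemma path_edges_append:
  "xs \<noteq> [] \<Longrightarrow> ys \<noteq> [] \<Longrightarrow> path_edges (xs @ ys) = path_edges xs \<union> path_edges ys \<union> {{last xs, hd ys}}"
proof (induction xs rule: path_edges.induct)
  case ("2_2" v) then show ?case by (cases ys) auto
qed auto

lemma path_edges_rev: "path_edges (rev xs) = path_edges xs"
proof (induction xs rule: path_edges.induct)
  case (1 x y zs)
  have "path_edges (rev (x # y # zs)) = path_edges (rev (y # zs) @ [x])" by simp
  also have "\<dots> = path_edges (rev (y # zs)) \<union> path_edges [x] \<union> {{last (rev (y # zs)), hd [x]}}"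
    by (rule path_edges_append) auto
  finally show ?case using 1 by (auto simp: insert_commute)
qed auto

lemma path_edges_subset: "\<Union>(path_edges xs) \<subseteq> set xs"
  by (induction xs rule: path_edges.induct) auto

text \<open>The sharper bound for the head of the path is what the induction needs when a new head is put in front.\<close>

lemma card_path_edges_nbrs:
  "distinct xs \<Longrightarrow> finite {w. {e, w} \<in> path_edges xs} \<and> card {w. {e, w} \<in> path_edges xs} \<le> 2 \<and>
    (e = hd xs \<longrightarrow> card {w. {e, w} \<in> path_edges xs} \<le> 1)"
proof (induction xs rule: path_edges.induct)
  case (1 x y zs)
  have dd: "distinct (y # zs)" using 1(2) by simp
  note IH = 1(1)[OF dd]
  have sub: "\<Union>(path_edges (y # zs)) \<subseteq> set (y # zs)" by (rule path_edges_subset)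
  consider "e = x" | "e = y" | "e \<noteq> x" "e \<noteq> y" by blast
  then show ?case
  proof cases
    case 1
    then have "{w. {e, w} \<in> path_edges (x # y # zs)} = {y}"
      using sub \<open>distinct (x # y # zs)\<close> by (auto simp: doubleton_eq_iff)
    then show ?thesis using 1 by simp
  next
    case 2
    then have "{w. {e, w} \<in> path_edges (x # y # zs)} = insert x {w. {e, w} \<in> path_edges (y # zs)}"
      by (auto simp: doubleton_eq_iff)
    then show ?thesis using IH 2 \<open>distinct (x # y # zs)\<close>
      by (auto simp: card_insert_if)
  next
    case 3
    then have "{w. {e, w} \<in> path_edges (x # y # zs)} = {w. {e, w} \<in> path_edges (y # zs)}"
      by (auto simp: doubleton_eq_iff)
    then show ?thesis using IH 3 by auto
  qed
qed auto

lemma is_path_rev: "is_path n G xs \<Longrightarrow> is_path n G (rev xs)"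
  by (auto simp: is_path_def insert_commute)

lemma is_path_mono: "is_path n G xs \<Longrightarrow> G \<subseteq> G' \<Longrightarrow> is_path n G' xs"
  unfolding is_path_def by (auto elim!: successively_mono)

lemma is_path_length: "is_path n G xs \<Longrightarrow> length xs \<le> n"
  unfolding is_path_def using card_mono[of "{0..<n}" "set xs"] by (auto simp: distinct_card)

lemma is_path_rotate:
  assumes "is_path n G (p @ x # q)" "p \<noteq> []" "{hd p, x} \<in> G"
  shows "is_path n G (rev p @ x # q)"
  using assms unfolding is_path_def
  by (auto simp: successively_append_iff last_rev insert_commute)

text \<open>If the head of a path is adjacent to \<open>x\<close>, then the segment before \<open>x\<close> can be reversed. The new path has
  the same vertices and the same last vertex, and its head is the former predecessor of \<open>x\<close>.\<close>

inductive_set rotations :: "nat set set \<Rightarrow> nat list \<Rightarrow> nat list set" for G xs where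
  base: "xs \<in> rotations G xs"
| rotate: "p @ x # q \<in> rotations G xs \<Longrightarrow> p \<noteq> [] \<Longrightarrow> {hd p, x} \<in> G \<Longrightarrow> rev p @ x # q \<in> rotations G xs"

lemma rotations_is_path:
  assumes "is_path n G xs" "ys \<in> rotations G xs"
  shows "is_path n G ys \<and> set ys = set xs \<and> last ys = last xs"
  using assms(2) by induction (use assms(1) in \<open>auto intro: is_path_rotate\<close>)

lemma rotations_hd_subset:
  assumes "is_path n G xs"
  shows "hd ` rotations G xs \<subseteq> {0..<n}"
proof safe
  fix ys assume "ys \<in> rotations G xs"
  then have "is_path n G ys" using rotations_is_path[OF assms] by blast
  then show "hd ys \<in> {0..<n}" unfolding is_path_def using hd_in_set[of ys] by blast
qed

definition nbrs :: "nat \<Rightarrow> nat set set \<Rightarrow> nat set \<Rightarrow> nat set" where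
  "nbrs n G S = {w. w < n \<and> w \<notin> S \<and> (\<exists>s\<in>S. {s, w} \<in> G)}"

lemma finite_nbrs [simp]: "finite (nbrs n G S)"
  by (rule finite_subset[of _ "{0..<n}"]) (auto simp: nbrs_def)

lemma nbrs_mono: "G \<subseteq> G' \<Longrightarrow> nbrs n G S \<subseteq> nbrs n G' S"
  by (auto simp: nbrs_def)

definition longest_path :: "nat \<Rightarrow> nat set set \<Rightarrow> nat list \<Rightarrow> bool" where
  "longest_path n G xs \<longleftrightarrow> is_path n G xs \<and> (\<forall>ys. is_path n G ys \<longrightarrow> length ys \<le> length xs)"

lemma rotations_longest:
  assumes "longest_path n G xs" "ys \<in> rotations G xs"
  shows "longest_path n G ys"
proof -
  have *: "is_path n G ys" "set ys = set xs"
    using rotations_is_path assms by (auto simp: longest_path_def)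
  then have "length ys = length xs"
    using assms(1) by (metis distinct_card is_path_def longest_path_def)
  then show ?thesis using * assms by (auto simp: longest_path_def)
qed

lemma longest_path_hd_nbr:
  assumes "longest_path n G xs" "{hd xs, w} \<in> G" "w < n"
  shows "w \<in> set xs"
proof (rule ccontr)
  assume "w \<notin> set xs"
  then have "is_path n G (w # xs)"
    using assms by (cases xs) (auto simp: longest_path_def is_path_def insert_commute)
  then show False using assms(1) by (fastforce simp: longest_path_def)
qed

text \<open>Let \<open>w\<close> be adjacent to a reachable head, but not a reachable head itself. A rotation deletes one path
  edge, and one of its ends becomes a head. So if no path neighbour of \<open>w\<close> in \<open>xs\<close> is a reachable
  head, then no rotation ever deletes a path edge at \<open>w\<close>. But rotating along the edge from
  the head to \<open>w\<close> turns the current predecessor of \<open>w\<close> into a head, a contradiction.\<close>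

lemma posa_endpoints:
  fixes n G xs
  assumes lp: "longest_path n G xs"
  defines "E \<equiv> hd ` rotations G xs"
  shows "nbrs n G E \<subseteq> (\<Union>e\<in>E. {w. {e, w} \<in> path_edges xs})"
proof
  fix w assume "w \<in> nbrs n G E"
  then obtain ys where w: "w < n" "w \<notin> E" and ys: "ys \<in> rotations G xs" "{hd ys, w} \<in> G"
    by (auto simp: nbrs_def E_def)
  show "w \<in> (\<Union>e\<in>E. {w. {e, w} \<in> path_edges xs})"
  proof (rule ccontr)
    assume "\<not> ?thesis"
    then have no: "\<And>e. e \<in> E \<Longrightarrow> {e, w} \<notin> path_edges xs" by auto
    \<comment> \<open>No rotation changes the path edges at \<open>w\<close>.\<close>
    have inv: "{u, w} \<in> path_edges zs \<longleftrightarrow> {u, w} \<in> path_edges xs" if "zs \<in> rotations G xs" for zs u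
      using that
    proof (induction arbitrary: u)
      case (rotate p x q)
      have pe1: "path_edges (p @ x # q) = path_edges p \<union> path_edges (x # q) \<union> {{last p, x}}"
        using path_edges_append[of p "x # q"] rotate by simp
      have pe2: "path_edges (rev p @ x # q) = path_edges p \<union> path_edges (x # q) \<union> {{hd p, x}}"
        using path_edges_append[of "rev p" "x # q"] rotate by (simp add: path_edges_rev last_rev)
      have hp: "hd p \<in> E" unfolding E_def
        by (rule image_eqI[OF _ rotate(1)]) (use rotate(2) in simp)
      have hl: "last p \<in> E" unfolding E_def
        by (rule image_eqI[OF _ rotations.rotate[OF rotate(1,2,3)]]) (use rotate(2) in \<open>simp add: hd_rev\<close>)
      have "w \<noteq> hd p" "w \<noteq> last p" using hp hl w by auto
      moreover have "w \<noteq> x"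
      proof
        assume "w = x"
        then have "{last p, w} \<in> path_edges (p @ x # q)" using pe1 by auto
        then show False using rotate.IH no[OF hl] by blast
      qed
      ultimately show ?case using rotate.IH[of u] pe1 pe2 by (auto simp: doubleton_eq_iff)
    qed simp
    have "w \<in> set ys"
      by (rule longest_path_hd_nbr[OF rotations_longest[OF lp ys(1)] ys(2) w(1)])
    then obtain p q where pq: "ys = p @ w # q" by (auto simp: in_set_conv_decomp)
    have "hd ys \<in> E" using ys by (auto simp: E_def)
    then have p: "p \<noteq> []" using pq w by (cases p) auto
    have "rev p @ w # q \<in> rotations G xs"
      using ys pq p by (intro rotations.rotate) auto
    then have "last p \<in> E" unfolding E_def
      by (rule image_eqI[rotated]) (use p in \<open>simp add: hd_rev\<close>)
    moreover have "{last p, w} \<in> path_edges ys"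
      using path_edges_append[of p "w # q"] p pq by auto
    ultimately show False using inv[OF ys(1)] no by blast
  qed
qed

text \<open>By the previous lemma the set \<open>E\<close> of reachable heads has at most \<open>2 * card E\<close> neighbours, so it is too
  large for the expansion hypothesis to apply.\<close>

lemma posa_many_endpoints:
  assumes lp: "longest_path n G xs"
    and exp: "\<And>S. S \<subseteq> {0..<n} \<Longrightarrow> S \<noteq> {} \<Longrightarrow> card S \<le> k \<Longrightarrow> card (nbrs n G S) \<ge> 3 * card S"
  shows "card (hd ` rotations G xs) > k"
proof (rule ccontr)
  define E where "E = hd ` rotations G xs"
  assume "\<not> ?thesis"
  then have E: "card E \<le> k" by (simp add: E_def)
  have sub: "E \<subseteq> {0..<n}"
    unfolding E_def by (rule rotations_hd_subset) (use lp in \<open>simp add: longest_path_def\<close>)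
  have fin: "finite E" using sub finite_subset by blast
  have ne: "E \<noteq> {}" using rotations.base[of xs G] by (auto simp: E_def)
  have d: "distinct xs" using lp by (auto simp: longest_path_def is_path_def)
  have "card (nbrs n G E) \<le> card (\<Union>e\<in>E. {w. {e, w} \<in> path_edges xs})"
  proof (rule card_mono)
    show "finite (\<Union>e\<in>E. {w. {e, w} \<in> path_edges xs})"
      using fin card_path_edges_nbrs[OF d] by blast
  qed (use posa_endpoints[OF lp] in \<open>simp add: E_def\<close>)
  also have "\<dots> \<le> (\<Sum>e\<in>E. card {w. {e, w} \<in> path_edges xs})"
    by (rule card_UN_le[OF fin])
  also have "\<dots> \<le> (\<Sum>e\<in>E. 2)" using card_path_edges_nbrs[OF d] by (intro sum_mono) auto
  also have "\<dots> = 2 * card E" by simp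
  finally have "card (nbrs n G E) \<le> 2 * card E" .
  moreover have "card E > 0" using ne fin by (simp add: card_gt_0_iff)
  ultimately show False using exp[OF sub ne E] by linarith
qed

text \<open>Connectedness in the form in which it is used: no nonempty proper vertex set is closed under adjacency.\<close>

definition cut_connected :: "nat \<Rightarrow> nat set set \<Rightarrow> bool" where
  "cut_connected n G \<longleftrightarrow> (\<forall>X \<subseteq> {0..<n}. X \<noteq> {} \<longrightarrow> X \<noteq> {0..<n} \<longrightarrow>
     (\<exists>x\<in>X. \<exists>y. y < n \<and> y \<notin> X \<and> {x, y} \<in> G))"

lemma cut_connected_mono: "cut_connected n G \<Longrightarrow> G \<subseteq> G' \<Longrightarrow> cut_connected n G'"
  unfolding cut_connected_def by (meson subsetD)

lemma hamilton_cycleI: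
  assumes "n \<ge> 3" "is_path n G xs" "set xs = {0..<n}" "{last xs, hd xs} \<in> G"
  shows "has_hamilton_cycle n G"
proof -
  have d: "distinct xs" and suc: "successively (\<lambda>x y. {x, y} \<in> G) xs"
    using assms by (auto simp: is_path_def)
  have len: "length xs = n" using d assms(3) by (metis distinct_card card_atLeastLessThan diff_zero)
  have "{xs ! i, xs ! (Suc i mod n)} \<in> G" if "i < n" for i
  proof (cases "Suc i = n")
    case True
    moreover have "xs \<noteq> []" using len assms(1) by auto
    ultimately have "xs ! i = last xs" "xs ! (Suc i mod n) = hd xs"
      using len assms(1) by (auto simp: last_conv_nth hd_conv_nth simp flip: True)
    then show ?thesis using assms(4) by simp
  next
    case False
    then have i: "Suc i < n" using that by simp
    then show ?thesis using suc len unfolding successively_conv_nth by simp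
  qed
  then show ?thesis using assms(1,3) d unfolding has_hamilton_cycle_def by blast
qed

text \<open>A cycle that misses a vertex has an edge leaving it; opening the cycle at that edge gives a path
  with one more vertex than the cycle has.\<close>

lemma longest_cycle_hamilton:
  assumes n: "n \<ge> 3" and con: "cut_connected n G" and p: "is_path n G xs" and cl: "{last xs, hd xs} \<in> G"
  shows "has_hamilton_cycle n G \<or> (\<exists>ys. is_path n G ys \<and> length ys > length xs)"
proof (cases "set xs = {0..<n}")
  case True
  then show ?thesis using hamilton_cycleI n p cl by blast
next
  case False
  have "set xs \<subseteq> {0..<n}" "set xs \<noteq> {}" using p by (auto simp: is_path_def)
  then obtain x y where xy: "x \<in> set xs" "y < n" "y \<notin> set xs" "{x, y} \<in> G"
    using con False unfolding cut_connected_def by blast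
  then obtain u v where uv: "xs = u @ x # v" by (auto simp: in_set_conv_decomp)
  have s: "successively (\<lambda>x y. {x, y} \<in> G) u" "successively (\<lambda>x y. {x, y} \<in> G) (x # v)"
    using p unfolding is_path_def uv by (auto simp: successively_append_iff)
  have "successively (\<lambda>x y. {x, y} \<in> G) ((x # v) @ u)"
    using s cl uv by (subst successively_append_iff) (auto simp: hd_append split: if_splits)
  then have "is_path n G (y # x # v @ u)"
    using p xy uv unfolding is_path_def by (auto simp: insert_commute)
  then show ?thesis using uv by (intro disjI2 exI[of _ "y # x # v @ u"]) auto
qed

definition max_path :: "nat \<Rightarrow> nat set set \<Rightarrow> nat" where
  "max_path n G = Max (length ` {xs. is_path n G xs})"

lemma finite_paths: "finite {xs. is_path n G xs}"
proof (rule finite_subset)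
  show "{xs. is_path n G xs} \<subseteq> {xs. set xs \<subseteq> {0..<n} \<and> length xs \<le> n}"
    using is_path_length by (auto simp: is_path_def)
qed (rule finite_lists_length_le, simp)

lemma path_le_max_path: "is_path n G xs \<Longrightarrow> length xs \<le> max_path n G"
  unfolding max_path_def using finite_paths by (intro Max_ge) auto

lemma longest_path_exists:
  assumes "n > 0" obtains xs where "longest_path n G xs" "length xs = max_path n G"
proof -
  have "is_path n G [0]" using assms by (auto simp: is_path_def)
  then have "max_path n G \<in> length ` {xs. is_path n G xs}"
    unfolding max_path_def using finite_paths by (intro Max_in) auto
  then obtain xs where "is_path n G xs" "length xs = max_path n G" by auto
  moreover from this have "longest_path n G xs"
    using path_le_max_path by (auto simp: longest_path_def)
  ultimately show ?thesis using that by blast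
qed

lemma max_path_le: "n > 0 \<Longrightarrow> max_path n G \<le> n"
  using longest_path_exists[of n G] is_path_length unfolding longest_path_def by metis

lemma max_path_mono: assumes "n > 0" "G \<subseteq> G'" shows "max_path n G \<le> max_path n G'"
  using longest_path_exists[OF assms(1), of G] path_le_max_path is_path_mono[OF _ assms(2)]
  unfolding longest_path_def by metis

lemma has_hamilton_cycle_mono: "has_hamilton_cycle n G \<Longrightarrow> G \<subseteq> G' \<Longrightarrow> has_hamilton_cycle n G'"
  unfolding has_hamilton_cycle_def by blast

definition boosters :: "nat \<Rightarrow> nat set set \<Rightarrow> nat set set" where
  "boosters n G = {e \<in> complete_edges n. e \<notin> G \<and>
     (has_hamilton_cycle n (insert e G) \<or> max_path n (insert e G) > max_path n G)}"

lemma card_doubletons_ge: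
  assumes "finite P" "\<And>x y. (x, y) \<in> P \<Longrightarrow> {x, y} \<in> B" "finite B"
  shows "card P \<le> 2 * card B"
proof -
  have "card P \<le> card (\<Union>b\<in>B. {p \<in> P. {fst p, snd p} = b})"
    using assms by (intro card_mono) auto
  also have "\<dots> \<le> (\<Sum>b\<in>B. card {p \<in> P. {fst p, snd p} = b})"
    by (rule card_UN_le) (rule assms)
  also have "\<dots> \<le> (\<Sum>b\<in>B. 2)"
  proof (rule sum_mono)
    fix b
    show "card {p \<in> P. {fst p, snd p} = b} \<le> 2"
    proof (cases "{p \<in> P. {fst p, snd p} = b} = {}")
      case False
      then obtain x y where "b = {x, y}" by auto
      then have sub: "{p \<in> P. {fst p, snd p} = b} \<subseteq> {(x, y), (y, x)}" by (auto simp: doubleton_eq_iff)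
      have "card {p \<in> P. {fst p, snd p} = b} \<le> card {(x, y), (y, x)}"
        by (rule card_mono[OF _ sub]) simp
      also have "\<dots> \<le> 2" by (cases "x = y") auto
      finally show ?thesis .
    qed (metis card.empty zero_le)
  qed
  finally show ?thesis by simp
qed

text \<open>Rotating a longest path gives more than \<open>k\<close> heads \<open>e\<close>; reversing the corresponding paths and rotating again
  gives, for each \<open>e\<close>, more than \<open>k\<close> vertices \<open>f\<close> such that a longest path joins \<open>e\<close> and \<open>f\<close>. If such a pair
  is an edge, the path closes to a cycle, and connectedness gives a Hamilton cycle or a longer path. So
  none of these pairs is an edge of \<open>G\<close>, and all of them are boosters.\<close>

lemma many_boosters:
  assumes n: "n \<ge> 3" and con: "cut_connected n G" and nh: "\<not> has_hamilton_cycle n G"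
    and exp: "\<And>S. S \<subseteq> {0..<n} \<Longrightarrow> S \<noteq> {} \<Longrightarrow> card S \<le> k \<Longrightarrow> card (nbrs n G S) \<ge> 3 * card S"
  shows "k ^ 2 \<le> 2 * card (boosters n G)"
proof -
  obtain xs where lp: "longest_path n G xs" and len: "length xs = max_path n G"
    using longest_path_exists[of n G] n by auto
  define E where "E = hd ` rotations G xs"
  define F where "F e = {f. \<exists>ys. longest_path n G ys \<and> length ys = max_path n G \<and> hd ys = f \<and> last ys = e}" for e
  have subF: "F e \<subseteq> {0..<n}" for e
  proof
    fix f assume "f \<in> F e"
    then obtain ys where "is_path n G ys" "hd ys = f" by (auto simp: F_def longest_path_def)
    then show "f \<in> {0..<n}" unfolding is_path_def using hd_in_set[of ys] by blast
  qed
  have subE: "E \<subseteq> {0..<n}"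
    unfolding E_def by (rule rotations_hd_subset) (use lp in \<open>simp add: longest_path_def\<close>)
  have finE: "finite E" using subE finite_subset by blast
  have cE: "card E > k" unfolding E_def by (rule posa_many_endpoints[OF lp exp])
  have cF: "card (F e) \<ge> k" if "e \<in> E" for e
  proof -
    from that obtain ys where ys: "ys \<in> rotations G xs" "e = hd ys" by (auto simp: E_def)
    have lys: "longest_path n G ys" by (rule rotations_longest[OF lp ys(1)])
    then have lr: "longest_path n G (rev ys)"
      using is_path_rev by (auto simp: longest_path_def)
    have ney: "ys \<noteq> []" using lys by (auto simp: longest_path_def is_path_def)
    have "hd ` rotations G (rev ys) \<subseteq> F e"
    proof safe
      fix zs assume zs: "zs \<in> rotations G (rev ys)"
      have l: "longest_path n G zs" by (rule rotations_longest[OF lr zs])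
      have "last zs = e" using rotations_is_path[OF _ zs, of n] lr ys ney
        by (auto simp: longest_path_def last_rev)
      moreover have "length zs = max_path n G"
        using l lp len unfolding longest_path_def by (metis order_antisym)
      ultimately show "hd zs \<in> F e" using l by (auto simp: F_def)
    qed
    then have "card (hd ` rotations G (rev ys)) \<le> card (F e)"
      by (intro card_mono finite_subset[OF subF]) auto
    then show ?thesis using posa_many_endpoints[OF lr exp] by force
  qed
  define P where "P = (SIGMA e:E. F e)"
  have fF: "finite (F e)" for e using subF finite_subset by blast
  have "k ^ 2 \<le> (\<Sum>e\<in>E. k)" using cE by (simp add: power2_eq_square)
  also have "\<dots> \<le> (\<Sum>e\<in>E. card (F e))" using cF by (rule sum_mono)
  also have "\<dots> = card P" unfolding P_def using finE fF by simp
  also have "\<dots> \<le> 2 * card (boosters n G)"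
  proof (rule card_doubletons_ge)
    show "finite P" unfolding P_def using finE fF by auto
    show "finite (boosters n G)"
      by (rule finite_subset[of _ "Pow {0..<n}"]) (auto simp: boosters_def complete_edges_def)
    fix e f assume "(e, f) \<in> P"
    then obtain ys where ys: "longest_path n G ys" "length ys = max_path n G" "hd ys = f" "last ys = e"
      by (auto simp: P_def F_def)
    have py: "is_path n G ys" using ys by (simp add: longest_path_def)
    have ef: "e \<in> set ys" "f \<in> set ys" using py ys by (auto simp: is_path_def)
    then have efn: "e < n" "f < n" using py by (auto simp: is_path_def)
    have "\<exists>zs. is_path n G zs \<and> length zs \<ge> 2"
    proof -
      have "{0} \<subseteq> {0..<n}" "{0} \<noteq> {0..<n}" using n by (auto simp: set_eq_iff intro!: exI[of _ 1])
      then obtain y where "y < n" "y \<noteq> 0" "{0, y} \<in> G"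
        using con unfolding cut_connected_def by blast
      then have "is_path n G [0, y]" using n by (auto simp: is_path_def)
      then show ?thesis by force
    qed
    then have "length ys \<ge> 2" using ys(1) unfolding longest_path_def by (meson order_trans)
    then have "e \<noteq> f" using py ys(3,4) unfolding is_path_def
      by (cases ys) (auto split: if_splits)
    then have ce: "{e, f} \<in> complete_edges n" using efn by (auto simp: complete_edges_def)
    have nG: "{e, f} \<notin> G"
    proof
      assume "{e, f} \<in> G"
      then have "\<exists>zs. is_path n G zs \<and> length zs > length ys"
        using longest_cycle_hamilton[OF n con py] ys nh by auto
      then show False using ys(1) unfolding longest_path_def by (meson not_le)
    qed
    have "has_hamilton_cycle n (insert {e, f} G) \<or> (\<exists>zs. is_path n (insert {e, f} G) zs \<and> length zs > length ys)"
    proof (rule longest_cycle_hamilton[OF n])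
      show "cut_connected n (insert {e, f} G)" by (rule cut_connected_mono[OF con]) auto
      show "is_path n (insert {e, f} G) ys" by (rule is_path_mono[OF py]) auto
    qed (use ys in auto)
    moreover have "max_path n (insert {e, f} G) > max_path n G"
      if "is_path n (insert {e, f} G) zs" "length zs > length ys" for zs
      using path_le_max_path[OF that(1)] that(2) ys(2) by linarith
    ultimately show "{e, f} \<in> boosters n G" using ce nG by (auto simp: boosters_def)
  qed
  finally show ?thesis .
qed

section \<open>Vertices that Breaker exhausts\<close>

lemma valid_claimed_subset: "valid n h \<Longrightarrow> claimed p h \<subseteq> complete_edges n"
  by (induction n h rule: valid.induct) (use free_subset in auto)

lemma edge_other_end:
  assumes "e \<in> complete_edges n" "v \<in> e"
  obtains w where "e = {v, w}" "w < n" "w \<noteq> v" "v < n"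
proof -
  have "e \<subseteq> {0..<n}" "card e = 2" using assms by (auto simp: complete_edges_def)
  with assms that show ?thesis by (fastforce simp: card_2_iff)
qed

lemma sum_fdeg: "(\<Sum>v<n. fdeg n h v) = 2 * card (free n h)"
proof -
  have "(\<Sum>v<n. fdeg n h v) = (\<Sum>v<n. \<Sum>e\<in>free n h. of_bool (v \<in> e))"
    by (simp add: of_bool_def sum.If_cases Int_def fdeg_def)
  also have "\<dots> = (\<Sum>e\<in>free n h. \<Sum>v<n. of_bool (v \<in> e))" by (rule sum.swap)
  also have "\<dots> = (\<Sum>e\<in>free n h. 2)"
  proof (rule sum.cong)
    fix e assume "e \<in> free n h"
    then have "e \<subseteq> {0..<n}" "card e = 2" using free_subset[of n h] by (auto simp: complete_edges_def)
    moreover from this have "{..<n} \<inter> {v. v \<in> e} = e" by auto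
    ultimately show "(\<Sum>v<n. of_bool (v \<in> e)) = (2::nat)" by (simp add: of_bool_def sum.If_cases)
  qed simp
  finally show ?thesis by simp
qed

text \<open>Handshake lemma for the claimed edges.\<close>

lemma sum_claimed_degrees:
  assumes "valid n h"
  shows "(\<Sum>v<n. real (n - 1) - real (fdeg n h v)) = 2 * real (length h)"
proof -
  have "(\<Sum>v<n. real (fdeg n h v)) = 2 * real (card (free n h))"
    using arg_cong[OF sum_fdeg[of n h], of real] by simp
  moreover have "real (card (free n h)) + real (length h) = n * (real n - 1) / 2"
    using arg_cong[OF card_free[OF assms], of real] by (simp add: real_choose_2)
  moreover have "real n * real (n - 1) = n * (real n - 1)" by (cases n) auto
  ultimately show ?thesis by (simp add: sum_subtractf)
qed

lemma card_low_degree: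
  assumes "valid n h"
  shows "real (card {v. v < n \<and> fdeg n h v \<le> k}) * (real (n - 1) - real k) \<le> 2 * real (length h)"
proof -
  have "real (card {v. v < n \<and> fdeg n h v \<le> k}) * (real (n - 1) - real k)
     = (\<Sum>v | v < n \<and> fdeg n h v \<le> k. real (n - 1) - real k)" by (simp only: sum_constant)
  also have "\<dots> \<le> (\<Sum>v | v < n \<and> fdeg n h v \<le> k. real (n - 1) - real (fdeg n h v))"
    by (intro sum_mono) auto
  also have "\<dots> \<le> (\<Sum>v<n. real (n - 1) - real (fdeg n h v))"
  proof (rule sum_mono2)
    show "0 \<le> real (n - 1) - real (fdeg n h v)" for v
      using of_nat_mono[OF fdeg_le, of n h v, where 'a = real] by simp
  qed auto
  also have "\<dots> = 2 * real (length h)" by (rule sum_claimed_degrees[OF assms])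
  finally show ?thesis .
qed

text \<open>The relation records, for a vertex \<open>x\<close>, the fresh neighbours that Maker's moves have given to it. A hit at
  \<open>x\<close> counts only while the number of free edges at \<open>x\<close> lies between \<open>m0\<close> and \<open>k0\<close> and only if its other end
  has not been recorded for any vertex. The cap of 8 records per vertex keeps the range of the
  relation small whatever Maker's degrees are, so that almost every hit is fresh. The number 8
  leaves a factor 7 when a set of vertices is compared with its outer neighbours (\<open>fresh_nbrs\<close>).\<close>

fun fresh :: "nat \<Rightarrow> nat \<Rightarrow> nat \<Rightarrow> history \<Rightarrow> (nat \<times> nat) set" where
  "fresh n m0 k0 [] = {}"
| "fresh n m0 k0 ((p, e) # h) = fresh n m0 k0 h \<union>
     (if p = Breaker then {} else
      {(x, y). e = {x, y} \<and> x \<noteq> y \<and> m0 \<le> fdeg n h x \<and> fdeg n h x \<le> k0 \<and>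
               card (fresh n m0 k0 h `` {x}) < 8 \<and> y \<notin> Range (fresh n m0 k0 h)})"

lemma fresh_claimed: "(x, y) \<in> fresh n m0 k0 h \<Longrightarrow> {x, y} \<in> claimed Maker h"
  by (induction h rule: fresh.induct) (auto split: if_splits, metis player.exhaust)

lemma fresh_less:
  assumes "valid n h" "(x, y) \<in> fresh n m0 k0 h"
  shows "x < n" "y < n" "x \<noteq> y"
proof -
  have "{x, y} \<in> complete_edges n"
    using fresh_claimed[OF assms(2)] valid_claimed_subset[OF assms(1)] by blast
  then show "x < n" "y < n" "x \<noteq> y" by (auto simp: complete_edges_def card_insert_if split: if_splits)
qed

lemma fresh_inj: "(x, y) \<in> fresh n m0 k0 h \<Longrightarrow> (x', y) \<in> fresh n m0 k0 h \<Longrightarrow> x = x'"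
proof (induction h rule: fresh.induct)
  case (2 n m0 k0 p e h)
  then show ?case by (fastforce split: if_splits simp: Range_iff doubleton_eq_iff)
qed simp

lemma finite_fresh: "valid n h \<Longrightarrow> finite (fresh n m0 k0 h)"
  by (rule finite_subset[of _ "{0..<n} \<times> {0..<n}"]) (auto dest: fresh_less)

lemma fresh_Image_Maker:
  assumes "valid n h" "e \<in> free n h"
  shows "fresh n m0 k0 ((Maker, e) # h) `` {x} = fresh n m0 k0 h `` {x} \<union>
    {y. e = {x, y} \<and> x \<noteq> y \<and> m0 \<le> fdeg n h x \<and> fdeg n h x \<le> k0 \<and>
               card (fresh n m0 k0 h `` {x}) < 8 \<and> y \<notin> Range (fresh n m0 k0 h)}"
  by auto

lemma finite_fresh_Image: "valid n h \<Longrightarrow> finite (fresh n m0 k0 h `` {x})"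
  by (simp add: finite_fresh finite_Image)

lemma card_fresh_Image: "valid n h \<Longrightarrow> card (fresh n m0 k0 h `` {x}) \<le> 8"
proof (induction n h rule: valid.induct)
  case (2 n p e h)
  then have v: "valid n h" "e \<in> free n h" by auto
  show ?case
  proof (cases "p = Breaker")
    case True then show ?thesis using 2 by simp
  next
    case False
    then have p: "p = Maker" by (cases p) auto
    define N where "N = {y. e = {x, y} \<and> x \<noteq> y \<and> m0 \<le> fdeg n h x \<and> fdeg n h x \<le> k0 \<and>
               card (fresh n m0 k0 h `` {x}) < 8 \<and> y \<notin> Range (fresh n m0 k0 h)}"
    have eq: "fresh n m0 k0 ((p, e) # h) `` {x} = fresh n m0 k0 h `` {x} \<union> N"
      unfolding p N_def by (rule fresh_Image_Maker[OF v])
    have IH: "card (fresh n m0 k0 h `` {x}) \<le> 8" using "2.IH" v(1) by blast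
    have "z = y" if "y \<in> N" "z \<in> N" for y z
    proof -
      have "{x, y} = {x, z}" using that unfolding N_def by blast
      then show ?thesis by (metis doubleton_eq_iff)
    qed
    then have "card N \<le> 1" by (metis One_nat_def card_le_Suc0_iff_eq card.infinite zero_le)
    moreover have "N = {} \<or> card (fresh n m0 k0 h `` {x}) < 8" unfolding N_def by blast
    moreover have "card (fresh n m0 k0 ((p, e) # h) `` {x}) \<le> card (fresh n m0 k0 h `` {x}) + card N"
      unfolding eq by (rule card_Un_le)
    ultimately show ?thesis using IH by fastforce
  qed
qed simp

lemma fresh_active: "valid n h \<Longrightarrow> (x, y) \<in> fresh n m0 k0 h \<Longrightarrow> fdeg n h x \<le> k0"
proof (induction n h rule: valid.induct)
  case (2 n p e h)
  then have "e \<in> free n h" by auto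
  then have "fdeg n ((p, e) # h) x \<le> fdeg n h x" by (simp add: fdeg_Cons)
  moreover have "(x, y) \<in> fresh n m0 k0 h \<or> fdeg n h x \<le> k0"
    using "2.prems"(2) by (cases p) auto
  then have "fdeg n h x \<le> k0" using "2.IH" "2.prems"(1) by auto
  ultimately show ?case by linarith
qed simp

lemma card_Range_fresh:
  assumes "valid n h"
  shows "card (Range (fresh n m0 k0 h)) \<le> 8 * card {v. v < n \<and> fdeg n h v \<le> k0}"
proof -
  let ?A = "{v. v < n \<and> fdeg n h v \<le> k0}"
  have fA: "finite ?A" by simp
  have "Range (fresh n m0 k0 h) \<subseteq> (\<Union>v\<in>?A. fresh n m0 k0 h `` {v})"
  proof
    fix y assume "y \<in> Range (fresh n m0 k0 h)"
    then obtain x where x: "(x, y) \<in> fresh n m0 k0 h" by auto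
    then have "x \<in> ?A" using fresh_active[OF assms x] fresh_less(1)[OF assms x] by simp
    then show "y \<in> (\<Union>v\<in>?A. fresh n m0 k0 h `` {v})" using x by blast
  qed
  then have "card (Range (fresh n m0 k0 h)) \<le> card (\<Union>v\<in>?A. fresh n m0 k0 h `` {v})"
    using finite_fresh_Image[OF assms] fA by (intro card_mono finite_UN_I) auto
  also have "\<dots> \<le> (\<Sum>v\<in>?A. card (fresh n m0 k0 h `` {v}))" by (rule card_UN_le[OF fA])
  also have "\<dots> \<le> (\<Sum>v\<in>?A. 8)" using card_fresh_Image[OF assms] by (intro sum_mono) auto
  finally show ?thesis by simp
qed

text \<open>The sum of the numbers of free edges at a vertex over all moves of Maker until it has fewer than \<open>m0\<close> free
  edges, if it has \<open>k\<close> of them now, Maker has \<open>i\<close> moves left in this turn, and Breaker claims an edge at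
  the vertex in every round. As long as Maker misses the vertex, no play of Breaker can make it smaller.\<close>

definition exposure :: "nat \<Rightarrow> nat \<Rightarrow> nat \<Rightarrow> nat \<Rightarrow> nat" where
  "exposure a m0 i k = (if k < m0 then 0 else i * k + a * (\<Sum>m=m0..<k. m))"

text \<open>With \<open>\<beta>\<close> slightly below \<open>2 / n\<^sup>2\<close>, this bounds the conditional expectation of \<open>lam\<close> to the power of the
  final number of fresh neighbours, restricted to the event that the vertex gets exhausted while this
  number is below 8.\<close>

definition vertex_weight ::
    "nat \<Rightarrow> nat \<Rightarrow> nat \<Rightarrow> nat \<Rightarrow> real \<Rightarrow> real \<Rightarrow> nat \<Rightarrow> history \<Rightarrow> nat \<Rightarrow> real" where
  "vertex_weight n a m0 k0 lam \<beta> i h v = (if card (fresh n m0 k0 h `` {v}) < 8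
     then lam ^ card (fresh n m0 k0 h `` {v}) * exp (- \<beta> * exposure a m0 i (fdeg n h v)) else 0)"

text \<open>An upper bound for the weight with which a vertex drops to \<open>k0\<close> free edges.\<close>

definition entry_weight :: "nat \<Rightarrow> nat \<Rightarrow> nat \<Rightarrow> real \<Rightarrow> real" where
  "entry_weight a m0 k0 \<beta> = exp (- \<beta> * (a * (\<Sum>m=m0..<k0. m)))"

text \<open>Vertices with more than \<open>k0\<close> free edges count 0, and every other vertex pays \<open>entry_weight\<close> once, at the
  moment it drops to \<open>k0\<close>. This is what makes the process a supermartingale that starts at 0:
  its final expectation compares the weight of a vertex with the probability that Breaker
  bothers to attack it, and only few vertices can be attacked.\<close>

definition vertex_excess ::
    "nat \<Rightarrow> nat \<Rightarrow> nat \<Rightarrow> nat \<Rightarrow> real \<Rightarrow> real \<Rightarrow> nat \<Rightarrow> nat \<Rightarrow> history \<Rightarrow> real" where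
  "vertex_excess n a m0 k0 lam \<beta> v i h =
     (if fdeg n h v \<le> k0 then vertex_weight n a m0 k0 lam \<beta> i h v - entry_weight a m0 k0 \<beta> else 0)"

context
  fixes n a m0 k0 :: nat and lam \<beta> :: real
  assumes lam: "0 < lam" "lam \<le> 1" and \<beta>: "\<beta> \<ge> 0" "\<beta> * (real n)\<^sup>2 / 2 \<le> 1 - 4 * lam"
    and e2: "exp (\<beta> * (a * n)) \<le> 2"
begin

abbreviation "weight \<equiv> vertex_weight n a m0 k0 lam \<beta>"
abbreviation "excess \<equiv> vertex_excess n a m0 k0 lam \<beta>"
abbreviation "entry \<equiv> entry_weight a m0 k0 \<beta>"

lemma weight_le_entry_weight: "fdeg n h v = k0 \<Longrightarrow> weight i h v \<le> entry"
proof -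
  assume k: "fdeg n h v = k0"
  have A: "exp (- \<beta> * exposure a m0 i k0) \<le> entry"
    using \<beta> by (auto simp: entry_weight_def exposure_def intro!: mult_left_mono)
  have B: "lam ^ card (fresh n m0 k0 h `` {v}) * exp (- \<beta> * exposure a m0 i k0) \<le> 1 * exp (- \<beta> * exposure a m0 i k0)"
    using lam by (intro mult_right_mono power_le_one) auto
  then have "lam ^ card (fresh n m0 k0 h `` {v}) * exp (- \<beta> * exposure a m0 i k0) \<le> entry"
    using A by linarith
  moreover have "0 \<le> entry" by (simp add: entry_weight_def)
  ultimately show ?thesis unfolding vertex_weight_def k by presburger
qed

text \<open>A hit by Maker also costs the vertex a free edge. The loss of that edge lowers the exposure by at most
  \<open>a * n\<close> and hence raises the weight by at most a factor \<open>exp (\<beta> * (a * n)) \<le> 2\<close>.\<close>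

lemma exposure_drop:
  assumes "m0 \<le> k" "k \<le> n" "i < a"
  shows "exposure a m0 i k \<le> exposure a m0 i (k - 1) + a * n"
proof (cases "k = m0")
  case True
  have "i * m0 \<le> a * n" using assms True by (intro mult_mono) auto
  then show ?thesis using True by (simp add: exposure_def)
next
  case False
  then obtain k' where k': "k = Suc k'" "m0 \<le> k'" using assms by (cases k) auto
  have "i + a * k' \<le> a * n"
  proof -
    have "i + a * k' \<le> a * Suc k'" using assms by simp
    also have "\<dots> \<le> a * n" using assms k' by (intro mult_left_mono) auto
    finally show ?thesis .
  qed
  then show ?thesis using k' by (simp add: exposure_def algebra_simps)
qed

text \<open>Of the \<open>k\<close> free edges at the vertex at most \<open>card (Range (fresh n m0 k0 h)) \<le> lam * k\<close> are not fresh. A fresh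
  hit multiplies the weight by at most \<open>2 * lam\<close> and any other hit by at most 2, so the total over
  \<open>F\<close> free edges is at most \<open>F - k * (1 - 4 * lam)\<close> times the weight. That is at most \<open>F * exp (- \<beta> * k)\<close>, and
  \<open>exp (- \<beta> * k)\<close> is the ratio of the weight before the move to the weight after a miss.\<close>

lemma excess_maker:
  assumes h: "valid n h" "free n h \<noteq> {}" and i: "i < a"
    and q: "real (card (Range (fresh n m0 k0 h))) \<le> lam * m0"
  shows "(\<Sum>e\<in>free n h. excess v i ((Maker, e) # h)) \<le> card (free n h) * excess v (Suc i) h"
proof (cases "fdeg n h v \<le> k0")
  case False
  have "excess v i ((Maker, e) # h) \<le> 0" if "e \<in> free n h" for e
  proof (cases "fdeg n ((Maker, e) # h) v \<le> k0")
    case True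
    then have "fdeg n ((Maker, e) # h) v = k0" using False that by (auto simp: fdeg_Cons split: if_splits)
    then show ?thesis using weight_le_entry_weight by (simp add: vertex_excess_def)
  qed (simp add: vertex_excess_def)
  then have "(\<Sum>e\<in>free n h. excess v i ((Maker, e) # h)) \<le> 0" by (intro sum_nonpos) auto
  then show ?thesis using False by (simp add: vertex_excess_def)
next
  case True
  let ?F = "free n h"
  define k where "k = fdeg n h v"
  define I where "I = fresh n m0 k0 h `` {v}"
  define R where "R = Range (fresh n m0 k0 h)"
  have fI: "finite I" unfolding I_def by (rule finite_fresh_Image[OF h(1)])
  have finR: "finite R" unfolding R_def by (simp add: finite_Range finite_fresh[OF h(1)])
  have IR: "I \<subseteq> R" by (auto simp: I_def R_def)
  have v': "valid n ((Maker, e) # h)" if "e \<in> ?F" for e using that h by simp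
  have ex: "excess v i ((Maker, e) # h) = weight i ((Maker, e) # h) v - entry" if "e \<in> ?F" for e
    using True that by (auto simp: vertex_excess_def fdeg_Cons)
  have I': "fresh n m0 k0 ((Maker, e) # h) `` {v} = I \<union> {y. e = {v, y} \<and> v \<noteq> y \<and> m0 \<le> k \<and> k \<le> k0 \<and>
               card I < 8 \<and> y \<notin> R}" if "e \<in> ?F" for e
    unfolding I_def k_def R_def by (rule fresh_Image_Maker[OF h(1) that])
  have "(\<Sum>e\<in>?F. weight i ((Maker, e) # h) v) \<le> card ?F * weight (Suc i) h v"
  proof (cases "card I < 8")
    case False
    have "weight i ((Maker, e) # h) v = 0" if "e \<in> ?F" for e
    proof -
      have "card I \<le> card (fresh n m0 k0 ((Maker, e) # h) `` {v})"
        unfolding I'[OF that] using finite_fresh_Image[OF v'[OF that], of m0 k0 v]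
        unfolding I'[OF that] by (intro card_mono) auto
      then show ?thesis using False by (simp add: vertex_weight_def)
    qed
    then have "(\<Sum>e\<in>?F. weight i ((Maker, e) # h) v) = 0" by simp
    moreover have "weight (Suc i) h v = 0" using False by (simp add: vertex_weight_def I_def)
    ultimately show ?thesis by simp
  next
    case j8: True
    show ?thesis
    proof (cases "k < m0")
      case True
      have "weight i ((Maker, e) # h) v = weight (Suc i) h v" if e: "e \<in> ?F" for e
      proof -
        have "fresh n m0 k0 ((Maker, e) # h) `` {v} = I" unfolding I'[OF e] using True by auto
        moreover have "fdeg n ((Maker, e) # h) v < m0" using True e by (auto simp: fdeg_Cons k_def)
        ultimately show ?thesis using True by (simp add: vertex_weight_def exposure_def I_def k_def)
      qed
      then show ?thesis by simp
    next
      case False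
      define w where "w = lam ^ card I * exp (- \<beta> * exposure a m0 i k)"
      have w0: "w > 0" using lam by (simp add: w_def)
      have kn: "k \<le> n" using fdeg_le[of n h v] by (simp add: k_def)
      \<comment> \<open>Free edges at \<open>v\<close> whose other end has already been recorded.\<close>
      define Bd where "Bd = {e \<in> ?F. \<exists>y\<in>R. e = {v, y}}"
      have cBd: "card Bd \<le> card R"
      proof -
        have "Bd \<subseteq> (\<lambda>y. {v, y}) ` R" by (auto simp: Bd_def)
        then have "card Bd \<le> card ((\<lambda>y. {v, y}) ` R)" using finR by (intro card_mono) auto
        also have "\<dots> \<le> card R" by (rule card_image_le[OF finR])
        finally show ?thesis .
      qed
      have drop: "exp (- \<beta> * exposure a m0 i (k - 1)) \<le> 2 * exp (- \<beta> * exposure a m0 i k)"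
      proof -
        have "real (exposure a m0 i k) \<le> real (exposure a m0 i (k - 1) + a * n)"
          using exposure_drop[of k i] False kn i by (intro of_nat_mono) auto
        then have "\<beta> * real (exposure a m0 i k) \<le> \<beta> * (real (exposure a m0 i (k - 1)) + a * n)"
          using \<beta> by (intro mult_left_mono) auto
        then have "exp (- \<beta> * exposure a m0 i (k - 1)) \<le> exp (\<beta> * (a * n) + (- \<beta> * exposure a m0 i k))"
          by (simp add: algebra_simps)
        also have "\<dots> \<le> 2 * exp (- \<beta> * exposure a m0 i k)"
          using e2 unfolding exp_add by (intro mult_right_mono) auto
        finally show ?thesis .
      qed
      have bound: "weight i ((Maker, e) # h) v \<le>
          w + of_bool (v \<in> e) * (2 * lam * w - w) + of_bool (e \<in> Bd) * (2 * w)" if e: "e \<in> ?F" for e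
      proof (cases "v \<in> e")
        case False
        then have "fresh n m0 k0 ((Maker, e) # h) `` {v} = I" unfolding I'[OF e] by auto
        then have "weight i ((Maker, e) # h) v = w"
          using False e j8 by (simp add: vertex_weight_def w_def fdeg_Cons k_def)
        then show ?thesis using False w0 by simp
      next
        case ve: True
        have "e \<in> complete_edges n" using e free_subset by blast
        then obtain y where y: "e = {v, y}" "y \<noteq> v" using ve by (metis edge_other_end)
        have fd: "fdeg n ((Maker, e) # h) v = k - 1" using ve e by (simp add: fdeg_Cons k_def)
        show ?thesis
        proof (cases "y \<in> R")
          case yR: True
          then have "fresh n m0 k0 ((Maker, e) # h) `` {v} = I"
            unfolding I'[OF e] using y by (auto simp: doubleton_eq_iff)
          then have "weight i ((Maker, e) # h) v = lam ^ card I * exp (- \<beta> * exposure a m0 i (k - 1))"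
            using fd j8 by (simp add: vertex_weight_def)
          also have "\<dots> \<le> lam ^ card I * (2 * exp (- \<beta> * exposure a m0 i k))"
            using drop lam by (intro mult_left_mono) auto
          also have "\<dots> = 2 * w" by (simp add: w_def)
          also have "\<dots> \<le> w + (2 * lam * w - w) + 2 * w" using w0 lam by simp
          also have "e \<in> Bd" using e y yR by (auto simp: Bd_def)
          ultimately show ?thesis using ve by simp
        next
          case yR: False
          then have "fresh n m0 k0 ((Maker, e) # h) `` {v} = insert y I"
            unfolding I'[OF e] using y False j8 True by (auto simp: doubleton_eq_iff k_def)
          moreover have "card (insert y I) = Suc (card I)"
            using yR IR fI by (subst card_insert_disjoint) auto
          ultimately have "weight i ((Maker, e) # h) v \<le> lam ^ Suc (card I) * exp (- \<beta> * exposure a m0 i (k - 1))"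
            using fd lam by (simp add: vertex_weight_def)
          also have "\<dots> \<le> lam ^ Suc (card I) * (2 * exp (- \<beta> * exposure a m0 i k))"
            using drop lam by (intro mult_left_mono) auto
          also have "\<dots> = w + (2 * lam * w - w)" by (simp add: w_def)
          finally show ?thesis using ve w0 by simp
        qed
      qed
      have "(\<Sum>e\<in>?F. weight i ((Maker, e) # h) v) \<le>
          (\<Sum>e\<in>?F. w + of_bool (v \<in> e) * (2 * lam * w - w) + of_bool (e \<in> Bd) * (2 * w))"
        using bound by (rule sum_mono)
      also have "\<dots> = card ?F * w + k * (2 * lam * w - w) + card Bd * (2 * w)"
      proof -
        have "(\<Sum>e\<in>?F. of_bool (v \<in> e)) = real k"
          by (simp add: of_bool_def sum.If_cases Int_def fdeg_def k_def)
        moreover have "(\<Sum>e\<in>?F. of_bool (e \<in> Bd)) = real (card Bd)"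
        proof -
          have "?F \<inter> Bd = Bd" by (auto simp: Bd_def)
          then show ?thesis by (simp add: of_bool_def sum.If_cases)
        qed
        ultimately show ?thesis by (simp add: sum.distrib sum_distrib_right[symmetric])
      qed
      also have "\<dots> = w * (card ?F - k * (1 - 2 * lam) + 2 * card Bd)" by (simp add: algebra_simps)
      also have "\<dots> \<le> w * (card ?F - k * (1 - 4 * lam))"
      proof (rule mult_left_mono)
        have "real (card Bd) \<le> card R" using cBd by simp
        also have "\<dots> \<le> lam * m0" using q by (simp add: R_def)
        also have "\<dots> \<le> lam * k" using False lam by (intro mult_left_mono) auto
        finally show "card ?F - k * (1 - 2 * lam) + 2 * card Bd \<le> card ?F - k * (1 - 4 * lam)"
          by (simp add: algebra_simps)
      qed (use w0 in simp)
      also have "\<dots> \<le> w * (card ?F * exp (- \<beta> * k))"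
      proof (rule mult_left_mono)
        have "real (card ?F) \<le> n choose 2" using card_free[OF h(1)] by simp
        also have "\<dots> \<le> (real n)\<^sup>2 / 2" by (simp add: real_choose_2 power2_eq_square mult_left_mono)
        finally have "\<beta> * card ?F \<le> \<beta> * ((real n)\<^sup>2 / 2)" using \<beta> by (intro mult_left_mono) auto
        then have "\<beta> * card ?F \<le> 1 - 4 * lam" using \<beta> by simp
        then have "k * (\<beta> * card ?F) \<le> k * (1 - 4 * lam)" by (rule mult_left_mono) simp
        moreover have "card ?F * (1 + (- \<beta> * k)) \<le> card ?F * exp (- \<beta> * k)"
          by (rule mult_left_mono[OF exp_ge_add_one_self]) simp
        ultimately show "card ?F - k * (1 - 4 * lam) \<le> card ?F * exp (- \<beta> * k)"
          by (simp add: algebra_simps)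
      qed (use w0 in simp)
      also have "\<dots> = card ?F * (w * exp (- \<beta> * k))" by simp
      also have "w * exp (- \<beta> * k) = weight (Suc i) h v"
        using False j8 by (simp add: w_def vertex_weight_def exposure_def I_def k_def algebra_simps flip: exp_add)
      finally show ?thesis .
    qed
  qed
  moreover have "(\<Sum>e\<in>?F. excess v i ((Maker, e) # h)) = (\<Sum>e\<in>?F. weight i ((Maker, e) # h) v - entry)"
    using ex by (rule sum.cong[OF refl])
  moreover have "excess v (Suc i) h = weight (Suc i) h v - entry"
    using True by (simp add: vertex_excess_def)
  ultimately show ?thesis by (simp add: sum_subtractf right_diff_distrib)
qed

text \<open>Exposure is defined so that an attack on the vertex leaves it unchanged, while a move elsewhere does
  not decrease it.\<close>

lemma excess_breaker:
  assumes "e \<in> free n h"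
  shows "excess v a ((Breaker, e) # h) \<le> excess v 0 h"
proof (cases "fdeg n h v \<le> k0")
  case False
  then show ?thesis
  proof (cases "fdeg n ((Breaker, e) # h) v \<le> k0")
    case True
    then have "fdeg n ((Breaker, e) # h) v = k0" using False assms by (auto simp: fdeg_Cons split: if_splits)
    then show ?thesis using weight_le_entry_weight False by (simp add: vertex_excess_def)
  qed (use False in \<open>simp add: vertex_excess_def\<close>)
next
  case True
  define k where "k = fdeg n h v"
  define k' where "k' = fdeg n ((Breaker, e) # h) v"
  have k': "k' = k \<or> k' = k - 1 \<and> k > 0" using assms fdeg_pos[OF assms, of v] by (auto simp: k_def k'_def fdeg_Cons)
  have "exposure a m0 0 k \<le> exposure a m0 a k'"
  proof (cases "k' = k")
    case False
    then have "k = Suc k'" using k' by auto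
    then show ?thesis by (auto simp: exposure_def algebra_simps not_less le_Suc_eq)
  qed (simp add: exposure_def)
  then have "exp (- \<beta> * exposure a m0 a k') \<le> exp (- \<beta> * exposure a m0 0 k)"
    using \<beta> by (auto intro!: mult_left_mono)
  then have "weight a ((Breaker, e) # h) v \<le> weight 0 h v"
    using lam by (auto simp: vertex_weight_def k_def k'_def intro!: mult_left_mono)
  moreover have "k' \<le> k0" using k' True by (auto simp: k_def)
  ultimately show ?thesis using True by (simp add: vertex_excess_def k'_def)
qed

text \<open>An exhausted vertex with fewer than 8 fresh neighbours has exposure 0 and hence weight at least \<open>lam ^ 7\<close>.\<close>

lemma starved_vertex_prob:
  assumes \<sigma>: "breaker_strategy n \<sigma>" and r: "r * (a + 1) \<le> n choose 2"
    and q: "16 * real (r * (a + 1)) \<le> lam * m0 * (real (n - 1) - real k0)" and k0: "k0 < n - 1" "m0 \<le> k0 + 1" and v: "v < n"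
  shows "lam ^ 7 * measure_pmf.prob (rounds n a \<sigma> r) {h. fdeg n h v < m0 \<and> card (fresh n m0 k0 h `` {v}) < 8}
     \<le> entry * measure_pmf.prob (rounds n a \<sigma> r) {h. fdeg n h v \<le> k0}"
proof -
  let ?M = "rounds n a \<sigma> r"
  have "expec (rounds n a \<sigma> (0 + r)) (excess v a) \<le> 1 ^ r * expec (rounds n a \<sigma> 0) (excess v a)"
  proof (rule expec_rounds_supermartingale[OF \<sigma>, where P = "excess v"])
    show "(0 + r) * (a + 1) \<le> n choose 2" using r by simp
  next
    fix i h assume h: "i < a" "valid n h" "length h < (0 + r) * (a + 1)"
    have ne: "free n h \<noteq> {}" using free_nonempty[OF h(2)] h(3) r by simp
    have "real (card (Range (fresh n m0 k0 h))) * (real (n - 1) - real k0)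
      \<le> 8 * card {v. v < n \<and> fdeg n h v \<le> k0} * (real (n - 1) - real k0)"
      using card_Range_fresh[OF h(2), of m0 k0] k0 by (intro mult_right_mono) (auto simp: of_nat_mono[of _ "8 * _", simplified])
    also have "\<dots> \<le> 16 * length h" using card_low_degree[OF h(2), of k0] by (simp only: of_nat_mult of_nat_numeral mult.assoc)
    also have "\<dots> \<le> 16 * real (r * (a + 1))"
    proof -
      have "length h \<le> r * (a + 1)" using h(3) by simp
      then show ?thesis using of_nat_mono[of "length h" "r * (a + 1)", where 'a = real] by simp
    qed
    also have "\<dots> \<le> lam * m0 * (real (n - 1) - real k0)" by (rule q)
    finally have "real (card (Range (fresh n m0 k0 h))) \<le> lam * m0"
      using k0 by (simp add: mult_le_cancel_right)
    from excess_maker[OF h(2) ne h(1) this]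
    show "(\<Sum>e\<in>free n h. excess v i ((Maker, e) # h)) \<le> card (free n h) * excess v (Suc i) h" .
  next
    fix e h assume "e \<in> free n h"
    then show "excess v a ((Breaker, e) # h) \<le> 1 * excess v 0 h" using excess_breaker by simp
  qed simp
  also have "\<dots> \<le> 0"
  proof -
    have "{e \<in> complete_edges n. v \<in> e} = (\<lambda>w. {v, w}) ` ({0..<n} - {v})"
      using v by (auto elim!: edge_other_end) (auto simp: complete_edges_def)
    moreover have "inj_on (\<lambda>w. {v, w}) ({0..<n} - {v})" by (auto simp: inj_on_def doubleton_eq_iff)
    ultimately have "fdeg n [] v = n - 1" using v by (simp add: fdeg_def card_image)
    then show ?thesis using k0 by (simp add: vertex_excess_def)
  qed
  finally have le0: "expec ?M (excess v a) \<le> 0" by simp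
  have "expec ?M (\<lambda>h. lam ^ 7 * of_bool (fdeg n h v < m0 \<and> card (fresh n m0 k0 h `` {v}) < 8)
      - entry * of_bool (fdeg n h v \<le> k0)) \<le> expec ?M (excess v a)"
  proof (rule expec_mono)
    fix h
    have "lam ^ 7 \<le> lam ^ j" if "j < 8" for j using lam that by (intro power_decreasing) auto
    then show "lam ^ 7 * of_bool (fdeg n h v < m0 \<and> card (fresh n m0 k0 h `` {v}) < 8)
      - entry * of_bool (fdeg n h v \<le> k0) \<le> excess v a h"
      using k0 lam by (auto simp: vertex_excess_def vertex_weight_def exposure_def)
  qed simp
  moreover have "expec ?M (\<lambda>h. lam ^ 7 * of_bool (fdeg n h v < m0 \<and> card (fresh n m0 k0 h `` {v}) < 8)
      - entry * of_bool (fdeg n h v \<le> k0))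
     = lam ^ 7 * expec ?M (\<lambda>h. of_bool (fdeg n h v < m0 \<and> card (fresh n m0 k0 h `` {v}) < 8))
       - entry * expec ?M (\<lambda>h. of_bool (fdeg n h v \<le> k0))"
    by (subst Bochner_Integration.integral_diff) (auto intro!: integrable_measure_pmf_finite)
  ultimately show ?thesis using le0 unfolding prob_eq_expec by linarith
qed

text \<open>Summing over all vertices turns the right-hand side of the previous lemma into the expected number of
  vertices with at most \<open>k0\<close> free edges, which is bounded by counting claimed edges
  (\<open>card_low_degree\<close>).\<close>

lemma starved_prob:
  assumes \<sigma>: "breaker_strategy n \<sigma>" and r: "r * (a + 1) \<le> n choose 2"
    and q: "16 * real (r * (a + 1)) \<le> lam * m0 * (real (n - 1) - real k0)" and k0: "k0 < n - 1" "m0 \<le> k0 + 1"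
  shows "measure_pmf.prob (rounds n a \<sigma> r) {h. \<exists>v<n. fdeg n h v < m0 \<and> card (fresh n m0 k0 h `` {v}) < 8}
     \<le> entry / lam ^ 7 * (2 * real (r * (a + 1)) / (real (n - 1) - real k0))"
proof -
  let ?M = "rounds n a \<sigma> r"
  define B where "B v = {h. fdeg n h v < m0 \<and> card (fresh n m0 k0 h `` {v}) < 8}" for v
  have "(\<Sum>v<n. expec ?M (\<lambda>h. of_bool (fdeg n h v \<le> k0))) = expec ?M (\<lambda>h. \<Sum>v<n. of_bool (fdeg n h v \<le> k0))"
    by (rule Bochner_Integration.integral_sum[symmetric]) (auto intro!: integrable_measure_pmf_finite)
  also have "\<dots> \<le> expec ?M (\<lambda>h. 2 * real (r * (a + 1)) / (real (n - 1) - real k0))"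
  proof (rule expec_mono)
    fix h assume "h \<in> set_pmf ?M"
    from rounds_valid[OF \<sigma> r this] have h: "valid n h" "length h = r * (a + 1)" by auto
    have "(\<Sum>v<n. of_bool (fdeg n h v \<le> k0)) = real (card {v. v < n \<and> fdeg n h v \<le> k0})"
      by (simp add: of_bool_def sum.If_cases Int_def)
    moreover have "real (card {v. v < n \<and> fdeg n h v \<le> k0}) \<le> 2 * real (length h) / (real (n - 1) - real k0)"
      using card_low_degree[OF h(1), of k0] k0 by (subst pos_le_divide_eq) auto
    ultimately show "(\<Sum>v<n. of_bool (fdeg n h v \<le> k0)) \<le> 2 * real (r * (a + 1)) / (real (n - 1) - real k0)"
      using h(2) by simp
  qed simp
  finally have few: "(\<Sum>v<n. expec ?M (\<lambda>h. of_bool (fdeg n h v \<le> k0))) \<le> 2 * real (r * (a + 1)) / (real (n - 1) - real k0)"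
    by simp
  have "lam ^ 7 * measure_pmf.prob ?M {h. \<exists>v<n. fdeg n h v < m0 \<and> card (fresh n m0 k0 h `` {v}) < 8}
     = lam ^ 7 * measure_pmf.prob ?M (\<Union>v\<in>{..<n}. B v)"
    by (rule arg_cong[where f = "\<lambda>A. lam ^ 7 * measure_pmf.prob ?M A"]) (auto simp: B_def)
  also have "\<dots> \<le> lam ^ 7 * (\<Sum>v<n. measure_pmf.prob ?M (B v))"
    using lam by (intro mult_left_mono measure_pmf.finite_measure_subadditive_finite) auto
  also have "\<dots> = (\<Sum>v<n. lam ^ 7 * measure_pmf.prob ?M (B v))" by (rule sum_distrib_left)
  also have "\<dots> \<le> (\<Sum>v<n. entry * measure_pmf.prob ?M {h. fdeg n h v \<le> k0})"
    unfolding B_def by (intro sum_mono starved_vertex_prob assms) auto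
  also have "\<dots> = entry * (\<Sum>v<n. expec ?M (\<lambda>h. of_bool (fdeg n h v \<le> k0)))"
    by (simp add: sum_distrib_left prob_eq_expec)
  also have "\<dots> \<le> entry * (2 * real (r * (a + 1)) / (real (n - 1) - real k0))"
    by (rule mult_left_mono[OF few]) (simp add: entry_weight_def)
  finally have "measure_pmf.prob ?M {h. \<exists>v<n. fdeg n h v < m0 \<and> card (fresh n m0 k0 h `` {v}) < 8} * lam ^ 7
     \<le> entry * (2 * real (r * (a + 1)) / (real (n - 1) - real k0))"
    by (subst mult.commute)
  moreover have "0 < lam ^ 7" using lam by simp
  ultimately have "measure_pmf.prob ?M {h. \<exists>v<n. fdeg n h v < m0 \<and> card (fresh n m0 k0 h `` {v}) < 8}
     \<le> (entry * (2 * real (r * (a + 1)) / (real (n - 1) - real k0))) / lam ^ 7"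
    by (rule pos_le_divide_eq[THEN iffD2, rotated])
  also have "\<dots> = entry / lam ^ 7 * (2 * real (r * (a + 1)) / (real (n - 1) - real k0))"
    by (rule times_divide_eq_left[symmetric])
  finally show ?thesis .
qed

end

section \<open>Expansion of Maker's graph\<close>

lemma card_free_le: "valid n h \<Longrightarrow> real (card (free n h)) \<le> (real n)\<^sup>2 / 2"
proof -
  assume "valid n h"
  from card_free[OF this] have "card (free n h) \<le> n choose 2" by linarith
  then have "real (card (free n h)) \<le> n choose 2" by (rule of_nat_mono)
  also have "\<dots> \<le> (real n)\<^sup>2 / 2" by (simp add: real_choose_2 power2_eq_square mult_left_mono)
  finally show ?thesis .
qed

lemma shrink_factor:
  fixes F m :: real and n :: nat
  assumes "0 \<le> m" "0 \<le> F" "F \<le> (real n)\<^sup>2 / 2" "n > 0"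
  shows "F - m \<le> F * exp (- (2 * m / (real n)\<^sup>2))"
proof -
  have "F * (2 * m / (real n)\<^sup>2) \<le> (real n)\<^sup>2 / 2 * (2 * m / (real n)\<^sup>2)"
    using assms by (intro mult_right_mono) auto
  also have "\<dots> = m" using assms by simp
  finally have "F - m \<le> F * (1 + - (2 * m / (real n)\<^sup>2))" by (simp add: algebra_simps)
  also have "\<dots> \<le> F * exp (- (2 * m / (real n)\<^sup>2))"
    using assms by (intro mult_left_mono exp_ge_add_one_self) auto
  finally show ?thesis .
qed

text \<open>\<open>D\<close> is a set of edges that Maker should not miss completely. Breaker can empty \<open>D\<close> himself, so the event
  includes a condition \<open>Q\<close> on the history under which at least \<open>m\<close> edges of \<open>D\<close> are still free. \<open>Q\<close> can only be
  lost in the course of the game; if it holds at the end it has held all the time.\<close>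

lemma missed_edges_prob:
  assumes \<sigma>: "breaker_strategy n \<sigma>" and r: "r * (a + 1) \<le> n choose 2" and m: "0 \<le> m" and n: "n > 0"
    and Q: "\<And>p e h. Q ((p, e) # h) \<Longrightarrow> e \<in> free n h \<Longrightarrow> Q h"
    and free: "\<And>h. valid n h \<Longrightarrow> length h < r * (a + 1) \<Longrightarrow> Q h \<Longrightarrow> claimed Maker h \<inter> D = {} \<Longrightarrow>
      m \<le> real (card (free n h \<inter> D))"
  shows "measure_pmf.prob (rounds n a \<sigma> r) {h. Q h \<and> claimed Maker h \<inter> D = {}}
     \<le> exp (- (2 * m / (real n)\<^sup>2)) ^ (a * r)"
proof -
  define \<Psi> where "\<Psi> h = (of_bool (Q h \<and> claimed Maker h \<inter> D = {}) :: real)" for h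
  have "expec (rounds n a \<sigma> (0 + r)) \<Psi> \<le> exp (- (2 * m / (real n)\<^sup>2)) ^ (a * r) * expec (rounds n a \<sigma> 0) \<Psi>"
  proof (rule expec_rounds_geometric[OF \<sigma>])
    show "(0 + r) * (a + 1) \<le> n choose 2" using r by simp
  next
    fix h assume h: "valid n h" "length h < (0 + r) * (a + 1)"
    let ?F = "free n h"
    show "(\<Sum>e\<in>?F. \<Psi> ((Maker, e) # h)) \<le> card ?F * (exp (- (2 * m / (real n)\<^sup>2)) * \<Psi> h)"
    proof (cases "Q h \<and> claimed Maker h \<inter> D = {}")
      case False
      then have "\<Psi> ((Maker, e) # h) = 0" if "e \<in> ?F" for e using Q that by (auto simp: \<Psi>_def)
      then have "(\<Sum>e\<in>?F. \<Psi> ((Maker, e) # h)) = 0" by simp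
      moreover have "\<Psi> h = 0" using False by (simp add: \<Psi>_def)
      ultimately show ?thesis by simp
    next
      case True
      have "(\<Sum>e\<in>?F. \<Psi> ((Maker, e) # h)) \<le> (\<Sum>e\<in>?F. of_bool (e \<notin> D))"
        by (intro sum_mono) (auto simp: \<Psi>_def)
      also have "\<dots> = real (card (?F - D))" by (simp add: of_bool_def sum.If_cases Diff_eq Collect_neg_eq)
      also have "\<dots> = real (card ?F) - card (?F \<inter> D)"
        by (simp add: card_Diff_subset_Int of_nat_diff card_mono)
      also have "\<dots> \<le> real (card ?F) - m" using free[OF h(1)] h(2) True by simp
      also have "\<dots> \<le> card ?F * exp (- (2 * m / (real n)\<^sup>2))"
        using m n card_free_le[OF h(1)] by (intro shrink_factor) auto
      finally show ?thesis using True by (simp add: \<Psi>_def)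
    qed
  next
    fix e h assume "e \<in> free n h"
    then show "\<Psi> ((Breaker, e) # h) \<le> \<Psi> h" using Q by (auto simp: \<Psi>_def)
  qed simp
  also have "\<dots> \<le> exp (- (2 * m / (real n)\<^sup>2)) ^ (a * r) * 1"
    by (intro mult_left_mono) (auto simp: \<Psi>_def)
  finally show ?thesis unfolding prob_eq_expec \<Psi>_def by simp
qed

lemma free_edges_leaving:
  assumes S: "S \<subseteq> {0..<n}" "T \<subseteq> {0..<n}" "card S = s" "card T \<le> t"
    and deg: "\<And>v. v \<in> S \<Longrightarrow> fdeg n h v \<ge> m0"
  shows "real s * (real m0 - real (s + t)) \<le> card (free n h \<inter> {e. e \<inter> S \<noteq> {} \<and> \<not> e \<subseteq> S \<union> T})"
proof -
  have fin: "finite S" "finite T" using S finite_subset by blast+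
  define L where "L v = {e \<in> free n h. v \<in> e \<and> \<not> e \<subseteq> S \<union> T}" for v
  have one: "real m0 - real (s + t) \<le> card (L v)" if v: "v \<in> S" for v
  proof -
    have "{e \<in> free n h. v \<in> e} \<subseteq> L v \<union> (\<lambda>w. {v, w}) ` (S \<union> T)"
    proof safe
      fix e assume e: "e \<in> free n h" "v \<in> e" "e \<notin> (\<lambda>w. {v, w}) ` (S \<union> T)"
      have "e \<in> complete_edges n" using e free_subset by blast
      then obtain w where "e = {v, w}" using e(2) by (metis edge_other_end)
      then show "e \<in> L v" using e v by (auto simp: L_def)
    qed
    then have "fdeg n h v \<le> card (L v \<union> (\<lambda>w. {v, w}) ` (S \<union> T))"
      unfolding fdeg_def using fin by (intro card_mono) (auto simp: L_def)
    also have "\<dots> \<le> card (L v) + card ((\<lambda>w. {v, w}) ` (S \<union> T))" by (rule card_Un_le)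
    also have "card ((\<lambda>w. {v, w}) ` (S \<union> T)) \<le> card (S \<union> T)" using fin by (intro card_image_le) auto
    also have "card (S \<union> T) \<le> s + t" using card_Un_le[of S T] S by simp
    finally show ?thesis using deg[OF v] by linarith
  qed
  have "real s * (real m0 - real (s + t)) = (\<Sum>v\<in>S. real m0 - real (s + t))" using S by simp
  also have "\<dots> \<le> (\<Sum>v\<in>S. real (card (L v)))" using one by (intro sum_mono) auto
  also have "\<dots> = card (\<Union>v\<in>S. L v)"
  proof -
    have "L v \<inter> L w = {}" if "v \<in> S" "w \<in> S" "v \<noteq> w" for v w
    proof (rule ccontr)
      assume "L v \<inter> L w \<noteq> {}"
      then obtain e where e: "e \<in> free n h" "v \<in> e" "w \<in> e" "\<not> e \<subseteq> S \<union> T" by (auto simp: L_def)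
      have "e \<in> complete_edges n" using e free_subset by blast
      then obtain w' where "e = {v, w'}" using e(2) by (metis edge_other_end)
      then show False using e that by auto
    qed
    then have "card (\<Union>v\<in>S. L v) = (\<Sum>v\<in>S. card (L v))"
      using fin by (intro card_UN_disjoint) (auto simp: L_def)
    then show ?thesis by simp
  qed
  also have "\<dots> \<le> card (free n h \<inter> {e. e \<inter> S \<noteq> {} \<and> \<not> e \<subseteq> S \<union> T})"
    by (intro of_nat_mono card_mono) (auto simp: L_def)
  finally show ?thesis .
qed

text \<open>Free degrees never increase, so the lower bound \<open>m0\<close> at the end holds at all earlier times as well, and \<open>S\<close> has
  always had many free edges that leave \<open>S \<union> T\<close>.\<close>

lemma nbrs_trapped_prob:
  assumes \<sigma>: "breaker_strategy n \<sigma>" and r: "r * (a + 1) \<le> n choose 2" and n: "n > 0"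
    and S: "S \<subseteq> {0..<n}" "T \<subseteq> {0..<n}" "card S = s" "card T \<le> t" "s + t \<le> m0"
  shows "measure_pmf.prob (rounds n a \<sigma> r)
      {h. (\<forall>v\<in>S. fdeg n h v \<ge> m0) \<and> nbrs n (claimed Maker h) S \<subseteq> T}
     \<le> exp (- (2 * (s * (real m0 - real (s + t))) / (real n)\<^sup>2)) ^ (a * r)"
proof -
  define Q where "Q h \<longleftrightarrow> (\<forall>v\<in>S. fdeg n h v \<ge> m0)" for h
  define D where "D = {e \<in> complete_edges n. e \<inter> S \<noteq> {} \<and> \<not> e \<subseteq> S \<union> T}"
  have A: "measure_pmf.prob (rounds n a \<sigma> r) {h. Q h \<and> claimed Maker h \<inter> D = {}}
     \<le> exp (- (2 * (s * (real m0 - real (s + t))) / (real n)\<^sup>2)) ^ (a * r)"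
  proof (rule missed_edges_prob[OF \<sigma> r _ n])
    show "0 \<le> real s * (real m0 - real (s + t))" using S by simp
    fix p e h assume "Q ((p, e) # h)" "e \<in> free n h"
    then show "Q h" unfolding Q_def by (fastforce simp: fdeg_Cons split: if_splits)
  next
    fix h assume "Q h"
    then have "real s * (real m0 - real (s + t)) \<le> card (free n h \<inter> {e. e \<inter> S \<noteq> {} \<and> \<not> e \<subseteq> S \<union> T})"
      by (intro free_edges_leaving S) (auto simp: Q_def)
    also have "free n h \<inter> {e. e \<inter> S \<noteq> {} \<and> \<not> e \<subseteq> S \<union> T} = free n h \<inter> D"
      using free_subset by (auto simp: D_def)
    finally show "real s * (real m0 - real (s + t)) \<le> card (free n h \<inter> D)" .
  qed
  have B: "{h. (\<forall>v\<in>S. fdeg n h v \<ge> m0) \<and> nbrs n (claimed Maker h) S \<subseteq> T} \<subseteq>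
     {h. Q h \<and> claimed Maker h \<inter> D = {}}"
  proof safe
    fix h assume h: "\<forall>v\<in>S. fdeg n h v \<ge> m0" "nbrs n (claimed Maker h) S \<subseteq> T"
    show "Q h" using h by (simp add: Q_def)
    fix e assume e: "e \<in> claimed Maker h" "e \<in> D"
    then obtain v where v: "v \<in> S" "v \<in> e" "e \<in> complete_edges n" "\<not> e \<subseteq> S \<union> T" by (auto simp: D_def)
    then obtain w where w: "e = {v, w}" "w < n" by (metis edge_other_end)
    then have "w \<notin> S" "w \<notin> T" using v by auto
    then have "w \<in> nbrs n (claimed Maker h) S" using v w e by (auto simp: nbrs_def)
    then show "e \<in> {}" using h \<open>w \<notin> T\<close> by auto
  qed
  have "measure_pmf.prob (rounds n a \<sigma> r) {h. (\<forall>v\<in>S. fdeg n h v \<ge> m0) \<and> nbrs n (claimed Maker h) S \<subseteq> T}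
     \<le> measure_pmf.prob (rounds n a \<sigma> r) {h. Q h \<and> claimed Maker h \<inter> D = {}}"
    by (rule measure_pmf.finite_measure_mono[OF B]) simp
  with A show ?thesis by (rule order.trans[rotated])
qed

lemma prob_Union_le:
  assumes "finite I" "{h. Q h} \<subseteq> (\<Union>i\<in>I. A i)" "\<And>i. i \<in> I \<Longrightarrow> measure_pmf.prob M (A i) \<le> b i"
  shows "measure_pmf.prob M {h. Q h} \<le> (\<Sum>i\<in>I. b i)"
proof -
  have "measure_pmf.prob M {h. Q h} \<le> measure_pmf.prob M (\<Union>i\<in>I. A i)"
    using assms(2) by (intro measure_pmf.finite_measure_mono) auto
  also have "\<dots> \<le> (\<Sum>i\<in>I. measure_pmf.prob M (A i))"
    by (intro measure_pmf.finite_measure_subadditive_finite assms) auto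
  also have "\<dots> \<le> (\<Sum>i\<in>I. b i)" using assms by (intro sum_mono) auto
  finally show ?thesis .
qed

text \<open>Union bound over \<open>S\<close> and over a set \<open>T\<close> of \<open>7 * card S\<close> vertices that contains its neighbours. For
  \<open>card S = s\<close> there are at most \<open>n ^ (8 * s)\<close> such pairs, and the bound for the probability of one pair is
  an \<open>s\<close>-th power as well.\<close>

lemma poor_expansion_prob:
  assumes \<sigma>: "breaker_strategy n \<sigma>" and r: "r * (a + 1) \<le> n choose 2" and n: "n > 0"
    and k: "8 * k \<le> m0" "7 * k \<le> n"
    and z: "n ^ 8 * exp (- (2 * (real m0 - 8 * real k) / (real n)\<^sup>2)) ^ (a * r) \<le> z" "z \<le> 1"
  shows "measure_pmf.prob (rounds n a \<sigma> r)
      {h. \<exists>S\<subseteq>{0..<n}. S \<noteq> {} \<and> card S \<le> k \<and> (\<forall>v\<in>S. fdeg n h v \<ge> m0) \<and>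
            card (nbrs n (claimed Maker h) S) < 7 * card S}
     \<le> k * z"
proof -
  define U where "U s = {S. S \<subseteq> {0..<n} \<and> card S = s}" for s
  have finU: "finite (U s)" for s unfolding U_def by simp
  have cU: "card (U s) \<le> n ^ s" for s
  proof (cases "s \<le> n")
    case True
    have "card (U s) = n choose s" unfolding U_def using n_subsets[of "{0..<n}" s] by simp
    then show ?thesis using binomial_le_pow[OF True] by simp
  next
    case False
    have "card (U s) = n choose s" unfolding U_def using n_subsets[of "{0..<n}" s] by simp
    then show ?thesis using False by (simp add: binomial_eq_0)
  qed
  define I where "I = (SIGMA s:{1..k}. U s \<times> U (7 * s))"
  define A where "A = (\<lambda>(s :: nat, S, T). {h. (\<forall>v\<in>S. fdeg n h v \<ge> m0) \<and> nbrs n (claimed Maker h) S \<subseteq> T})"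
  define x where "x = exp (- (2 * (real m0 - 8 * real k) / (real n)\<^sup>2)) ^ (a * r)"
  have x0: "0 < x" by (simp add: x_def)
  have "measure_pmf.prob (rounds n a \<sigma> r)
      {h. \<exists>S\<subseteq>{0..<n}. S \<noteq> {} \<and> card S \<le> k \<and> (\<forall>v\<in>S. fdeg n h v \<ge> m0) \<and>
            card (nbrs n (claimed Maker h) S) < 7 * card S}
     \<le> (\<Sum>i\<in>I. (\<lambda>(s, S, T). x ^ s) i)"
  proof (rule prob_Union_le)
    show "finite I" unfolding I_def using finU by auto
    show "{h. \<exists>S\<subseteq>{0..<n}. S \<noteq> {} \<and> card S \<le> k \<and> (\<forall>v\<in>S. fdeg n h v \<ge> m0) \<and>
            card (nbrs n (claimed Maker h) S) < 7 * card S} \<subseteq> (\<Union>i\<in>I. A i)"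
    proof
      fix h assume "h \<in> {h. \<exists>S\<subseteq>{0..<n}. S \<noteq> {} \<and> card S \<le> k \<and> (\<forall>v\<in>S. fdeg n h v \<ge> m0) \<and>
            card (nbrs n (claimed Maker h) S) < 7 * card S}"
      then obtain S where S: "S \<subseteq> {0..<n}" "S \<noteq> {}" "card S \<le> k" "\<forall>v\<in>S. fdeg n h v \<ge> m0"
        "card (nbrs n (claimed Maker h) S) < 7 * card S" by blast
      have "nbrs n (claimed Maker h) S \<subseteq> {0..<n}" by (auto simp: nbrs_def)
      moreover have "7 * card S \<le> card {0..<n}" using S k by simp
      ultimately obtain T where T: "nbrs n (claimed Maker h) S \<subseteq> T" "T \<subseteq> {0..<n}" "card T = 7 * card S"
        using exists_subset_between[of "nbrs n (claimed Maker h) S" "7 * card S" "{0..<n}"] S(5) by auto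
      have "finite S" using S(1) finite_subset by blast
      then have "card S \<ge> 1" using S(2) by (simp add: Suc_le_eq card_gt_0_iff)
      then have "(card S, S, T) \<in> I" using S T by (auto simp: I_def U_def)
      moreover have "h \<in> A (card S, S, T)" using S T by (auto simp: A_def)
      ultimately show "h \<in> (\<Union>i\<in>I. A i)" by blast
    qed
  next
    fix i assume "i \<in> I"
    then obtain s S T where i: "i = (s, S, T)" "1 \<le> s" "s \<le> k" "S \<subseteq> {0..<n}" "card S = s"
      "T \<subseteq> {0..<n}" "card T = 7 * s" by (auto simp: I_def U_def)
    have "measure_pmf.prob (rounds n a \<sigma> r) (A i)
      \<le> exp (- (2 * (s * (real m0 - real (s + 7 * s))) / (real n)\<^sup>2)) ^ (a * r)"
      unfolding A_def i(1) prod.case using i k by (intro nbrs_trapped_prob[OF \<sigma> r n]) auto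
    also have "\<dots> \<le> exp (- (s * (2 * (real m0 - 8 * real k) / (real n)\<^sup>2))) ^ (a * r)"
    proof (rule power_mono)
      have "real s * (real m0 - 8 * real k) \<le> s * (real m0 - real (s + 7 * s))"
        using i by (intro mult_left_mono) auto
      then have "2 * (real s * (real m0 - 8 * real k)) / (real n)\<^sup>2 \<le> 2 * (s * (real m0 - real (s + 7 * s))) / (real n)\<^sup>2"
        by (rule divide_right_mono[OF mult_left_mono]) simp_all
      moreover have "s * (2 * (real m0 - 8 * real k) / (real n)\<^sup>2) = 2 * (real s * (real m0 - 8 * real k)) / (real n)\<^sup>2"
        by simp
      ultimately show "exp (- (2 * (s * (real m0 - real (s + 7 * s))) / (real n)\<^sup>2))
        \<le> exp (- (s * (2 * (real m0 - 8 * real k) / (real n)\<^sup>2)))"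
        by (simp only: exp_le_cancel_iff neg_le_iff_le)
    qed simp
    also have "\<dots> = x ^ s"
      unfolding x_def power_mult[symmetric] exp_of_nat_mult[symmetric] by (simp add: mult_ac)
    finally show "measure_pmf.prob (rounds n a \<sigma> r) (A i) \<le> (\<lambda>(s, S, T). x ^ s) i" using i by simp
  qed
  also have "(\<Sum>i\<in>I. (\<lambda>(s, S, T). x ^ s) i) = (\<Sum>s=1..k. \<Sum>ST\<in>U s \<times> U (7 * s). x ^ s)"
    unfolding I_def using finU by (subst sum.Sigma[symmetric]) (auto intro!: sum.cong)
  also have "\<dots> \<le> (\<Sum>s=1..k. z)"
  proof (rule sum_mono)
    fix s assume s: "s \<in> {1..k}"
    have "(\<Sum>ST\<in>U s \<times> U (7 * s). x ^ s) = real (card (U s)) * real (card (U (7 * s))) * x ^ s"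
      by (simp add: card_cartesian_product)
    also have "\<dots> \<le> real (n ^ s) * real (n ^ (7 * s)) * x ^ s"
    proof (intro mult_right_mono mult_mono)
      show "real (card (U s)) \<le> real (n ^ s)" "real (card (U (7 * s))) \<le> real (n ^ (7 * s))"
        by (intro of_nat_mono cU)+
    qed (use x0 in auto)
    also have "\<dots> = (n ^ 8 * x) ^ s"
      by (simp add: power_mult_distrib power_mult[symmetric] power_add[symmetric])
    also have "\<dots> \<le> z ^ s" using z x0 by (intro power_mono) (auto simp: x_def)
    also have "\<dots> \<le> z ^ 1"
    proof (rule power_decreasing)
      have "0 \<le> real n ^ 8 * x" using x0 by simp
      then show "0 \<le> z" using z(1) unfolding x_def by linarith
    qed (use s z in auto)
    finally show "(\<Sum>ST\<in>U s \<times> U (7 * s). x ^ s) \<le> z" by simp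
  qed
  finally show ?thesis by simp
qed

lemma card_claimed_le: "valid n h \<Longrightarrow> card (complete_edges n - free n h) \<le> length h"
proof -
  assume "valid n h"
  from card_free[OF this] have "card (complete_edges n) - card (free n h) = length h"
    by (simp add: card_complete_edges)
  then show ?thesis using card_Diff_subset[of "free n h" "complete_edges n"] free_subset[of n h] by simp
qed

text \<open>Two disjoint sets of \<open>k\<close> vertices span \<open>k\<^sup>2\<close> edges between them. By the last hypothesis at most half of
  them have been claimed, so the estimate holds for every play of Breaker.\<close>

lemma no_cross_edge_prob:
  assumes \<sigma>: "breaker_strategy n \<sigma>" and r: "r * (a + 1) \<le> n choose 2" and n: "n > 0"
    and k: "2 * (r * (a + 1)) \<le> k\<^sup>2"
  shows "measure_pmf.prob (rounds n a \<sigma> r)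
      {h. \<exists>X\<subseteq>{0..<n}. \<exists>Y\<subseteq>{0..<n}. card X = k \<and> card Y = k \<and> X \<inter> Y = {} \<and>
            (\<forall>x\<in>X. \<forall>y\<in>Y. {x, y} \<notin> claimed Maker h)}
     \<le> 4 ^ n * exp (- ((real k)\<^sup>2 / (real n)\<^sup>2)) ^ (a * r)"
proof -
  define I where "I = {(X, Y). X \<subseteq> {0..<n} \<and> Y \<subseteq> {0..<n} \<and> card X = k \<and> card Y = k \<and> X \<inter> Y = {}}"
  have subI: "I \<subseteq> Pow {0..<n} \<times> Pow {0..<n}" by (auto simp: I_def)
  have finI: "finite I" by (rule finite_subset[OF subI]) simp
  have "card I \<le> card (Pow {0..<n} \<times> Pow {0..<n})" by (rule card_mono[OF _ subI]) simp
  also have "\<dots> = 4 ^ n" by (simp add: card_cartesian_product card_Pow flip: power_mult_distrib)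
  finally have cI: "card I \<le> 4 ^ n" .
  define D where "D = (\<lambda>(X, Y). {{x, y} | x y. x \<in> X \<and> y \<in> (Y :: nat set)})"
  have "measure_pmf.prob (rounds n a \<sigma> r)
      {h. \<exists>X\<subseteq>{0..<n}. \<exists>Y\<subseteq>{0..<n}. card X = k \<and> card Y = k \<and> X \<inter> Y = {} \<and>
            (\<forall>x\<in>X. \<forall>y\<in>Y. {x, y} \<notin> claimed Maker h)} \<le> (\<Sum>i\<in>I. exp (- ((real k)\<^sup>2 / (real n)\<^sup>2)) ^ (a * r))"
  proof (rule prob_Union_le[OF finI])
    show "{h. \<exists>X\<subseteq>{0..<n}. \<exists>Y\<subseteq>{0..<n}. card X = k \<and> card Y = k \<and> X \<inter> Y = {} \<and>
            (\<forall>x\<in>X. \<forall>y\<in>Y. {x, y} \<notin> claimed Maker h)} \<subseteq> (\<Union>i\<in>I. {h. True \<and> claimed Maker h \<inter> D i = {}})"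
    proof
      fix h assume "h \<in> {h. \<exists>X\<subseteq>{0..<n}. \<exists>Y\<subseteq>{0..<n}. card X = k \<and> card Y = k \<and> X \<inter> Y = {} \<and>
            (\<forall>x\<in>X. \<forall>y\<in>Y. {x, y} \<notin> claimed Maker h)}"
      then obtain X Y where XY: "X \<subseteq> {0..<n}" "Y \<subseteq> {0..<n}" "card X = k" "card Y = k" "X \<inter> Y = {}"
        "\<forall>x\<in>X. \<forall>y\<in>Y. {x, y} \<notin> claimed Maker h" by blast
      then have "(X, Y) \<in> I" by (simp add: I_def)
      moreover have "claimed Maker h \<inter> D (X, Y) = {}" using XY(6) by (auto simp: D_def)
      ultimately show "h \<in> (\<Union>i\<in>I. {h. True \<and> claimed Maker h \<inter> D i = {}})" by blast
    qed
  next
    fix i assume "i \<in> I"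
    then obtain X Y where i: "i = (X, Y)" and XY: "X \<subseteq> {0..<n}" "Y \<subseteq> {0..<n}" "card X = k" "card Y = k" "X \<inter> Y = {}"
      by (auto simp: I_def)
    have Dsub: "D i \<subseteq> complete_edges n"
    proof
      fix e assume "e \<in> D i"
      then obtain x y where "e = {x, y}" "x \<in> X" "y \<in> Y" by (auto simp: D_def i)
      moreover from this have "x \<noteq> y" using XY by auto
      ultimately show "e \<in> complete_edges n" using XY by (auto simp: complete_edges_def)
    qed
    have cD: "card (D i) = k\<^sup>2"
    proof -
      have "D i = (\<lambda>(x, y). {x, y}) ` (X \<times> Y)" by (auto simp: D_def i)
      moreover have "inj_on (\<lambda>(x, y). {x, y}) (X \<times> Y)"
        using XY(5) by (auto simp: inj_on_def doubleton_eq_iff)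
      ultimately show ?thesis using XY by (simp add: card_image card_cartesian_product power2_eq_square)
    qed
    have "measure_pmf.prob (rounds n a \<sigma> r) {h. True \<and> claimed Maker h \<inter> D i = {}}
      \<le> exp (- (2 * ((real k)\<^sup>2 / 2) / (real n)\<^sup>2)) ^ (a * r)"
    proof (rule missed_edges_prob[OF \<sigma> r _ n])
      fix h assume h: "valid n h" "length h < r * (a + 1)"
      have "card (D i) \<le> card (free n h \<inter> D i) + card (complete_edges n - free n h)"
      proof -
        have "D i \<subseteq> (free n h \<inter> D i) \<union> (complete_edges n - free n h)" using Dsub by auto
        then have "card (D i) \<le> card ((free n h \<inter> D i) \<union> (complete_edges n - free n h))"
          by (intro card_mono) auto
        also have "\<dots> \<le> card (free n h \<inter> D i) + card (complete_edges n - free n h)" by (rule card_Un_le)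
        finally show ?thesis .
      qed
      then have "2 * k\<^sup>2 \<le> 2 * card (free n h \<inter> D i) + k\<^sup>2"
        using card_claimed_le[OF h(1)] h(2) k cD by linarith
      then have "real (k\<^sup>2) \<le> real (2 * card (free n h \<inter> D i))" by (intro of_nat_mono) simp
      then show "(real k)\<^sup>2 / 2 \<le> real (card (free n h \<inter> D i))" by simp
    qed auto
    then show "measure_pmf.prob (rounds n a \<sigma> r) {h. True \<and> claimed Maker h \<inter> D i = {}}
      \<le> exp (- ((real k)\<^sup>2 / (real n)\<^sup>2)) ^ (a * r)" by simp
  qed
  also have "\<dots> = card I * exp (- ((real k)\<^sup>2 / (real n)\<^sup>2)) ^ (a * r)" by simp
  also have "\<dots> \<le> 4 ^ n * exp (- ((real k)\<^sup>2 / (real n)\<^sup>2)) ^ (a * r)"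
  proof (rule mult_right_mono)
    show "real (card I) \<le> 4 ^ n" using of_nat_mono[OF cI, where 'a = real] by simp
  qed simp
  finally show ?thesis .
qed

definition expander :: "nat \<Rightarrow> nat \<Rightarrow> nat set set \<Rightarrow> bool" where
  "expander n k G \<longleftrightarrow> cut_connected n G \<and>
     (\<forall>S\<subseteq>{0..<n}. S \<noteq> {} \<longrightarrow> card S \<le> k \<longrightarrow> 3 * card S \<le> card (nbrs n G S))"

lemma expander_mono: "expander n k G \<Longrightarrow> G \<subseteq> G' \<Longrightarrow> expander n k G'"
proof -
  assume e: "expander n k G" and sub: "G \<subseteq> G'"
  have "card (nbrs n G S) \<le> card (nbrs n G' S)" for S
    by (rule card_mono[OF finite_nbrs nbrs_mono[OF sub]])
  then show ?thesis
    using e cut_connected_mono[OF _ sub] unfolding expander_def by (blast intro: order_trans)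
qed

text \<open>A vertex set that is closed under adjacency, as well as its complement, would have more than \<open>k\<close> vertices by
  expansion, and then the second hypothesis gives an edge between them.\<close>

lemma expanderI:
  assumes exp: "\<And>S. S \<subseteq> {0..<n} \<Longrightarrow> S \<noteq> {} \<Longrightarrow> card S \<le> k \<Longrightarrow> 3 * card S \<le> card (nbrs n G S)"
    and cross: "\<And>X Y. X \<subseteq> {0..<n} \<Longrightarrow> Y \<subseteq> {0..<n} \<Longrightarrow> card X = k \<Longrightarrow> card Y = k \<Longrightarrow> X \<inter> Y = {} \<Longrightarrow>
       \<exists>x\<in>X. \<exists>y\<in>Y. {x, y} \<in> G"
  shows "expander n k G"
proof -
  have small: "\<exists>x\<in>X. \<exists>y. y < n \<and> y \<notin> X \<and> {x, y} \<in> G" if "X \<subseteq> {0..<n}" "X \<noteq> {}" "card X \<le> k" for X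
  proof -
    have "finite X" using that(1) finite_subset by blast
    then have "card X > 0" using that by (simp add: card_gt_0_iff)
    then have "card (nbrs n G X) > 0" using exp[OF that] by linarith
    then show ?thesis by (fastforce simp: card_gt_0_iff nbrs_def)
  qed
  have "cut_connected n G"
    unfolding cut_connected_def
  proof (intro allI impI)
    fix X assume X: "X \<subseteq> {0..<n}" "X \<noteq> {}" "X \<noteq> {0..<n}"
    define Y where "Y = {0..<n} - X"
    have Y: "Y \<subseteq> {0..<n}" "Y \<noteq> {}" using X by (auto simp: Y_def)
    consider "card X \<le> k" | "card Y \<le> k" | "k < card X" "k < card Y" by linarith
    then show "\<exists>x\<in>X. \<exists>y. y < n \<and> y \<notin> X \<and> {x, y} \<in> G"
    proof cases
      case 1 then show ?thesis using small X by blast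
    next
      case 2
      from small[OF Y 2] obtain y x where "y \<in> Y" "x < n" "x \<notin> Y" "{y, x} \<in> G" by blast
      then show ?thesis by (auto simp: Y_def insert_commute intro!: bexI[of _ x] exI[of _ y])
    next
      case 3
      obtain X' where X': "X' \<subseteq> X" "card X' = k" using obtain_subset_with_card_n[of k X] 3 by auto
      obtain Y' where Y': "Y' \<subseteq> Y" "card Y' = k" using obtain_subset_with_card_n[of k Y] 3 by auto
      have "X' \<inter> Y' = {}" using X' Y' by (auto simp: Y_def)
      with cross[of X' Y'] X' Y' X Y obtain x y where "x \<in> X'" "y \<in> Y'" "{x, y} \<in> G" by blast
      moreover from this have "x \<in> X" "y < n" "y \<notin> X" using X' Y' by (auto simp: Y_def)
      ultimately show ?thesis by blast
    qed
  qed
  then show ?thesis using exp by (simp add: expander_def)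
qed

text \<open>The fresh neighbours of different vertices are different, so \<open>S\<close> has \<open>8 * card S\<close> of them, and at most
  \<open>card S\<close> of these lie in \<open>S\<close> itself.\<close>

lemma fresh_nbrs:
  assumes h: "valid n h" and S: "S \<subseteq> {0..<n}" and f: "\<And>v. v \<in> S \<Longrightarrow> card (fresh n m0 k0 h `` {v}) \<ge> 8"
  shows "7 * card S \<le> card (nbrs n (claimed Maker h) S)"
proof -
  have finS: "finite S" using S finite_subset by blast
  have "8 * card S \<le> (\<Sum>v\<in>S. card (fresh n m0 k0 h `` {v}))"
    using sum_mono[of S "\<lambda>_. 8" "\<lambda>v. card (fresh n m0 k0 h `` {v})"] f by simp
  also have "\<dots> = card (\<Union>v\<in>S. fresh n m0 k0 h `` {v})"
    using finS finite_fresh_Image[OF h] fresh_inj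
    by (intro card_UN_disjoint[symmetric]) fastforce+
  also have "\<dots> \<le> card (S \<union> nbrs n (claimed Maker h) S)"
  proof (rule card_mono)
    show "(\<Union>v\<in>S. fresh n m0 k0 h `` {v}) \<subseteq> S \<union> nbrs n (claimed Maker h) S"
    proof safe
      fix v w assume "v \<in> S" "(v, w) \<in> fresh n m0 k0 h" "w \<notin> nbrs n (claimed Maker h) S"
      then show "w \<in> S"
        using fresh_claimed[of v w n m0 k0 h] fresh_less[OF h] unfolding nbrs_def by blast
    qed
  qed (use finS in simp)
  also have "\<dots> \<le> card S + card (nbrs n (claimed Maker h) S)" by (rule card_Un_le)
  finally show ?thesis by simp
qed

text \<open>If \<open>card S1 \<ge> card S2\<close>, then the neighbours of \<open>S1\<close> outside \<open>S2\<close> suffice, since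
  \<open>7 * card S1 - card S2 \<ge> 3 * (card S1 + card S2)\<close>; the other case is symmetric.\<close>

lemma expansion_combine:
  assumes finS: "finite S1" "finite S2" "S1 \<inter> S2 = {}"
    and e: "7 * card S1 \<le> card (nbrs n G S1)" "7 * card S2 \<le> card (nbrs n G S2)"
  shows "3 * card (S1 \<union> S2) \<le> card (nbrs n G (S1 \<union> S2))"
proof -
  have *: "card (nbrs n G A) \<le> card (nbrs n G (A \<union> B)) + card B" if "finite B" for A B
  proof -
    have "nbrs n G A \<subseteq> nbrs n G (A \<union> B) \<union> B" by (auto simp: nbrs_def)
    then have "card (nbrs n G A) \<le> card (nbrs n G (A \<union> B) \<union> B)" using that by (intro card_mono) auto
    also have "\<dots> \<le> card (nbrs n G (A \<union> B)) + card B" by (rule card_Un_le)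
    finally show ?thesis .
  qed
  have "card (S1 \<union> S2) = card S1 + card S2" using finS by (rule card_Un_disjoint)
  then show ?thesis using *[OF finS(2), of S1] *[OF finS(1), of S2] e by (simp add: Un_commute)
qed

lemma expander_from_events:
  assumes h: "valid n h"
    and starved: "\<And>v. v < n \<Longrightarrow> fdeg n h v < m0 \<Longrightarrow> card (fresh n m0 k0 h `` {v}) \<ge> 8"
    and poor: "\<And>S. S \<subseteq> {0..<n} \<Longrightarrow> S \<noteq> {} \<Longrightarrow> card S \<le> k \<Longrightarrow> (\<And>v. v \<in> S \<Longrightarrow> fdeg n h v \<ge> m0) \<Longrightarrow>
            7 * card S \<le> card (nbrs n (claimed Maker h) S)"
    and cross: "\<And>X Y. X \<subseteq> {0..<n} \<Longrightarrow> Y \<subseteq> {0..<n} \<Longrightarrow> card X = k \<Longrightarrow> card Y = k \<Longrightarrow> X \<inter> Y = {} \<Longrightarrow>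
       \<exists>x\<in>X. \<exists>y\<in>Y. {x, y} \<in> claimed Maker h"
  shows "expander n k (claimed Maker h)"
proof (rule expanderI)
  fix S assume S: "S \<subseteq> {0..<n}" "S \<noteq> {}" "card S \<le> k"
  define S1 where "S1 = {v \<in> S. fdeg n h v < m0}"
  define S2 where "S2 = {v \<in> S. fdeg n h v \<ge> m0}"
  have S12: "S = S1 \<union> S2" "S1 \<inter> S2 = {}" by (auto simp: S1_def S2_def)
  have fin: "finite S" using S(1) finite_subset by blast
  then have fin12: "finite S1" "finite S2" using S12 by auto
  have "7 * card S1 \<le> card (nbrs n (claimed Maker h) S1)"
    using S starved by (intro fresh_nbrs[OF h, of _ m0 k0]) (auto simp: S1_def)
  moreover have "7 * card S2 \<le> card (nbrs n (claimed Maker h) S2)"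
  proof (cases "S2 = {}")
    case False
    have "card S2 \<le> card S" using fin by (intro card_mono) (auto simp: S2_def)
    then show ?thesis using S False by (intro poor) (auto simp: S2_def)
  qed simp
  ultimately show "3 * card S \<le> card (nbrs n (claimed Maker h) S)"
    unfolding S12(1) by (intro expansion_combine fin12 S12)
qed (rule cross)

lemma not_expander_prob:
  fixes lam \<beta> z :: real
  assumes \<sigma>: "breaker_strategy n \<sigma>" and r: "r * (a + 1) \<le> n choose 2" and n: "n > 0"
    and lam: "0 < lam" "lam \<le> 1" and \<beta>: "\<beta> \<ge> 0" "\<beta> * (real n)\<^sup>2 / 2 \<le> 1 - 4 * lam"
    and e2: "exp (\<beta> * real (a * n)) \<le> 2"
    and q: "16 * real (r * (a + 1)) \<le> lam * m0 * (real (n - 1) - real k0)" and k0: "k0 < n - 1" "m0 \<le> k0 + 1"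
    and k: "8 * k \<le> m0" "7 * k \<le> n" "2 * (r * (a + 1)) \<le> k\<^sup>2"
    and z: "n ^ 8 * exp (- (2 * (real m0 - 8 * real k) / (real n)\<^sup>2)) ^ (a * r) \<le> z" "z \<le> 1"
  shows "measure_pmf.prob (rounds n a \<sigma> r) {h. \<not> expander n k (claimed Maker h)}
    \<le> entry_weight a m0 k0 \<beta> / lam ^ 7 * (2 * real (r * (a + 1)) / (real (n - 1) - real k0))
      + k * z + 4 ^ n * exp (- ((real k)\<^sup>2 / (real n)\<^sup>2)) ^ (a * r)"
proof -
  let ?M = "rounds n a \<sigma> r"
  let ?A = "{h. \<exists>v<n. fdeg n h v < m0 \<and> card (fresh n m0 k0 h `` {v}) < 8}"
  let ?B = "{h. \<exists>S\<subseteq>{0..<n}. S \<noteq> {} \<and> card S \<le> k \<and> (\<forall>v\<in>S. fdeg n h v \<ge> m0) \<and>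
            card (nbrs n (claimed Maker h) S) < 7 * card S}"
  let ?C = "{h. \<exists>X\<subseteq>{0..<n}. \<exists>Y\<subseteq>{0..<n}. card X = k \<and> card Y = k \<and> X \<inter> Y = {} \<and>
            (\<forall>x\<in>X. \<forall>y\<in>Y. {x, y} \<notin> claimed Maker h)}"
  have "{h. \<not> expander n k (claimed Maker h)} \<inter> set_pmf ?M \<subseteq> ?A \<union> ?B \<union> ?C"
  proof
    fix h assume h: "h \<in> {h. \<not> expander n k (claimed Maker h)} \<inter> set_pmf ?M"
    then have v: "valid n h" using rounds_valid[OF \<sigma> r] by blast
    show "h \<in> ?A \<union> ?B \<union> ?C"
    proof (rule ccontr)
      assume no: "h \<notin> ?A \<union> ?B \<union> ?C"
      have "expander n k (claimed Maker h)"
      proof (rule expander_from_events[OF v])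
        show "8 \<le> card (fresh n m0 k0 h `` {v})" if "v < n" "fdeg n h v < m0" for v
        proof -
          have "\<not> card (fresh n m0 k0 h `` {v}) < 8" using no that by blast
          then show ?thesis by simp
        qed
        show "7 * card S \<le> card (nbrs n (claimed Maker h) S)"
          if "S \<subseteq> {0..<n}" "S \<noteq> {}" "card S \<le> k" "\<And>v. v \<in> S \<Longrightarrow> m0 \<le> fdeg n h v" for S
        proof -
          have "\<not> card (nbrs n (claimed Maker h) S) < 7 * card S" using no that by blast
          then show ?thesis by simp
        qed
        show "\<exists>x\<in>X. \<exists>y\<in>Y. {x, y} \<in> claimed Maker h"
          if "X \<subseteq> {0..<n}" "Y \<subseteq> {0..<n}" "card X = k" "card Y = k" "X \<inter> Y = {}" for X Y
        proof -
          have "h \<notin> ?C" using no by blast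
          then show ?thesis using that by blast
        qed
      qed
      then show False using h by simp
    qed
  qed
  then have "measure_pmf.prob ?M ({h. \<not> expander n k (claimed Maker h)} \<inter> set_pmf ?M)
      \<le> measure_pmf.prob ?M (?A \<union> ?B \<union> ?C)"
    by (rule measure_pmf.finite_measure_mono) simp
  also have "measure_pmf.prob ?M ({h. \<not> expander n k (claimed Maker h)} \<inter> set_pmf ?M)
     = measure_pmf.prob ?M {h. \<not> expander n k (claimed Maker h)}"
    by (rule measure_Int_set_pmf)
  finally have "measure_pmf.prob ?M {h. \<not> expander n k (claimed Maker h)} \<le> measure_pmf.prob ?M (?A \<union> ?B \<union> ?C)" .
  moreover have "measure_pmf.prob ?M (?A \<union> ?B \<union> ?C) \<le> measure_pmf.prob ?M (?A \<union> ?B) + measure_pmf.prob ?M ?C"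
    "measure_pmf.prob ?M (?A \<union> ?B) \<le> measure_pmf.prob ?M ?A + measure_pmf.prob ?M ?B"
    by (rule measure_Un_le; simp)+
  moreover note starved_prob[OF lam \<beta> e2 \<sigma> r q k0] poor_expansion_prob[OF \<sigma> r n k(1,2) z]
    no_cross_edge_prob[OF \<sigma> r n k(3)]
  ultimately show ?thesis by linarith
qed

section \<open>Boosters complete a Hamilton cycle\<close>

text \<open>The potential is \<open>1 / 2\<close> to the power of the length of a longest path. A booster at least halves it (or ends
  the game in Maker's favour), and there are at least \<open>k\<^sup>2 / 4\<close> free boosters among at most \<open>n\<^sup>2 / 2\<close> free edges.\<close>

lemma booster_phase:
  assumes \<sigma>: "breaker_strategy n \<sigma>" and rs: "(r + s) * (a + 1) \<le> n choose 2" and n: "n \<ge> 3"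
    and k: "4 * ((r + s) * (a + 1)) \<le> k\<^sup>2"
  shows "measure_pmf.prob (rounds n a \<sigma> (r + s)) {h. \<not> has_hamilton_cycle n (claimed Maker h)}
    \<le> measure_pmf.prob (rounds n a \<sigma> r) {h. \<not> expander n k (claimed Maker h)}
      + 2 ^ n * exp (- ((real k)\<^sup>2 / (4 * (real n)\<^sup>2))) ^ (a * s)"
proof -
  define L where "L = r * (a + 1)"
  \<comment> \<open>Whether the graph after round \<open>r\<close> is an expander must be a property of the later history, so that
    the potential vanishes on the plays in which it is not; \<open>early h\<close> recovers the history after round \<open>r\<close>.\<close>
  define early where "early h = drop (length h - L) h" for h :: history
  have early_Cons: "early (x # h) = early h" if "L \<le> length h" for x h
    using that by (simp add: early_def Suc_diff_le)
  define good where "good h \<longleftrightarrow> expander n k (claimed Maker (early h))" for h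
  have good_Cons: "good (x # h) \<longleftrightarrow> good h" if "L \<le> length h" for x h
    using early_Cons[OF that] by (simp add: good_def)
  have early_sub: "claimed p (early h) \<subseteq> claimed p h" for p h
    using set_drop_subset[of "length h - L" h] by (auto simp: claimed_def early_def)
  define mp where "mp h = max_path n (claimed Maker h)" for h
  define ham where "ham h \<longleftrightarrow> has_hamilton_cycle n (claimed Maker h)" for h
  define \<Psi> where "\<Psi> h = of_bool (good h \<and> \<not> ham h) * (1 / 2 :: real) ^ mp h" for h
  define M where "M = rounds n a \<sigma> (r + s)"
  have n0: "n > 0" using n by simp
  have A: "measure_pmf.prob M {h. \<not> good h} \<le> measure_pmf.prob (rounds n a \<sigma> r) {h. \<not> expander n k (claimed Maker h)}"
  proof -
    have "expec (rounds n a \<sigma> (r + s)) (\<lambda>h. of_bool (\<not> good h))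
       \<le> 1 ^ (a * s) * expec (rounds n a \<sigma> r) (\<lambda>h. of_bool (\<not> good h))"
      by (rule expec_rounds_geometric[OF \<sigma> rs]) (auto simp: good_Cons L_def)
    also have "\<dots> = expec (rounds n a \<sigma> r) (\<lambda>h. of_bool (\<not> good h))" by simp
    also have "\<dots> \<le> expec (rounds n a \<sigma> r) (\<lambda>h. of_bool (\<not> expander n k (claimed Maker h)))"
    proof (rule expec_mono)
      fix h assume "h \<in> set_pmf (rounds n a \<sigma> r)"
      from rounds_valid[OF \<sigma> _ this] have "length h = L" using rs by (auto simp: L_def algebra_simps)
      then show "of_bool (\<not> good h) \<le> (of_bool (\<not> expander n k (claimed Maker h)) :: real)"
        by (simp add: good_def early_def)
    qed simp
    finally show ?thesis by (simp add: prob_eq_expec M_def)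
  qed
  have B: "expec M \<Psi> \<le> exp (- ((real k)\<^sup>2 / (4 * (real n)\<^sup>2))) ^ (a * s) * expec (rounds n a \<sigma> r) \<Psi>"
    unfolding M_def
  proof (rule expec_rounds_geometric[OF \<sigma> rs])
    fix h assume h: "valid n h" "r * (a + 1) \<le> length h" "length h < (r + s) * (a + 1)"
    let ?F = "free n h"
    have gC: "good ((Maker, e) # h) \<longleftrightarrow> good h" for e using good_Cons h(2) by (simp add: L_def)
    show "(\<Sum>e\<in>?F. \<Psi> ((Maker, e) # h)) \<le> card ?F * (exp (- ((real k)\<^sup>2 / (4 * (real n)\<^sup>2))) * \<Psi> h)"
    proof (cases "good h \<and> \<not> ham h")
      case False
      then have "\<Psi> ((Maker, e) # h) = 0" for e
        using gC has_hamilton_cycle_mono[of n "claimed Maker h" "insert e (claimed Maker h)"]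
        by (auto simp: \<Psi>_def ham_def)
      then have "(\<Sum>e\<in>?F. \<Psi> ((Maker, e) # h)) = 0" by simp
      moreover have "\<Psi> h = 0" using False by (simp add: \<Psi>_def)
      ultimately show ?thesis by simp
    next
      case True
      have exp: "expander n k (claimed Maker h)"
        using True expander_mono[OF _ early_sub] by (auto simp: good_def)
      define B where "B = boosters n (claimed Maker h)"
      have "k\<^sup>2 \<le> 2 * card B" unfolding B_def
        using exp True n by (intro many_boosters) (auto simp: expander_def ham_def)
      have "card B \<le> card (?F \<inter> B) + card (complete_edges n - ?F)"
      proof -
        have "B \<subseteq> (?F \<inter> B) \<union> (complete_edges n - ?F)" by (auto simp: B_def boosters_def)
        then have "card B \<le> card ((?F \<inter> B) \<union> (complete_edges n - ?F))" by (intro card_mono) auto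
        also have "\<dots> \<le> card (?F \<inter> B) + card (complete_edges n - ?F)" by (rule card_Un_le)
        finally show ?thesis .
      qed
      then have "k\<^sup>2 \<le> 4 * card (?F \<inter> B)"
        using card_claimed_le[OF h(1)] h(3) k \<open>k\<^sup>2 \<le> 2 * card B\<close> by linarith
      then have B4: "real (k\<^sup>2) \<le> real (4 * card (?F \<inter> B))" by (intro of_nat_mono)
      have step: "\<Psi> ((Maker, e) # h) \<le> (1 - of_bool (e \<in> B) / 2) * \<Psi> h" if "e \<in> ?F" for e
      proof (cases "e \<in> B")
        case False
        have "mp h \<le> mp ((Maker, e) # h)" unfolding mp_def using n0 by (intro max_path_mono) auto
        then have "(1 / 2 :: real) ^ mp ((Maker, e) # h) \<le> (1 / 2) ^ mp h" by (intro power_decreasing) auto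
        then show ?thesis using True False by (auto simp: \<Psi>_def)
      next
        case eB: True
        show ?thesis
        proof (cases "ham ((Maker, e) # h)")
          case False
          then have "Suc (mp h) \<le> mp ((Maker, e) # h)" using eB by (auto simp: B_def boosters_def mp_def ham_def)
          then have "(1 / 2 :: real) ^ mp ((Maker, e) # h) \<le> (1 / 2) ^ Suc (mp h)" by (intro power_decreasing) auto
          then show ?thesis using True eB by (auto simp: \<Psi>_def)
        next
          case True
          then show ?thesis by (simp add: \<Psi>_def)
        qed
      qed
      have "(\<Sum>e\<in>?F. \<Psi> ((Maker, e) # h)) \<le> (\<Sum>e\<in>?F. (1 - of_bool (e \<in> B) / 2) * \<Psi> h)"
        using step by (rule sum_mono)
      also have "\<dots> = (card ?F - card (?F \<inter> B) / 2) * \<Psi> h"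
      proof -
        have "(\<Sum>e\<in>?F. of_bool (e \<in> B)) = real (card (?F \<inter> B))"
          by (simp add: of_bool_def sum.If_cases)
        then have "(\<Sum>e\<in>?F. 1 - of_bool (e \<in> B) / 2) = real (card ?F) - card (?F \<inter> B) / 2"
          by (simp add: sum_subtractf sum_divide_distrib[symmetric])
        then show ?thesis by (simp add: sum_distrib_right[symmetric])
      qed
      also have "\<dots> \<le> (card ?F * exp (- (2 * ((real k)\<^sup>2 / 8) / (real n)\<^sup>2))) * \<Psi> h"
      proof (rule mult_right_mono)
        have "card ?F - card (?F \<inter> B) / 2 \<le> card ?F - (real k)\<^sup>2 / 8" using B4 by simp
        also have "\<dots> \<le> card ?F * exp (- (2 * ((real k)\<^sup>2 / 8) / (real n)\<^sup>2))"
          using n0 card_free_le[OF h(1)] by (intro shrink_factor) auto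
        finally show "card ?F - card (?F \<inter> B) / 2 \<le> card ?F * exp (- (2 * ((real k)\<^sup>2 / 8) / (real n)\<^sup>2))" .
      qed (simp add: \<Psi>_def)
      also have "2 * ((real k)\<^sup>2 / 8) / (real n)\<^sup>2 = (real k)\<^sup>2 / (4 * (real n)\<^sup>2)" by simp
      finally show ?thesis by (simp add: mult_ac)
    qed
  next
    fix e and h :: history assume h: "r * (a + 1) \<le> length h"
    have "good ((Breaker, e) # h) \<longleftrightarrow> good h" using good_Cons h by (simp add: L_def)
    then show "\<Psi> ((Breaker, e) # h) \<le> \<Psi> h" by (simp add: \<Psi>_def mp_def ham_def)
  qed simp
  have "expec (rounds n a \<sigma> r) \<Psi> \<le> expec (rounds n a \<sigma> r) (\<lambda>h. 1)"
    by (intro expec_mono) (auto simp: \<Psi>_def power_le_one)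
  then have "expec (rounds n a \<sigma> r) \<Psi> \<le> 1" by simp
  then have "exp (- ((real k)\<^sup>2 / (4 * (real n)\<^sup>2))) ^ (a * s) * expec (rounds n a \<sigma> r) \<Psi>
      \<le> exp (- ((real k)\<^sup>2 / (4 * (real n)\<^sup>2))) ^ (a * s) * 1"
    by (intro mult_left_mono) auto
  from order.trans[OF B this] have B1: "expec M \<Psi> \<le> exp (- ((real k)\<^sup>2 / (4 * (real n)\<^sup>2))) ^ (a * s)"
    by (simp only: mult_1_right)
  have C: "measure_pmf.prob M {h. good h \<and> \<not> ham h} \<le> 2 ^ n * expec M \<Psi>"
  proof -
    have "measure_pmf.prob M {h. good h \<and> \<not> ham h} \<le> expec M (\<lambda>h. 2 ^ n * \<Psi> h)"
      unfolding prob_eq_expec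
    proof (rule expec_mono)
      show "finite (set_pmf M)" by (simp add: M_def)
      fix h
      have "(1 / 2 :: real) ^ n \<le> (1 / 2) ^ mp h" unfolding mp_def
        using max_path_le[OF n0] by (intro power_decreasing) auto
      then have "2 ^ n * (1 / 2 :: real) ^ n \<le> 2 ^ n * (1 / 2) ^ mp h" by (intro mult_left_mono) auto
      moreover have "2 ^ n * (1 / 2 :: real) ^ n = 1" by (simp flip: power_mult_distrib)
      ultimately show "of_bool (good h \<and> \<not> ham h) \<le> 2 ^ n * \<Psi> h" by (auto simp: \<Psi>_def)
    qed
    then show ?thesis by simp
  qed
  have "measure_pmf.prob M {h. \<not> ham h} \<le> measure_pmf.prob M ({h. \<not> good h} \<union> {h. good h \<and> \<not> ham h})"
    by (intro measure_pmf.finite_measure_mono) auto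
  also have "\<dots> \<le> measure_pmf.prob M {h. \<not> good h} + measure_pmf.prob M {h. good h \<and> \<not> ham h}"
    by (rule measure_Un_le) auto
  also have "measure_pmf.prob M {h. good h \<and> \<not> ham h} \<le> 2 ^ n * exp (- ((real k)\<^sup>2 / (4 * (real n)\<^sup>2))) ^ (a * s)"
    by (rule order.trans[OF C mult_left_mono[OF B1]]) simp
  finally show ?thesis using A by (simp add: M_def ham_def)
qed

section \<open>The threshold\<close>

lemma sum_atLeastLessThan_real:
  assumes "m \<le> k"
  shows "real (\<Sum>i=m..<k. i) = (real k * (real k - 1) - real m * (real m - 1)) / 2"
  using assms by (induction rule: dec_induct) (auto simp: field_simps)

text \<open>The number \<open>r\<close> of rounds is used twice: after \<open>r\<close> rounds Maker's graph is an expander, and \<open>r\<close> further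
  rounds suffice for the boosters. The choice of \<open>c\<close> gives a fixed pair of sets in \<open>poor_expansion_prob\<close>
  with \<open>card S = s\<close> probability at most \<open>1 / n ^ (10 * s)\<close>, which beats the \<open>n ^ (8 * s)\<close> pairs. \<open>A\<close> is an upper bound for
  the bias and \<open>Lr\<close> one for the number of edges claimed in \<open>r\<close> rounds; the hypotheses \<open>large\<close> hold
  for all large \<open>n\<close>.\<close>

lemma random_maker_fails_prob:
  fixes \<delta> c A :: real and n a r :: nat
  defines "m0 \<equiv> nat \<lceil>\<delta> * n\<rceil>" and "k0 \<equiv> nat \<lfloor>(1 - \<delta>) * n\<rfloor>" and "k \<equiv> nat \<lfloor>\<delta> * n / 16\<rfloor>"
  defines "Lr \<equiv> 2 * c + 2 * A"
  assumes \<sigma>: "breaker_strategy n \<sigma>" and n: "n \<ge> 3" and \<delta>: "0 < \<delta>" "\<delta> \<le> 1 / 16"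
    and a: "1 \<le> a" "real a \<le> A" and r: "c \<le> real (a * r)" "real (a * r) \<le> c + A"
    and c: "c = 10 / \<delta> * n * ln n"
    and large: "2 * Lr \<le> n * (real n - 1) / 2" "8 * Lr \<le> (\<delta> * n / 16 - 1)\<^sup>2"
      "16 * Lr \<le> \<delta> * (\<delta> * n) * (\<delta> * n - 1)" "exp (2 * A / n) \<le> 2" "\<delta> * n \<ge> 16"
      "(1 - 7 * \<delta>) * (real n)\<^sup>2 \<le> (1 - 4 * \<delta>) * (((1 - \<delta>) * n - 1) * ((1 - \<delta>) * n - 2) - (\<delta> * n + 1) * (\<delta> * n))"
  shows "measure_pmf.prob (half_random_game n a \<sigma>) {h. \<not> has_hamilton_cycle n (claimed Maker h)}
    \<le> exp (- ((1 - 7 * \<delta>) * a)) / \<delta> ^ 7 * (2 * Lr / (\<delta> * n - 1)) + 1 / n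
      + 4 ^ n * exp (- ((\<delta> * n / 16 - 1)\<^sup>2 / (real n)\<^sup>2 * c)) + 2 ^ n * exp (- ((\<delta> * n / 16 - 1)\<^sup>2 / (4 * (real n)\<^sup>2) * c))"
proof -
  define \<beta> where "\<beta> = 2 * (1 - 4 * \<delta>) / (real n)\<^sup>2"
  have n0: "real n > 0" "n > 0" "real n \<ge> 3" using n by auto
  have dn0: "0 \<le> \<delta> * n" "0 \<le> (1 - \<delta>) * n" using \<delta> by auto
  have m0: "\<delta> * n \<le> m0" "m0 \<le> \<delta> * n + 1" unfolding m0_def using dn0 by linarith+
  have k0: "(1 - \<delta>) * n - 1 \<le> k0" "k0 \<le> (1 - \<delta>) * n"
    unfolding k0_def using dn0 by linarith+
  have k: "\<delta> * n / 16 - 1 \<le> k" "k \<le> \<delta> * n / 16" unfolding k_def using dn0 by linarith+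
  have c0: "0 \<le> c" unfolding c using \<delta> n0 by simp
  have dn: "\<delta> * n \<le> n / 16" using \<delta> n0 by (simp add: mult_right_mono)
  have Lr: "real (r * (a + 1)) \<le> Lr"
  proof -
    have "r \<le> a * r" using a(1) by simp
    then have "real r \<le> real (a * r)" by (rule of_nat_mono)
    moreover have "real (r * (a + 1)) = real (a * r) + real r" by (simp add: algebra_simps)
    ultimately show ?thesis using r unfolding Lr_def by linarith
  qed
  have ch: "real (n choose 2) = n * (real n - 1) / 2" by (rule real_choose_2)
  have rr: "(r + r) * (a + 1) \<le> n choose 2"
  proof -
    have "real ((r + r) * (a + 1)) = 2 * real (r * (a + 1))" by (simp add: algebra_simps)
    also have "\<dots> \<le> real (n choose 2)" using Lr large(1) unfolding ch by linarith
    finally show ?thesis by (simp only: of_nat_le_iff)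
  qed
  then have r1: "r * (a + 1) \<le> n choose 2" by (simp add: algebra_simps)
  have ksq: "(\<delta> * n / 16 - 1)\<^sup>2 \<le> (real k)\<^sup>2" using k large(5) by (intro power_mono) auto
  have kk: "4 * ((r + r) * (a + 1)) \<le> k\<^sup>2"
  proof -
    have "real (4 * ((r + r) * (a + 1))) = 8 * real (r * (a + 1))" by (simp add: algebra_simps)
    also have "\<dots> \<le> (real k)\<^sup>2" using Lr large(2) ksq by linarith
    also have "\<dots> = real (k\<^sup>2)" by simp
    finally show ?thesis by (simp only: of_nat_le_iff)
  qed
  have gap: "\<delta> * n - 1 \<le> real (n - 1) - real k0"
    using k0(2) n by (simp add: of_nat_diff algebra_simps)
  have gap0: "0 < \<delta> * n - 1" using large(5) by simp
  have q: "16 * real (r * (a + 1)) \<le> \<delta> * m0 * (real (n - 1) - real k0)"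
  proof -
    have "16 * real (r * (a + 1)) \<le> \<delta> * (\<delta> * n) * (\<delta> * n - 1)" using Lr large(3) by linarith
    also have "\<dots> \<le> \<delta> * m0 * (real (n - 1) - real k0)"
      using m0 gap gap0 \<delta> by (intro mult_mono mult_left_mono) auto
    finally show ?thesis .
  qed
  have k0n: "k0 < n - 1" using gap gap0 by linarith
  have mk: "m0 \<le> k0"
  proof -
    have "(1 - \<delta>) * n = n - \<delta> * n" by (simp add: algebra_simps)
    then have "\<delta> * n + 1 \<le> (1 - \<delta>) * n - 1" using dn n0(3) by linarith
    then have "real m0 \<le> real k0" using m0 k0 by linarith
    then show ?thesis by simp
  qed
  have k8: "8 * k \<le> m0"
  proof -
    have "real (8 * k) \<le> real m0" using k m0 large(5) by simp
    then show ?thesis by (simp only: of_nat_le_iff)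
  qed
  have k7: "7 * k \<le> n"
  proof -
    have "7 * real k \<le> real n" using k dn n0 by linarith
    then have "real (7 * k) \<le> real n" by simp
    then show ?thesis by (simp only: of_nat_le_iff)
  qed
  have \<beta>: "0 \<le> \<beta>" "\<beta> * (real n)\<^sup>2 / 2 \<le> 1 - 4 * \<delta>" using \<delta> n0 by (auto simp: \<beta>_def)
  have e2: "exp (\<beta> * real (a * n)) \<le> 2"
  proof -
    have "\<beta> * real (a * n) = 2 * (1 - 4 * \<delta>) * a / n" using n0 by (simp add: \<beta>_def power2_eq_square)
    also have "\<dots> \<le> 2 * 1 * A / n" using a \<delta> n0 by (intro divide_right_mono mult_mono) auto
    finally have "exp (\<beta> * real (a * n)) \<le> exp (2 * A / n)" by simp
    then show ?thesis using large(4) by linarith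
  qed
  have z: "real n ^ 8 * exp (- (2 * (real m0 - 8 * real k) / (real n)\<^sup>2)) ^ (a * r) \<le> 1 / (real n)\<^sup>2"
  proof -
    have "exp (- (2 * (real m0 - 8 * real k) / (real n)\<^sup>2)) ^ (a * r) \<le> exp (- (10 * ln n))"
    proof -
      have "16 * real k \<le> \<delta> * n" using k(2) by simp
      then have d: "\<delta> * n \<le> 2 * (real m0 - 8 * real k)" using m0(1) by simp
      have d0: "\<delta> * n / (real n)\<^sup>2 \<le> 2 * (real m0 - 8 * real k) / (real n)\<^sup>2"
        by (rule divide_right_mono[OF d]) simp
      moreover have "0 \<le> \<delta> * n / (real n)\<^sup>2" using dn0 by simp
      ultimately have "0 \<le> 2 * (real m0 - 8 * real k) / (real n)\<^sup>2" by linarith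
      then have "\<delta> * n / (real n)\<^sup>2 * c \<le> 2 * (real m0 - 8 * real k) / (real n)\<^sup>2 * real (a * r)"
        using mult_mono[OF d0 r(1)] c0 by blast
      moreover have "\<delta> * n / (real n)\<^sup>2 * c = 10 * ln n" using n0 \<delta> by (simp add: c power2_eq_square)
      ultimately show ?thesis by (simp add: exp_of_nat_mult[symmetric] mult.commute)
    qed
    also have "exp (- (10 * ln n)) = 1 / (real n) ^ 10"
      using n0 exp_of_nat_mult[of 10 "ln (real n)"] by (simp add: exp_minus inverse_eq_divide)
    finally have "real n ^ 8 * exp (- (2 * (real m0 - 8 * real k) / (real n)\<^sup>2)) ^ (a * r) \<le> real n ^ 8 * (1 / (real n) ^ 10)"
      by (intro mult_left_mono) auto
    also have "\<dots> = 1 / (real n)\<^sup>2"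
      using n0 by (simp add: divide_simps flip: power_add)
    finally show ?thesis .
  qed
  have z1: "1 / (real n)\<^sup>2 \<le> 1" using n0 by (simp add: divide_le_eq power2_eq_square mult_ge1_I)
  have kz: "k * (1 / (real n)\<^sup>2) \<le> 1 / n"
  proof -
    have "real k \<le> n" using k7 by simp
    then have "k * (1 / (real n)\<^sup>2) \<le> n * (1 / (real n)\<^sup>2)" by (intro mult_right_mono) auto
    then show ?thesis using n0 by (simp add: power2_eq_square)
  qed
  have ew: "entry_weight a m0 k0 \<beta> \<le> exp (- ((1 - 7 * \<delta>) * a))"
  proof -
    have "((1 - \<delta>) * n - 1) * ((1 - \<delta>) * n - 2) - (\<delta> * n + 1) * (\<delta> * n)
        \<le> real k0 * (real k0 - 1) - real m0 * (real m0 - 1)"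
    proof (rule diff_mono)
      have "(1 - \<delta>) * n = n - \<delta> * n" by (simp add: algebra_simps)
      then have "2 \<le> (1 - \<delta>) * n" using dn n0(3) by linarith
      then show "((1 - \<delta>) * n - 1) * ((1 - \<delta>) * n - 2) \<le> real k0 * (real k0 - 1)"
        using k0(1) by (intro mult_mono) linarith+
      have "1 \<le> real m0" using m0(1) large(5) by linarith
      then show "real m0 * (real m0 - 1) \<le> (\<delta> * n + 1) * (\<delta> * n)"
        using m0(2) large(5) by (intro mult_mono) linarith+
    qed
    then have "(1 - 4 * \<delta>) * (((1 - \<delta>) * n - 1) * ((1 - \<delta>) * n - 2) - (\<delta> * n + 1) * (\<delta> * n))
        \<le> (1 - 4 * \<delta>) * (2 * real (\<Sum>i=m0..<k0. i))"
      using \<delta> sum_atLeastLessThan_real[OF mk] by (intro mult_left_mono) auto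
    then have "(1 - 7 * \<delta>) * (real n)\<^sup>2 \<le> (1 - 4 * \<delta>) * (2 * real (\<Sum>i=m0..<k0. i))" using large(6) by linarith
    then have "1 - 7 * \<delta> \<le> (1 - 4 * \<delta>) * (2 * real (\<Sum>i=m0..<k0. i)) / (real n)\<^sup>2"
      by (subst pos_le_divide_eq) (use n0 in simp_all)
    also have "\<dots> = \<beta> * real (\<Sum>i=m0..<k0. i)" unfolding \<beta>_def by simp
    finally have "1 - 7 * \<delta> \<le> \<beta> * real (\<Sum>i=m0..<k0. i)" .
    then have "(1 - 7 * \<delta>) * a \<le> \<beta> * real (\<Sum>i=m0..<k0. i) * a" by (rule mult_right_mono) simp
    then show ?thesis by (simp add: entry_weight_def mult_ac)
  qed
  have t1: "entry_weight a m0 k0 \<beta> / \<delta> ^ 7 * (2 * real (r * (a + 1)) / (real (n - 1) - real k0))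
     \<le> exp (- ((1 - 7 * \<delta>) * a)) / \<delta> ^ 7 * (2 * Lr / (\<delta> * n - 1))"
    using ew \<delta> Lr order.trans[OF of_nat_0_le_iff Lr] gap gap0 by (intro mult_mono divide_right_mono frac_le) auto
  have pw: "exp (- ((real k)\<^sup>2 / x)) ^ (a * r) \<le> exp (- ((\<delta> * n / 16 - 1)\<^sup>2 / x * c))" if "x > 0" for x
  proof -
    have "(\<delta> * n / 16 - 1)\<^sup>2 / x * c \<le> (real k)\<^sup>2 / x * real (a * r)"
      using ksq r c0 that by (intro mult_mono divide_right_mono) auto
    then show ?thesis by (simp add: exp_of_nat_mult[symmetric] mult.commute)
  qed
  have "measure_pmf.prob (half_random_game n a \<sigma>) {h. \<not> has_hamilton_cycle n (claimed Maker h)}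
    \<le> measure_pmf.prob (rounds n a \<sigma> (r + r)) {h. \<not> has_hamilton_cycle n (claimed Maker h)}"
  proof -
    have "r + r \<le> n choose 2"
    proof -
      have "(r + r) * 1 \<le> (r + r) * (a + 1)" by (rule mult_left_mono) auto
      from order.trans[OF this rr] show ?thesis by (simp only: mult_1_right)
    qed
    then have "measure_pmf.prob (rounds n a \<sigma> (r + r)) {h. has_hamilton_cycle n (claimed Maker h)}
      \<le> measure_pmf.prob (half_random_game n a \<sigma>) {h. has_hamilton_cycle n (claimed Maker h)}"
      unfolding half_random_game_def card_complete_edges
      by (intro prob_persistent[OF _ \<sigma>]) (auto elim!: has_hamilton_cycle_mono)
    moreover have "measure_pmf.prob M {h. \<not> has_hamilton_cycle n (claimed Maker h)}
      = 1 - measure_pmf.prob M {h. has_hamilton_cycle n (claimed Maker h)}" for M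
      using measure_pmf.prob_compl[of "{h. has_hamilton_cycle n (claimed Maker h)}" M]
      by (simp add: Compl_eq_Diff_UNIV[symmetric] Collect_neg_eq)
    ultimately show ?thesis by simp
  qed
  also have "\<dots> \<le> measure_pmf.prob (rounds n a \<sigma> r) {h. \<not> expander n k (claimed Maker h)}
      + 2 ^ n * exp (- ((real k)\<^sup>2 / (4 * (real n)\<^sup>2))) ^ (a * r)"
    by (rule booster_phase[OF \<sigma> rr n kk])
  also have "measure_pmf.prob (rounds n a \<sigma> r) {h. \<not> expander n k (claimed Maker h)}
    \<le> entry_weight a m0 k0 \<beta> / \<delta> ^ 7 * (2 * real (r * (a + 1)) / (real (n - 1) - real k0))
      + k * (1 / (real n)\<^sup>2) + 4 ^ n * exp (- ((real k)\<^sup>2 / (real n)\<^sup>2)) ^ (a * r)"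
    by (rule not_expander_prob[OF \<sigma> r1 n0(2) _ _ \<beta> e2 q k0n _ k8 k7 _ z z1])
       (use \<delta> mk kk in \<open>auto simp: algebra_simps\<close>)
  also have "entry_weight a m0 k0 \<beta> / \<delta> ^ 7 * (2 * real (r * (a + 1)) / (real (n - 1) - real k0))
      + k * (1 / (real n)\<^sup>2) + 4 ^ n * exp (- ((real k)\<^sup>2 / (real n)\<^sup>2)) ^ (a * r)
     \<le> exp (- ((1 - 7 * \<delta>) * a)) / \<delta> ^ 7 * (2 * Lr / (\<delta> * n - 1)) + 1 / n
      + 4 ^ n * exp (- ((\<delta> * n / 16 - 1)\<^sup>2 / (real n)\<^sup>2 * c))"
    using n0 by (intro add_mono t1 kz mult_left_mono pw) auto
  also have "2 ^ n * exp (- ((real k)\<^sup>2 / (4 * (real n)\<^sup>2))) ^ (a * r)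
     \<le> 2 ^ n * exp (- ((\<delta> * n / 16 - 1)\<^sup>2 / (4 * (real n)\<^sup>2) * c))"
    using n0 by (intro mult_left_mono pw) auto
  finally show ?thesis by simp
qed

text \<open>The loss of \<open>7 * \<delta>\<close> in the exponent of \<open>random_maker_fails_prob\<close> must be smaller than the gain from
  \<open>\<epsilon>\<close>. With \<open>\<delta> = \<epsilon> / (16 * (1 + \<epsilon>))\<close> the product \<open>(1 - 7 * \<delta>) * (1 + \<epsilon>)\<close> equals \<open>1 + 9 / 16 * \<epsilon>\<close>, and the
  leading error term is of order \<open>ln n\<close> to the power \<open>- 9 / 16 * \<epsilon>\<close>.\<close>

lemma random_maker_wins:
  assumes \<epsilon>: "\<epsilon> > 0" and a: "rounding_of a (\<lambda>n. (1 + \<epsilon>) * ln (ln (real n)))"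
    and \<sigma>: "\<And>n. breaker_strategy n (\<sigma> n)"
  shows "(\<lambda>n. measure_pmf.prob (half_random_game n (a n) (\<sigma> n))
    {h. maker_wins has_hamilton_cycle n h}) \<longlonglongrightarrow> 1"
proof -
  define \<delta> where "\<delta> = \<epsilon> / (16 * (1 + \<epsilon>))"
  have \<delta>: "0 < \<delta>" "\<delta> \<le> 1 / 16" using \<epsilon> by (auto simp: \<delta>_def divide_simps)
  have \<delta>\<epsilon>: "(1 - 7 * \<delta>) * (1 + \<epsilon>) = 1 + 9 / 16 * \<epsilon>"
    using \<epsilon> by (simp add: \<delta>_def divide_simps) (simp add: algebra_simps)
  define A where "A n = (1 + \<epsilon>) * ln (ln (real n)) + 1" for n :: nat
  define c where "c n = 10 / \<delta> * n * ln n" for n :: nat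
  define Lr where "Lr n = 2 * c n + 2 * A n" for n
  define b where "b n = exp (1 - (1 + 9 / 16 * \<epsilon>) * ln (ln n)) / \<delta> ^ 7 * (2 * Lr n / (\<delta> * n - 1)) + 1 / n
      + 4 ^ n * exp (- ((\<delta> * n / 16 - 1)\<^sup>2 / (real n)\<^sup>2 * c n))
      + 2 ^ n * exp (- ((\<delta> * n / 16 - 1)\<^sup>2 / (4 * (real n)\<^sup>2) * c n))" for n :: nat
  have b0: "b \<longlonglongrightarrow> 0"
    unfolding b_def Lr_def c_def A_def using \<epsilon> \<delta> by real_asymp
  have ev: "\<forall>\<^sub>F n in sequentially. 2 * Lr n \<le> n * (real n - 1) / 2"
    "\<forall>\<^sub>F n in sequentially. 8 * Lr n \<le> (\<delta> * n / 16 - 1)\<^sup>2"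
    "\<forall>\<^sub>F n in sequentially. 16 * Lr n \<le> \<delta> * (\<delta> * n) * (\<delta> * n - 1)"
    "\<forall>\<^sub>F n in sequentially. exp (2 * A n / n) \<le> 2"
    "\<forall>\<^sub>F n in sequentially. \<delta> * real n \<ge> 16"
    unfolding Lr_def c_def A_def using \<epsilon> \<delta> by real_asymp+
  have ev6: "\<forall>\<^sub>F n in sequentially. (1 - 7 * \<delta>) * (real n)\<^sup>2 \<le>
     (1 - 4 * \<delta>) * (((1 - \<delta>) * n - 1) * ((1 - \<delta>) * n - 2) - (\<delta> * n + 1) * (\<delta> * n))"
  proof -
    have "(\<lambda>n::nat. (1 - 4 * \<delta>) * ((((1 - \<delta>) * n - 1) * ((1 - \<delta>) * n - 2) - (\<delta> * n + 1) * (\<delta> * n)) / (real n)\<^sup>2))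
       \<longlonglongrightarrow> (1 - 4 * \<delta>) * ((1 - \<delta>) * (1 - \<delta>) - \<delta> * \<delta>)"
      by real_asymp
    moreover have "1 - 7 * \<delta> < (1 - 4 * \<delta>) * ((1 - \<delta>) * (1 - \<delta>) - \<delta> * \<delta>)"
    proof -
      have "(1 - 4 * \<delta>) * ((1 - \<delta>) * (1 - \<delta>) - \<delta> * \<delta>) - (1 - 7 * \<delta>) = \<delta> + 8 * (\<delta> * \<delta>)"
        by (simp add: algebra_simps)
      moreover have "0 < \<delta> + 8 * (\<delta> * \<delta>)" using \<delta> by (intro add_pos_pos mult_pos_pos) auto
      ultimately show ?thesis by linarith
    qed
    ultimately have "\<forall>\<^sub>F n in sequentially. 1 - 7 * \<delta> < (1 - 4 * \<delta>) *
        ((((1 - \<delta>) * n - 1) * ((1 - \<delta>) * n - 2) - (\<delta> * n + 1) * (\<delta> * n)) / (real n)\<^sup>2)"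
      by (rule order_tendstoD(1))
    then show ?thesis using eventually_gt_at_top[of 0]
    proof eventually_elim
      case (elim n)
      then show ?case by (simp add: pos_less_divide_eq less_imp_le)
    qed
  qed
  have ev7: "\<forall>\<^sub>F n in sequentially. (1 + \<epsilon>) * ln (ln (real n)) \<ge> 2" using \<epsilon> by real_asymp
  have "\<forall>\<^sub>F n in sequentially. 1 - b n \<le> measure_pmf.prob (half_random_game n (a n) (\<sigma> n))
    {h. maker_wins has_hamilton_cycle n h}"
    using ev ev6 ev7 eventually_ge_at_top[of 3]
  proof eventually_elim
    case (elim n)
    have aA: "1 \<le> a n" "real (a n) \<le> A n" and al: "(1 + \<epsilon>) * ln (ln (real n)) - 1 \<le> real (a n)"
      using rounding_of_bounds[OF a, of n] elim(7) by (auto simp: A_def)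
    define r where "r = nat \<lceil>c n / a n\<rceil>"
    have c0: "0 \<le> c n" using \<delta> elim(8) by (simp add: c_def)
    have "c n / a n \<le> r" "r \<le> c n / a n + 1" unfolding r_def using divide_nonneg_nonneg[OF c0, of "real (a n)"] by linarith+
    then have r: "c n \<le> real (a n * r)" "real (a n * r) \<le> c n + A n"
      using aA by (auto simp: field_simps)
    note bound = random_maker_fails_prob[OF \<sigma> elim(8) \<delta> aA r c_def elim(1-3)[unfolded Lr_def] elim(4,5,6)]
    have "exp (- ((1 - 7 * \<delta>) * a n)) \<le> exp (1 - (1 + 9 / 16 * \<epsilon>) * ln (ln n))"
    proof -
      have "(1 - 7 * \<delta>) * ((1 + \<epsilon>) * ln (ln (real n)) - 1) \<le> (1 - 7 * \<delta>) * a n"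
        using al \<delta> by (intro mult_left_mono) auto
      then have "(1 - 7 * \<delta>) * (1 + \<epsilon>) * ln (ln (real n)) - 1 \<le> (1 - 7 * \<delta>) * a n"
        using \<delta> by (simp add: right_diff_distrib mult.assoc)
      then show ?thesis unfolding \<delta>\<epsilon> by simp
    qed
    then have "exp (- ((1 - 7 * \<delta>) * a n)) / \<delta> ^ 7 * (2 * Lr n / (\<delta> * n - 1))
       \<le> exp (1 - (1 + 9 / 16 * \<epsilon>) * ln (ln n)) / \<delta> ^ 7 * (2 * Lr n / (\<delta> * n - 1))"
      using \<delta> elim(5) c0 aA by (intro mult_right_mono divide_right_mono) (auto simp: Lr_def)
    then have "measure_pmf.prob (half_random_game n (a n) (\<sigma> n)) {h. \<not> has_hamilton_cycle n (claimed Maker h)} \<le> b n"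
      using bound unfolding b_def Lr_def by linarith
    moreover have "measure_pmf.prob M {h. \<not> has_hamilton_cycle n (claimed Maker h)}
      = 1 - measure_pmf.prob M {h. has_hamilton_cycle n (claimed Maker h)}" for M
      using measure_pmf.prob_compl[of "{h. has_hamilton_cycle n (claimed Maker h)}" M]
      by (simp add: Compl_eq_Diff_UNIV[symmetric] Collect_neg_eq)
    ultimately show ?case by (simp add: maker_wins_def)
  qed
  note lower = this
  have "(\<lambda>n. 1 - b n) \<longlonglongrightarrow> 1" using tendsto_diff[OF tendsto_const b0, of 1] by simp
  from tendsto_sandwich[OF lower _ this tendsto_const] show ?thesis
    by (simp add: always_eventually)
qed

theorem theorem1p5:
  "sharp_threshold_bias has_hamilton_cycle (\<lambda>n. ln (ln (real n)))"
  unfolding sharp_threshold_bias_def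
proof (intro allI impI conjI)
  fix \<epsilon> :: real and a \<sigma>
  assume "0 < \<epsilon>" "rounding_of a (\<lambda>n. (1 + \<epsilon>) * ln (ln (real n)))" "\<forall>n. breaker_strategy n (\<sigma> n)"
  then show "(\<lambda>n. measure_pmf.prob (half_random_game n (a n) (\<sigma> n)) {h. maker_wins has_hamilton_cycle n h}) \<longlonglongrightarrow> 1"
    using random_maker_wins by blast
next
  fix \<epsilon> :: real and a
  assume "0 < \<epsilon>" "rounding_of a (\<lambda>n. (1 - \<epsilon>) * ln (ln (real n)))"
  from attack_beats_random_maker[OF this]
  show "\<exists>\<sigma>. (\<forall>n. breaker_strategy n (\<sigma> n)) \<and>
     (\<lambda>n. measure_pmf.prob (half_random_game n (a n) (\<sigma> n)) {h. \<not> maker_wins has_hamilton_cycle n h}) \<longlonglongrightarrow> 1"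
    using breaker_strategy_attack by (intro exI[of _ attack]) simp
qed

end
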